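(* There exist a constant $K>0$ and a function $\varepsilon(n)\to 0$ (as $n\to\infty$) such that the following holds for every positive integer $n$. Let $M=\binom{n}{\lfloor n/2\rfloor}$ and $s=2^{n}/M$. Then the Boolean lattice $2^{[n]}$ can be partitioned into $M$ chains such that all but at most $n^{-\frac18+\varepsilon(n)}\cdot M$ of these chains $C$ satisfy $\bigl||C|-s\bigr|\le K\,s\,n^{-\frac1{16}}$. (In the paper's notation: all but at most $n^{-\frac18+o(1)}$ proportion of the chains have size $s(1+O(n^{-\frac1{16}}))$.)
   Context: $2^{[n]}$ is the family of all subsets of $[n]=\{1,\dots,n\}$ ordered by inclusion. A chain is a family $x_1\subset x_2\subset\dots\subset x_k$ of pairwise comparable sets; a partition of $2^{[n]}$ into chains means every subset of $[n]$ lies in exactly one of the chains. *)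

theory Defs
  imports Complex_Main "HOL-Library.Disjoint_Sets"
begin

text \<open>
  The blocks of a \<^const>\<open>partition_on\<close> are nonempty and pairwise disjoint, so every subset
  of \<open>[n]\<close> lies in exactly one chain.
\<close>
definition chain_partition :: "nat \<Rightarrow> nat set set set \<Rightarrow> bool" where
  "chain_partition n P \<longleftrightarrow> partition_on (Pow {1..n}) P \<and> (\<forall>C\<in>P. chain\<^sub>\<subseteq> C)"

end

(*
  It suffices to find M chains of size at most s (1 + O(n^(-3/16))), apart from a negligible number
  of elements: the average size is s, so Markov's inequality leaves few chains that are too short.

  By complementation one may work above the middle level. There a partition into chains starting
  in the middle level is an injective map sending each set to a proper subset, and the chains have
  at most H elements if a function with H values strictly increases along this map. By Hall's
  theorem it is enough to give weights on the allowed pairs of total 1 from below at every set and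
  of total at most 1 from above.

  Each set x gets a random phase in {0,...,b-1}, b about n^(3/16), and belongs to the run
  card x - phase. Chains follow a run for b levels and then skip at least 16 levels to a later run;
  the skipping makes the height grow at the rate at which the sizes of the levels add up to
  multiples of M. Inside a run the weights join consecutive levels. Degrees there are only about
  n/b, so a proportion of the order of (n/b)^(-1/2) of the weight is missing and is supplied by
  pairs at least 16 levels apart. Averages over 16 levels are so strongly concentrated (bounded
  differences) that the weights on such pairs can be products, and only the total masses of the
  blocks (level, phase) matter. Masses are moved by shifting intervals on a line; the loads are
  controlled by the log-concavity of the binomial coefficients.
*)

theory Submission
  imports Defs "HOL-Library.FuncSet"
begin

text \<open>The exponents come from balancing one loss. The flow inside runs misses a proportion of
  order sqrt (b / n) at each set. The proportion given up is fixed as \<open>kap b\<close>, of order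
  1 / b^2: summed over the \<open>b\<close> phases of a run this is of order 1 / b, no more than
  what skipping between runs costs anyway. That forces b^5 = O(n). With n = r^16 and b close to r^3
  a factor r is left to absorb constants. Apart from the outer levels, chains then have at most s (1
  + O(1 / b)) elements, and Markov's inequality at relative deviation 54000 / r leaves a proportion
  of at most r / (2 b) <= 1 / r^2 = n^(-1/8) of bad chains; so the exponent needs no correction for
  large n.

  The obstacle is that weights must be valid at each of 2^n sets, whereas sums over n / b neighbours
  in an adjacent level are not concentrated enough for a union bound of that size. Between adjacent
  levels only expectations are therefore made exact; the fluctuations at single sets become residual
  capacities and demands, which only the far pairs see, through sums of order n^16 terms.\<close>

section \<open>Hall's theorem, fractional matchings and paths\<close>

theorem hall_marriage:
  assumes "finite B" "\<And>y. y \<in> B \<Longrightarrow> finite (G y)"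
    and "\<And>Y. Y \<subseteq> B \<Longrightarrow> card Y \<le> card (\<Union>(G ` Y))"
  shows "\<exists>g. inj_on g B \<and> (\<forall>y\<in>B. g y \<in> G y)"
  using assms
proof (induction "card B" arbitrary: B G rule: less_induct)
  case less
  note fin = less.prems(1) and finG = less.prems(2) and hall = less.prems(3)
  have finU: "finite (\<Union>(G ` Y))" if "Y \<subseteq> B" for Y
    using that fin finG by (meson finite_UN finite_subset subsetD)
  show ?case
  proof (cases "B = {}")
    case False
    \<comment> \<open>Either a tight proper subset splits the problem into two independent ones, or
      every nonempty proper subset has a spare neighbour, so that one element may be given any of
      its neighbours.\<close>
    show ?thesis
    proof (cases "\<exists>Y. Y \<noteq> {} \<and> Y \<subset> B \<and> card Y = card (\<Union>(G ` Y))")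
      case True
      then obtain Y where Y: "Y \<noteq> {}" "Y \<subset> B" "card Y = card (\<Union>(G ` Y))"
        by blast
      define X where "X = \<Union>(G ` Y)"
      define H where "H = (\<lambda>y. G y - X)"
      have "card Y < card B"
        by (rule psubset_card_mono[OF fin Y(2)])
      moreover have "card Z \<le> card (\<Union>(G ` Z))" if "Z \<subseteq> Y" for Z
        using hall that Y by blast
      moreover have "finite Y"
        using Y fin finite_subset by blast
      ultimately obtain g1 where g1: "inj_on g1 Y" "\<forall>y\<in>Y. g1 y \<in> G y"
        using less.hyps[of Y G] finG Y by blast
      have "card (B - Y) < card B"
        using Y fin by (intro psubset_card_mono) auto
      moreover have "card Z \<le> card (\<Union>(H ` Z))" if Z: "Z \<subseteq> B - Y" for Z
      proof -
        have "card Z + card Y = card (Z \<union> Y)"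
          using Z Y fin by (intro card_Un_disjoint[symmetric]) (auto intro: finite_subset)
        also have "\<dots> \<le> card (\<Union>(G ` (Z \<union> Y)))"
          using Z Y by (intro hall) auto
        also have "\<Union>(G ` (Z \<union> Y)) = \<Union>(H ` Z) \<union> X"
          by (auto simp: H_def X_def)
        also have "card \<dots> \<le> card (\<Union>(H ` Z)) + card X"
          by (rule card_Un_le)
        finally show ?thesis
          using Y by (simp add: X_def)
      qed
      ultimately obtain g2 where g2: "inj_on g2 (B - Y)" "\<forall>y\<in>B - Y. g2 y \<in> H y"
        using less.hyps[of "B - Y" H] finG fin by (auto simp: H_def)
      define g where "g = (\<lambda>y. if y \<in> Y then g1 y else g2 y)"
      have "inj_on g B"
      proof (rule inj_onI)
        fix u v assume uv: "u \<in> B" "v \<in> B" "g u = g v"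
        have "g1 y \<in> X" if "y \<in> Y" for y
          using g1 that by (auto simp: X_def)
        moreover have "g2 y \<notin> X" if "y \<in> B - Y" for y
          using g2 that by (auto simp: H_def)
        ultimately show "u = v"
          using uv inj_onD[OF g1(1)] inj_onD[OF g2(1)] unfolding g_def
          by (metis DiffI)
      qed
      moreover have "\<forall>y\<in>B. g y \<in> G y"
        using g1 g2 by (auto simp: g_def H_def)
      ultimately show ?thesis
        by blast
    next
      case nt: False
      obtain y0 where y0: "y0 \<in> B"
        using False by blast
      have "card {y0} \<le> card (\<Union>(G ` {y0}))"
        by (intro hall) (use y0 in auto)
      then obtain x0 where x0: "x0 \<in> G y0"
        by fastforce
      define H where "H = (\<lambda>y. G y - {x0})"
      have "card (B - {y0}) < card B"
        by (rule card_Diff1_less[OF fin y0])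
      moreover have "card Z \<le> card (\<Union>(H ` Z))" if Z: "Z \<subseteq> B - {y0}" for Z
      proof (cases "Z = {}")
        case False
        have "Z \<subset> B"
          using Z y0 by blast
        then have "card Z < card (\<Union>(G ` Z))"
          using nt hall[of Z] False by (metis le_neq_implies_less psubset_imp_subset)
        moreover have "\<Union>(H ` Z) = \<Union>(G ` Z) - {x0}"
          by (auto simp: H_def)
        moreover have "finite (\<Union>(G ` Z))"
          using \<open>Z \<subset> B\<close> by (intro finU) auto
        ultimately show ?thesis
          by (auto simp: card_Diff_singleton_if)
      qed simp
      ultimately obtain g2 where g2: "inj_on g2 (B - {y0})" "\<forall>y\<in>B - {y0}. g2 y \<in> H y"
        using less.hyps[of "B - {y0}" H] finG fin by (auto simp: H_def)
      define g where "g = g2(y0 := x0)"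
      have "inj_on g B"
      proof (rule inj_onI)
        fix u v assume uv: "u \<in> B" "v \<in> B" "g u = g v"
        have "g2 y \<noteq> x0" if "y \<in> B - {y0}" for y
          using g2 that by (auto simp: H_def)
        then show "u = v"
          using uv inj_onD[OF g2(1)] unfolding g_def
          by (metis DiffI fun_upd_apply singletonD)
      qed
      moreover have "\<forall>y\<in>B. g y \<in> G y"
        using g2 x0 by (auto simp: g_def H_def)
      ultimately show ?thesis
        by blast
    qed
  qed simp
qed

text \<open>Double counting gives Hall's condition: the demands in \<open>Y\<close> carry total
  weight \<open>card Y\<close>, all of it at neighbours of \<open>Y\<close>, and each neighbour
  carries at most 1. Only pairs of positive weight are matched, so whatever holds on the support of
  \<open>w\<close> holds along \<open>g\<close>.\<close>

corollary fractional_matching: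
  fixes w :: "'a \<Rightarrow> 'b \<Rightarrow> real"
  assumes "finite A" "finite B"
    and nonneg: "\<And>x y. x \<in> A \<Longrightarrow> y \<in> B \<Longrightarrow> 0 \<le> w x y"
    and dem: "\<And>y. y \<in> B \<Longrightarrow> (\<Sum>x\<in>A. w x y) = 1"
    and cap: "\<And>x. x \<in> A \<Longrightarrow> (\<Sum>y\<in>B. w x y) \<le> 1"
  shows "\<exists>g. inj_on g B \<and> (\<forall>y\<in>B. g y \<in> A \<and> 0 < w (g y) y)"
proof -
  define G where "G = (\<lambda>y. {x\<in>A. 0 < w x y})"
  have "\<exists>g. inj_on g B \<and> (\<forall>y\<in>B. g y \<in> G y)"
  proof (rule hall_marriage)
    fix Y assume Y: "Y \<subseteq> B"
    have fY: "finite Y"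
      using Y assms finite_subset by blast
    have sub: "\<Union>(G ` Y) \<subseteq> A"
      by (auto simp: G_def)
    have "real (card Y) = (\<Sum>y\<in>Y. \<Sum>x\<in>A. w x y)"
      using dem Y by (simp add: subset_iff)
    also have "\<dots> = (\<Sum>y\<in>Y. \<Sum>x\<in>\<Union>(G ` Y). w x y)"
    proof (rule sum.cong[OF refl])
      fix y assume y: "y \<in> Y"
      show "(\<Sum>x\<in>A. w x y) = (\<Sum>x\<in>\<Union>(G ` Y). w x y)"
        using assms(1) sub y Y nonneg
        by (intro sum.mono_neutral_right) (auto simp: G_def, force)
    qed
    also have "\<dots> = (\<Sum>x\<in>\<Union>(G ` Y). \<Sum>y\<in>Y. w x y)"
      by (rule sum.swap)
    also have "\<dots> \<le> (\<Sum>x\<in>\<Union>(G ` Y). 1)"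
    proof (rule sum_mono)
      fix x assume "x \<in> \<Union>(G ` Y)"
      then have x: "x \<in> A"
        using sub by blast
      have "(\<Sum>y\<in>Y. w x y) \<le> (\<Sum>y\<in>B. w x y)"
        using Y x nonneg assms(2) by (intro sum_mono2) auto
      then show "(\<Sum>y\<in>Y. w x y) \<le> 1"
        using cap[OF x] by linarith
    qed
    finally show "card Y \<le> card (\<Union>(G ` Y))"
      by simp
  qed (use assms in \<open>auto simp: G_def\<close>)
  then show ?thesis
    by (auto simp: G_def)
qed

text \<open>Following \<open>p\<close> downwards ends in \<open>R\<close>, and injectivity of
  \<open>p\<close> means that paths never branch upwards; hence the sets with a common root form a
  single path. Comparability is expressed by \<open>trancl\<close> so that a function increasing
  along \<open>p\<close>, such as the height, can be compared as well.\<close>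

lemma descending_paths:
  fixes p :: "'a set \<Rightarrow> 'a set" and X :: "'a set set"
  assumes X: "\<And>x. x \<in> X \<Longrightarrow> card x \<le> m" "R \<subseteq> X"
    and inj: "inj_on p (X - R)"
    and p: "\<And>y. y \<in> X - R \<Longrightarrow> p y \<in> X \<and> p y \<subset> y \<and> finite y"
  obtains root where "\<And>z. z \<in> R \<Longrightarrow> root z = z" "\<And>y. y \<in> X \<Longrightarrow> root y \<in> R"
    "\<And>y. y \<in> X \<Longrightarrow> root y \<subseteq> y"
    "\<And>y z. y \<in> X \<Longrightarrow> z \<in> X \<Longrightarrow> root y = root z \<Longrightarrow> y \<noteq> z \<Longrightarrow>
       (z, y) \<in> {(p v, v) |v. v \<in> X - R}\<^sup>+ \<or> (y, z) \<in> {(p v, v) |v. v \<in> X - R}\<^sup>+"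
proof -
  define E where "E = {(p v, v) |v. v \<in> X - R}"
  \<comment> \<open>Stopping at \<open>R\<close> makes \<open>m\<close> steps the right number from
    every set: each step outside \<open>R\<close> lowers the cardinality, and further steps do
    nothing.\<close>
  define q where "q = (\<lambda>y. if y \<in> R then y else p y)"
  have qX: "q y \<in> X" if "y \<in> X" for y
    using that p by (auto simp: q_def)
  have qiX: "(q ^^ i) y \<in> X" if "y \<in> X" for y i
    using that by (induction i) (auto intro: qX)
  have fix1: "(q ^^ i) z = z" if "z \<in> R" for z i
    using that by (induction i) (auto simp: q_def)
  have reach: "(q ^^ i) y \<in> R" if "y \<in> X" "card y \<le> i" for y i
    using that
  proof (induction i arbitrary: y)
    case 0
    then have "y \<in> R"
      using p[of y] psubset_card_mono[of y "p y"] by force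
    then show ?case by simp
  next
    case (Suc i)
    show ?case
    proof (cases "y \<in> R")
      case True
      then show ?thesis using fix1[of y "Suc i"] by simp
    next
      case False
      then have "q y = p y" "p y \<in> X" "card (p y) < card y"
        using p[of y] Suc.prems psubset_card_mono[of y "p y"] by (auto simp: q_def)
      then show ?thesis
        using Suc.IH[of "p y"] Suc.prems by (simp add: funpow_swap1)
    qed
  qed
  define root where "root = (\<lambda>y. (q ^^ m) y)"
  have rootR: "root y \<in> R" if "y \<in> X" for y
    unfolding root_def using that X by (intro reach) auto
  have root_q: "root (q y) = root y" if "y \<in> X" for y
  proof -
    have "root (q y) = q (root y)"
      by (simp add: root_def funpow_swap1)
    also have "\<dots> = root y"
      using rootR[OF that] by (simp add: q_def)
    finally show ?thesis .
  qed
  have qsub: "q y \<subseteq> y" if "y \<in> X" for y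
    using that p[of y] by (auto simp: q_def)
  have sub: "(q ^^ i) y \<subseteq> y" if "y \<in> X" for y i
    using that
  proof (induction i)
    case (Suc i)
    then show ?case
      using qsub[of "(q ^^ i) y"] qiX[of y i] by auto
  qed simp
  have stepE: "(q y, y) \<in> E" if "y \<in> X - R" for y
    using that by (auto simp: E_def q_def)
  have key: "(z, y) \<in> E\<^sup>* \<or> (y, z) \<in> E\<^sup>*"
    if "y \<in> X" "z \<in> X" "root y = root z" for y z
    using that
  proof (induction "card y + card z" arbitrary: y z rule: less_induct)
    case less
    have toroot: "(root v, v) \<in> E\<^sup>*" if "v \<in> X" for v
    proof -
      have "((q ^^ i) v, v) \<in> E\<^sup>*" for i
      proof (induction i)
        case (Suc i)
        show ?case
        proof (cases "(q ^^ i) v \<in> R")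
          case True
          then show ?thesis using Suc by (simp add: q_def)
        next
          case False
          then show ?thesis
            using stepE[of "(q ^^ i) v"] qiX[OF that, of i] Suc
            by (auto intro: converse_rtrancl_into_rtrancl)
        qed
      qed simp
      then show ?thesis by (simp add: root_def)
    qed
    consider "y \<in> R" | "z \<in> R" | "y \<notin> R" "z \<notin> R" by blast
    then show ?case
    proof cases
      case 1
      then have "y = root z" using less.prems fix1 by (simp add: root_def)
      then show ?thesis using toroot[of z] less.prems by simp
    next
      case 2
      then have "z = root y" using less.prems fix1 by (simp add: root_def)
      then show ?thesis using toroot[of y] less.prems by simp
    next
      case 3
      then have qy: "q y = p y" "p y \<in> X" "card (p y) < card y"
        using p[of y] less.prems psubset_card_mono[of y "p y"] by (auto simp: q_def)
      have "(z, p y) \<in> E\<^sup>* \<or> (p y, z) \<in> E\<^sup>*"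
        using less.hyps[of "p y" z] qy less.prems root_q[of y] by auto
      then show ?thesis
      proof
        assume "(z, p y) \<in> E\<^sup>*"
        then show ?thesis
          using stepE[of y] 3 less.prems qy by (auto intro: rtrancl_into_rtrancl)
      next
        assume "(p y, z) \<in> E\<^sup>*"
        then show ?thesis
        proof (cases rule: converse_rtranclE)
          case base
          then show ?thesis
            using stepE[of y] 3 less.prems qy by auto
        next
          \<comment> \<open>The path leaves \<open>p y\<close> through some \<open>u\<close> with
            \<open>p u = p y\<close>; injectivity identifies \<open>u\<close> with
            \<open>y\<close>.\<close>
          case (step u)
          then have "u = y"
            using inj 3 less.prems by (auto simp: E_def inj_on_def)
          then show ?thesis using step by simp
        qed
      qed
    qed
  qed
  show ?thesis
  proof (rule that[of root])
    fix y z assume "y \<in> X" "z \<in> X" "root y = root z" "y \<noteq> z"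
    then show "(z, y) \<in> {(p v, v) |v. v \<in> X - R}\<^sup>+ \<or> (y, z) \<in> {(p v, v) |v. v \<in> X - R}\<^sup>+"
      using key[of y z] by (auto simp: E_def rtrancl_eq_or_trancl)
  next
    fix y assume "y \<in> X" then show "root y \<subseteq> y"
      using sub by (simp add: root_def)
  qed (auto simp: root_def fix1 rootR[unfolded root_def])
qed

section \<open>Averages over random colourings\<close>

definition avg :: "'a set \<Rightarrow> nat \<Rightarrow> (('a \<Rightarrow> nat) \<Rightarrow> real) \<Rightarrow> real" where
  "avg V b F = (\<Sum>\<phi>\<in>V \<rightarrow>\<^sub>E {..<b}. F \<phi>) / real b ^ card V"

lemma card_colourings: "finite V \<Longrightarrow> card (V \<rightarrow>\<^sub>E {..<b}) = b ^ card V"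
  by (simp add: card_PiE)

lemma avg_const: "finite V \<Longrightarrow> b > 0 \<Longrightarrow> avg V b (\<lambda>_. c) = c"
  by (simp add: avg_def card_colourings)

lemma avg_add: "avg V b (\<lambda>\<phi>. F \<phi> + G \<phi>) = avg V b F + avg V b G"
  by (simp add: avg_def sum.distrib add_divide_distrib)

lemma avg_diff: "avg V b (\<lambda>\<phi>. F \<phi> - G \<phi>) = avg V b F - avg V b G"
  by (simp add: avg_def sum_subtractf diff_divide_distrib)

lemma avg_cmult: "avg V b (\<lambda>\<phi>. c * F \<phi>) = c * avg V b F"
  by (simp add: avg_def sum_distrib_left)

lemma avg_sum: "avg V b (\<lambda>\<phi>. \<Sum>i\<in>I. F i \<phi>) = (\<Sum>i\<in>I. avg V b (F i))"
  unfolding avg_def sum_divide_distrib[symmetric] by (subst sum.swap) simp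

lemma avg_mono:
  "(\<And>\<phi>. \<phi> \<in> V \<rightarrow>\<^sub>E {..<b} \<Longrightarrow> F \<phi> \<le> G \<phi>) \<Longrightarrow> avg V b F \<le> avg V b G"
  unfolding avg_def by (intro divide_right_mono sum_mono) auto

lemma avg_cong:
  "(\<And>\<phi>. \<phi> \<in> V \<rightarrow>\<^sub>E {..<b} \<Longrightarrow> F \<phi> = G \<phi>) \<Longrightarrow> avg V b F = avg V b G"
  unfolding avg_def by (simp cong: sum.cong)

lemma avg_insert:
  assumes "finite V" "v \<notin> V"
  shows "avg (insert v V) b F = avg V b (\<lambda>\<phi>. (\<Sum>s<b. F (\<phi>(v := s))) / real b)"
proof -
  have "(\<Sum>\<phi>\<in>insert v V \<rightarrow>\<^sub>E {..<b}. F \<phi>) = (\<Sum>(s, \<phi>)\<in>{..<b} \<times> (V \<rightarrow>\<^sub>E {..<b}). F (\<phi>(v := s)))"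
    unfolding PiE_insert_eq
    by (subst sum.reindex) (use inj_combinator[OF assms(2)] in \<open>auto simp: case_prod_unfold\<close>)
  also have "\<dots> = (\<Sum>s<b. \<Sum>\<phi>\<in>V \<rightarrow>\<^sub>E {..<b}. F (\<phi>(v := s)))"
    by (simp add: sum.cartesian_product)
  also have "\<dots> = (\<Sum>\<phi>\<in>V \<rightarrow>\<^sub>E {..<b}. \<Sum>s<b. F (\<phi>(v := s)))"
    by (rule sum.swap)
  finally show ?thesis
    using assms by (simp add: avg_def sum_divide_distrib field_simps)
qed

text \<open>Independence of the colours: with factor 1 at the points outside \<open>S\<close>, the
  sum over the product space factorises.\<close>

lemma avg_prod:
  assumes "finite V" "S \<subseteq> V" "b > 0"
  shows "avg V b (\<lambda>\<phi>. \<Prod>v\<in>S. g v (\<phi> v)) = (\<Prod>v\<in>S. (\<Sum>s<b. g v s) / real b)"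
proof -
  define h where "h = (\<lambda>v s. if v \<in> S then g v s else (1::real))"
  have "avg V b (\<lambda>\<phi>. \<Prod>v\<in>S. g v (\<phi> v)) = avg V b (\<lambda>\<phi>. \<Prod>v\<in>V. h v (\<phi> v))"
  proof (rule avg_cong)
    fix \<phi>
    have "(\<Prod>v\<in>S. g v (\<phi> v)) = (\<Prod>v\<in>S. h v (\<phi> v))"
      by (simp add: h_def)
    also have "\<dots> = (\<Prod>v\<in>V. h v (\<phi> v))"
      using assms by (intro prod.mono_neutral_left) (auto simp: h_def)
    finally show "(\<Prod>v\<in>S. g v (\<phi> v)) = (\<Prod>v\<in>V. h v (\<phi> v))" .
  qed
  also have "\<dots> = (\<Prod>v\<in>V. \<Sum>s<b. h v s) / real b ^ card V"
    unfolding avg_def using assms by (subst prod_sum_PiE) auto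
  also have "\<dots> = (\<Prod>v\<in>V. (\<Sum>s<b. h v s) / real b)"
    by (simp add: prod_dividef)
  also have "\<dots> = (\<Prod>v\<in>S. (\<Sum>s<b. h v s) / real b)"
    using assms by (intro prod.mono_neutral_right) (auto simp: h_def)
  finally show ?thesis
    by (simp add: h_def)
qed

text \<open>For a centred variable the linear term averages out and
  \<open>1 + z^2 <= exp (z^2)\<close> remains: this is the moment bound for a single
  coordinate.\<close>

lemma exp_le_quadratic:
  fixes z :: real
  assumes "\<bar>z\<bar> \<le> 1"
  shows "exp z \<le> 1 + z + z\<^sup>2"
proof (cases "z \<ge> 0")
  case True
  then show ?thesis using exp_bound[of z] assms by simp
next
  case False
  define u where "u = - z"
  have u: "u \<ge> 0" using False by (simp add: u_def)
  have "1 + u + u\<^sup>2 / 2 \<le> exp u"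
    using exp_lower_Taylor_quadratic[OF u] by simp
  moreover have "0 < 1 - u + u\<^sup>2"
    using zero_le_power2[of "u - 1/2"] by (simp add: power2_eq_square algebra_simps)
  ultimately have "(1 - u + u\<^sup>2) * (1 + u + u\<^sup>2 / 2) \<le> (1 - u + u\<^sup>2) * exp u"
    by (intro mult_left_mono) auto
  moreover have "(1 - u + u\<^sup>2) * (1 + u + u\<^sup>2 / 2) = 1 + u\<^sup>2/2 + u^3/2 + u^4/2"
    by (simp add: field_simps power2_eq_square power3_eq_cube power4_eq_xxxx)
  moreover have "0 \<le> u\<^sup>2/2 + u^3/2 + u^4/2"
    using u by simp
  ultimately have "1 \<le> (1 - u + u\<^sup>2) * exp u"
    by linarith
  then have "exp (-u) * 1 \<le> exp (-u) * ((1 - u + u\<^sup>2) * exp u)"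
    by (intro mult_left_mono) auto
  also have "\<dots> = 1 - u + u\<^sup>2"
    by (simp add: exp_minus)
  finally show ?thesis
    by (simp add: u_def)
qed

text \<open>The martingale method as an induction on \<open>V\<close>: averaging out the colour of
  \<open>v\<close> gives \<open>G\<close>, which inherits the remaining bounded differences, while
  \<open>F\<close> minus \<open>G\<close> is centred and at most \<open>c v\<close>. The condition
  \<open>l * c v <= 1\<close> permits \<open>exp_le_quadratic\<close> in place of Hoeffding's
  lemma.\<close>

lemma avg_exp_bounded_differences:
  assumes "finite V" "b > 0" "l \<ge> 0"
    and "\<And>v. v \<in> V \<Longrightarrow> l * c v \<le> 1"
    and "\<And>\<phi> v s. \<phi> \<in> V \<rightarrow>\<^sub>E {..<b} \<Longrightarrow> v \<in> V \<Longrightarrow> s < b \<Longrightarrow> \<bar>F (\<phi>(v := s)) - F \<phi>\<bar> \<le> c v"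
  shows "avg V b (\<lambda>\<phi>. exp (l * (F \<phi> - avg V b F))) \<le> exp (l\<^sup>2 * (\<Sum>v\<in>V. (c v)\<^sup>2))"
  using assms(1,4,5)
proof (induction V arbitrary: F rule: finite_induct)
  case empty
  show ?case by (simp add: avg_def)
next
  case (insert v V)
  define G where "G = (\<lambda>\<phi>. (\<Sum>s<b. F (\<phi>(v := s))) / real b)"
  have avgG: "avg (insert v V) b F = avg V b G"
    using insert by (simp add: avg_insert G_def)
  have ext: "\<phi>(v := s) \<in> insert v V \<rightarrow>\<^sub>E {..<b}" if "\<phi> \<in> V \<rightarrow>\<^sub>E {..<b}" "s < b" for \<phi> s
    using that by (intro PiE_fun_upd) auto
  have G: "avg V b (\<lambda>\<phi>. exp (l * (G \<phi> - avg V b G))) \<le> exp (l\<^sup>2 * (\<Sum>v\<in>V. (c v)\<^sup>2))"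
  proof (rule insert.IH)
    fix \<phi> u s assume *: "\<phi> \<in> V \<rightarrow>\<^sub>E {..<b}" "u \<in> V" "s < b"
    have "\<bar>(\<Sum>r<b. F (\<phi>(u := s, v := r)) - F (\<phi>(v := r)))\<bar> \<le> (\<Sum>r<b. c u)"
    proof (rule order_trans[OF sum_abs sum_mono])
      fix r assume "r \<in> {..<b}"
      then have "\<phi>(v := r) \<in> insert v V \<rightarrow>\<^sub>E {..<b}"
        using * ext by simp
      then have "\<bar>F (\<phi>(v := r, u := s)) - F (\<phi>(v := r))\<bar> \<le> c u"
        using insert.prems(2) * by blast
      moreover have "\<phi>(v := r, u := s) = \<phi>(u := s, v := r)"
        using * insert by (auto simp: fun_upd_twist)
      ultimately show "\<bar>F (\<phi>(u := s, v := r)) - F (\<phi>(v := r))\<bar> \<le> c u"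
        by simp
    qed
    then show "\<bar>G (\<phi>(u := s)) - G \<phi>\<bar> \<le> c u"
      using assms(2) by (simp add: G_def sum_subtractf diff_divide_distrib[symmetric] field_simps)
  qed (use insert in auto)
  have one: "(\<Sum>s<b. exp (l * (F (\<phi>(v := s)) - G \<phi>))) / real b \<le> exp (l\<^sup>2 * (c v)\<^sup>2)"
    if \<phi>: "\<phi> \<in> V \<rightarrow>\<^sub>E {..<b}" for \<phi>
  proof -
    define X where "X = (\<lambda>s. F (\<phi>(v := s)) - G \<phi>)"
    have sumX: "(\<Sum>s<b. X s) = 0"
      using assms(2) by (simp add: X_def sum_subtractf G_def)
    have X: "\<bar>X s\<bar> \<le> c v" if "s < b" for s
    proof -
      have "\<bar>(\<Sum>r<b. F (\<phi>(v := s)) - F (\<phi>(v := r)))\<bar> \<le> (\<Sum>r<b. c v)"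
      proof (rule order_trans[OF sum_abs sum_mono])
        fix r assume "r \<in> {..<b}"
        then show "\<bar>F (\<phi>(v := s)) - F (\<phi>(v := r))\<bar> \<le> c v"
          using insert.prems(2)[OF ext[OF \<phi>, of r], of v s] \<open>s < b\<close>
          by (metis fun_upd_upd insertI1 lessThan_iff)
      qed
      then show ?thesis
        using assms(2) by (simp add: X_def G_def sum_subtractf field_simps)
    qed
    have cv: "0 \<le> c v" using X[of 0] assms(2) by simp
    have "(\<Sum>s<b. exp (l * X s)) \<le> (\<Sum>s<b. 1 + l * X s + l\<^sup>2 * (c v)\<^sup>2)"
    proof (rule sum_mono)
      fix s assume "s \<in> {..<b}"
      then have s: "\<bar>X s\<bar> \<le> c v" using X by simp
      then have "\<bar>l * X s\<bar> \<le> l * c v"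
        using assms(3) by (simp add: abs_mult mult_left_mono)
      then have le1: "\<bar>l * X s\<bar> \<le> 1"
        using insert.prems(1)[of v] by simp
      have "(X s)\<^sup>2 \<le> (c v)\<^sup>2"
        using s cv by (simp add: abs_le_square_iff[symmetric])
      then have "(l * X s)\<^sup>2 \<le> l\<^sup>2 * (c v)\<^sup>2"
        by (simp add: power_mult_distrib mult_left_mono)
      then show "exp (l * X s) \<le> 1 + l * X s + l\<^sup>2 * (c v)\<^sup>2"
        using exp_le_quadratic[OF le1] by linarith
    qed
    also have "\<dots> = real b * (1 + l\<^sup>2 * (c v)\<^sup>2)"
      using sumX by (simp add: sum.distrib sum_distrib_left[symmetric] algebra_simps)
    also have "\<dots> \<le> real b * exp (l\<^sup>2 * (c v)\<^sup>2)"
      by (intro mult_left_mono exp_ge_add_one_self) auto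
    finally show ?thesis
      using assms(2) by (simp add: X_def field_simps)
  qed
  have "avg (insert v V) b (\<lambda>\<phi>. exp (l * (F \<phi> - avg (insert v V) b F)))
    = avg V b (\<lambda>\<phi>. exp (l * (G \<phi> - avg V b G)) * ((\<Sum>s<b. exp (l * (F (\<phi>(v := s)) - G \<phi>))) / real b))"
    unfolding avgG
    by (subst avg_insert[OF insert.hyps(1,2)], rule avg_cong)
      (simp add: sum_distrib_left exp_add[symmetric] algebra_simps)
  also have "\<dots> \<le> avg V b (\<lambda>\<phi>. exp (l\<^sup>2 * (c v)\<^sup>2) * exp (l * (G \<phi> - avg V b G)))"
    by (rule avg_mono, subst mult.commute, intro mult_right_mono one) auto
  also have "\<dots> \<le> exp (l\<^sup>2 * (c v)\<^sup>2) * exp (l\<^sup>2 * (\<Sum>v\<in>V. (c v)\<^sup>2))"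
    unfolding avg_cmult using G by simp
  also have "\<dots> = exp (l\<^sup>2 * (\<Sum>v\<in>insert v V. (c v)\<^sup>2))"
    using insert.hyps by (simp add: exp_add[symmetric] algebra_simps)
  finally show ?case .
qed

lemma bounded_differences_tail:
  assumes "finite V" "b > 0" "l \<ge> 0"
    and "\<And>v. v \<in> V \<Longrightarrow> l * c v \<le> 1"
    and "\<And>\<phi> v s. \<phi> \<in> V \<rightarrow>\<^sub>E {..<b} \<Longrightarrow> v \<in> V \<Longrightarrow> s < b \<Longrightarrow> \<bar>F (\<phi>(v := s)) - F \<phi>\<bar> \<le> c v"
  shows "avg V b (\<lambda>\<phi>. of_bool (F \<phi> \<ge> avg V b F + t)) \<le> exp (l\<^sup>2 * (\<Sum>v\<in>V. (c v)\<^sup>2) - l * t)"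
proof -
  have "avg V b (\<lambda>\<phi>. of_bool (F \<phi> \<ge> avg V b F + t))
      \<le> avg V b (\<lambda>\<phi>. exp (- l * t) * exp (l * (F \<phi> - avg V b F)))"
  proof (rule avg_mono)
    fix \<phi>
    show "of_bool (F \<phi> \<ge> avg V b F + t) \<le> exp (- l * t) * exp (l * (F \<phi> - avg V b F))"
    proof (cases "F \<phi> \<ge> avg V b F + t")
      case True
      then have "0 \<le> l * (F \<phi> - avg V b F - t)"
        using assms(3) by simp
      then show ?thesis
        using True by (simp add: exp_add[symmetric] algebra_simps)
    qed simp
  qed
  also have "\<dots> \<le> exp (- l * t) * exp (l\<^sup>2 * (\<Sum>v\<in>V. (c v)\<^sup>2))"
    unfolding avg_cmult using avg_exp_bounded_differences[OF assms] by simp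
  finally show ?thesis
    by (simp add: exp_add[symmetric] algebra_simps)
qed

lemma union_bound_colouring:
  assumes "finite V" "b > 0" "(\<Sum>i\<in>I. avg V b (\<lambda>\<phi>. of_bool (P i \<phi>))) < 1" "finite I"
  shows "\<exists>\<phi>\<in>V \<rightarrow>\<^sub>E {..<b}. \<forall>i\<in>I. \<not> P i \<phi>"
proof (rule ccontr)
  assume *: "\<not> ?thesis"
  have "1 = avg V b (\<lambda>_. 1)"
    using assms by (simp add: avg_const)
  also have "\<dots> \<le> avg V b (\<lambda>\<phi>. \<Sum>i\<in>I. of_bool (P i \<phi>))"
  proof (rule avg_mono)
    fix \<phi> assume "\<phi> \<in> V \<rightarrow>\<^sub>E {..<b}"
    then obtain i where "i \<in> I" "P i \<phi>"
      using * by blast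
    then show "1 \<le> (\<Sum>i\<in>I. of_bool (P i \<phi>) :: real)"
      using member_le_sum[of i I "\<lambda>i. of_bool (P i \<phi>) :: real"] assms(4) by simp
  qed
  also have "\<dots> = (\<Sum>i\<in>I. avg V b (\<lambda>\<phi>. of_bool (P i \<phi>)))"
    by (rule avg_sum)
  finally show False
    using assms by linarith
qed

section \<open>Levels of the Boolean lattice\<close>

definition level :: "nat \<Rightarrow> nat \<Rightarrow> nat set set" where
  "level n k = {x. x \<subseteq> {1..n} \<and> card x = k}"

definition below :: "nat set \<Rightarrow> nat \<Rightarrow> nat set set" where
  "below y j = {x. x \<subseteq> y \<and> card x = j}"

definition above :: "nat \<Rightarrow> nat set \<Rightarrow> nat \<Rightarrow> nat set set" where
  "above n x k = {y. x \<subseteq> y \<and> y \<subseteq> {1..n} \<and> card y = k}"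

lemma finite_level [simp, intro]: "finite (level n k)"
  by (simp add: level_def)

lemma finite_below [simp, intro]: "finite y \<Longrightarrow> finite (below y j)"
  by (simp add: below_def)

lemma finite_above [simp, intro]: "finite (above n x k)"
  by (rule finite_subset[of _ "Pow {1..n}"]) (auto simp: above_def)

lemma card_level: "card (level n k) = n choose k"
  using n_subsets[of "{1..n}" k] by (simp add: level_def)

lemma card_below: "finite y \<Longrightarrow> card (below y j) = card y choose j"
  using n_subsets[of y j] by (simp add: below_def)

lemma finite_mem_level: "x \<in> level n k \<Longrightarrow> finite x"
  using finite_subset[of x "{1..n}"] by (auto simp: level_def)

lemma card_supersets:
  assumes "finite y" "x \<subseteq> y" "card x = j" "j \<le> i"
  shows "card {u. x \<subseteq> u \<and> u \<subseteq> y \<and> card u = i} = (card y - j) choose (i - j)"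
proof -
  have fx: "finite x"
    using assms(1,2) finite_subset by blast
  have "{u. x \<subseteq> u \<and> u \<subseteq> y \<and> card u = i} = (\<lambda>z. z \<union> x) ` {z. z \<subseteq> y - x \<and> card z = i - j}"
    (is "?A = ?f ` ?B")
  proof (intro equalityI subsetI)
    fix u assume u: "u \<in> ?A"
    then have "u = ?f (u - x)" by blast
    moreover have "card (u - x) = i - j"
      using u fx assms(3) by (simp add: card_Diff_subset)
    ultimately show "u \<in> ?f ` ?B" using u by blast
  next
    fix u assume "u \<in> ?f ` ?B"
    then obtain z where z: "u = z \<union> x" "z \<subseteq> y - x" "card z = i - j" by blast
    have "finite z" using z(2) assms(1) finite_subset by blast
    then have "card (z \<union> x) = card z + card x"
      using fx z(2) by (intro card_Un_disjoint) auto
    then show "u \<in> ?A" using z assms by auto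
  qed
  moreover have "inj_on ?f ?B"
    by (rule inj_onI) blast
  ultimately have "card ?A = card ?B"
    by (simp add: card_image)
  also have "\<dots> = card (y - x) choose (i - j)"
    using assms(1) by (intro n_subsets) simp
  also have "card (y - x) = card y - j"
    using fx assms by (simp add: card_Diff_subset)
  finally show ?thesis .
qed

lemma card_above:
  assumes "x \<in> level n j" "j \<le> k"
  shows "card (above n x k) = (n - j) choose (k - j)"
  using card_supersets[of "{1..n}" x j k] assms by (simp add: level_def above_def)

lemma mem_above_iff: "x \<in> level n j \<Longrightarrow> y \<in> above n x k \<longleftrightarrow> y \<in> level n k \<and> x \<in> below y j"
  by (auto simp: level_def above_def below_def)

lemma below_subset_level: "y \<in> level n k \<Longrightarrow> below y j \<subseteq> level n j"
  by (auto simp: level_def below_def)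

lemma above_subset_level: "above n x k \<subseteq> level n k"
  by (auto simp: level_def above_def)

lemma choose_double_count:
  assumes "j \<le> k" "k \<le> n"
  shows "(n choose j) * ((n - j) choose (k - j)) = (n choose k) * (k choose j)"
  using choose_mult[OF assms] by simp

text \<open>Every \<open>x\<close> lies under the same number of intermediate sets \<open>u\<close>.
  So a bound on the sums below all sets of size \<open>i\<close> passes to larger sets.\<close>

lemma sum_below_intermediate:
  fixes c :: "nat set \<Rightarrow> real"
  assumes "finite y" "j \<le> i" "i \<le> card y"
  shows "(\<Sum>u\<in>below y i. \<Sum>x\<in>below u j. c x) = real ((card y - j) choose (i - j)) * (\<Sum>x\<in>below y j. c x)"
proof -
  have fin: "finite (below y i)"
    using assms by simp
  have "(\<Sum>u\<in>below y i. \<Sum>x\<in>below u j. c x) = (\<Sum>u\<in>below y i. \<Sum>x\<in>below y j. if x \<subseteq> u then c x else 0)"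
  proof (rule sum.cong[OF refl])
    fix u assume u: "u \<in> below y i"
    have "below u j = {x \<in> below y j. x \<subseteq> u}"
      using u by (auto simp: below_def)
    then show "(\<Sum>x\<in>below u j. c x) = (\<Sum>x\<in>below y j. if x \<subseteq> u then c x else 0)"
      using assms by (simp add: sum.inter_filter)
  qed
  also have "\<dots> = (\<Sum>x\<in>below y j. \<Sum>u\<in>below y i. if x \<subseteq> u then c x else 0)"
    by (rule sum.swap)
  also have "\<dots> = (\<Sum>x\<in>below y j. real ((card y - j) choose (i - j)) * c x)"
  proof (rule sum.cong[OF refl])
    fix x assume x: "x \<in> below y j"
    then have fx: "finite x" "x \<subseteq> y" "card x = j"
      using assms finite_subset[of x y] by (auto simp: below_def)
    have "{u \<in> below y i. x \<subseteq> u} = {u. x \<subseteq> u \<and> u \<subseteq> y \<and> card u = i}"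
      by (auto simp: below_def)
    then have "card {u \<in> below y i. x \<subseteq> u} = (card y - j) choose (i - j)"
      using card_supersets[of y x j i] fx assms by simp
    moreover have "(\<Sum>u\<in>below y i. if x \<subseteq> u then c x else 0) = real (card {u \<in> below y i. x \<subseteq> u}) * c x"
      using fin by (simp add: sum.inter_filter[symmetric])
    ultimately show "(\<Sum>u\<in>below y i. if x \<subseteq> u then c x else 0) = real ((card y - j) choose (i - j)) * c x"
      by simp
  qed
  finally show ?thesis
    by (simp add: sum_distrib_left)
qed

lemma sum_above_intermediate:
  fixes c :: "nat set \<Rightarrow> real"
  assumes "x \<in> level n j" "j \<le> i" "i \<le> k"
  shows "(\<Sum>u\<in>above n x i. \<Sum>y\<in>above n u k. c y) = real ((k - j) choose (i - j)) * (\<Sum>y\<in>above n x k. c y)"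
proof -
  have x: "finite x" "x \<subseteq> {1..n}" "card x = j"
    using assms finite_mem_level[OF assms(1)] by (auto simp: level_def)
  have "(\<Sum>u\<in>above n x i. \<Sum>y\<in>above n u k. c y) = (\<Sum>u\<in>above n x i. \<Sum>y\<in>above n x k. if u \<subseteq> y then c y else 0)"
  proof (rule sum.cong[OF refl])
    fix u assume u: "u \<in> above n x i"
    have "above n u k = {y \<in> above n x k. u \<subseteq> y}"
      using u by (auto simp: above_def)
    then show "(\<Sum>y\<in>above n u k. c y) = (\<Sum>y\<in>above n x k. if u \<subseteq> y then c y else 0)"
      by (simp add: sum.inter_filter)
  qed
  also have "\<dots> = (\<Sum>y\<in>above n x k. \<Sum>u\<in>above n x i. if u \<subseteq> y then c y else 0)"
    by (rule sum.swap)
  also have "\<dots> = (\<Sum>y\<in>above n x k. real ((k - j) choose (i - j)) * c y)"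
  proof (rule sum.cong[OF refl])
    fix y assume y: "y \<in> above n x k"
    then have fy: "finite y" "x \<subseteq> y" "card y = k" "y \<subseteq> {1..n}"
      using finite_subset[of y "{1..n}"] by (auto simp: above_def)
    have "{u \<in> above n x i. u \<subseteq> y} = {u. x \<subseteq> u \<and> u \<subseteq> y \<and> card u = i}"
      using fy by (auto simp: above_def)
    then have "card {u \<in> above n x i. u \<subseteq> y} = (k - j) choose (i - j)"
      using card_supersets[of y x j i] fy x assms by simp
    moreover have "(\<Sum>u\<in>above n x i. if u \<subseteq> y then c y else 0) = real (card {u \<in> above n x i. u \<subseteq> y}) * c y"
      by (simp add: sum.inter_filter[symmetric])
    ultimately show "(\<Sum>u\<in>above n x i. if u \<subseteq> y then c y else 0) = real ((k - j) choose (i - j)) * c y"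
      by simp
  qed
  finally show ?thesis
    by (simp add: sum_distrib_left)
qed

lemma binomial_decreasing:
  assumes "n \<le> 2 * j + 1" 
  shows "n choose Suc j \<le> n choose j"
proof (cases "Suc j \<le> n")
  case True
  have "Suc j * (n choose Suc j) = (n - j) * (n choose j)"
    by (metis binomial_absorb_comp binomial_absorption mult.commute)
  also have "\<dots> \<le> Suc j * (n choose j)"
    using assms by (intro mult_right_mono) auto
  finally show ?thesis by (simp del: mult_Suc)
next
  case False then show ?thesis by (simp add: binomial_eq_0)
qed

lemma binomial_antimono:
  assumes "n \<le> 2 * j + 1" "j \<le> k"
  shows "n choose k \<le> n choose j"
  using assms(2)
proof (induction k rule: dec_induct)
  case (step k)
  then show ?case using binomial_decreasing[of n k] assms by simp
qed simp

lemma binomial_Suc_ratio: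
  "real (n choose Suc j) * real (Suc j) = real (n choose j) * real (n - j)"
  by (metis binomial_absorb_comp binomial_absorption mult.commute of_nat_mult)

text \<open>The ratio of consecutive coefficients, \<open>(n - k) / Suc k\<close>, decreases in
  \<open>k\<close>; multiplied over \<open>t\<close> steps, this says that the decay from the later
  level \<open>g\<close> is at least as strong as that from \<open>h\<close>. It is what makes
  \<open>repair_load\<close> work.\<close>

lemma binomial_log_concave:
  assumes "h \<le> g" "h + t \<le> n"
  shows "real (n choose (g + t)) * real (n choose h) \<le> real (n choose (h + t)) * real (n choose g)"
  using assms(2)
proof (induction t)
  case (Suc t)
  have IH: "real (n choose (g + t)) * real (n choose h) \<le> real (n choose (h + t)) * real (n choose g)"
    using Suc by simp
  have "(real (n choose (g + Suc t)) * real (n choose h)) * (real (Suc (g + t)) * real (Suc (h + t)))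
     = (real (n choose (g + t)) * real (n choose h)) * (real (n - (g + t)) * real (Suc (h + t)))"
    using binomial_Suc_ratio[of n "g + t"] by simp
  also have "\<dots> \<le> (real (n choose (h + t)) * real (n choose g)) * (real (n - (h + t)) * real (Suc (g + t)))"
    using assms(1) IH by (intro mult_mono[OF _ mult_mono]) auto
  also have "\<dots> = (real (n choose (h + Suc t)) * real (n choose g)) * (real (Suc (g + t)) * real (Suc (h + t)))"
    using binomial_Suc_ratio[of n "h + t"] by simp
  finally show ?case
    by (subst (asm) mult_le_cancel_right) auto
qed simp

section \<open>Phases and short flows\<close>

text \<open>A colouring \<open>\<phi>\<close> gives every set a phase below \<open>b\<close>. A set \<open>x\<close> of phase \<open>\<phi> x\<close> lies in the run
  \<open>card x - \<phi> x\<close>, and runs are traversed along pairs \<open>x \<subset> y\<close> with \<open>card y = card x + 1\<close> and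
  \<open>\<phi> y = \<phi> x + 1\<close>. Dividing by the larger of the two degrees keeps the flow below 1 at both ends.\<close>

definition updeg :: "nat \<Rightarrow> (nat set \<Rightarrow> nat) \<Rightarrow> nat set \<Rightarrow> real" where
  "updeg n \<phi> x = real (card {y \<in> above n x (Suc (card x)). \<phi> y = Suc (\<phi> x)})"

definition downdeg :: "(nat set \<Rightarrow> nat) \<Rightarrow> nat set \<Rightarrow> real" where
  "downdeg \<phi> y = real (card {x \<in> below y (card y - 1). Suc (\<phi> x) = \<phi> y})"

definition qflow :: "nat \<Rightarrow> (nat set \<Rightarrow> nat) \<Rightarrow> nat set \<Rightarrow> nat set \<Rightarrow> real" where
  "qflow n \<phi> x y = of_bool (\<phi> y = Suc (\<phi> x)) / max (updeg n \<phi> x) (downdeg \<phi> y)"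

definition eflow :: "nat \<Rightarrow> nat \<Rightarrow> nat \<Rightarrow> nat set \<Rightarrow> nat set \<Rightarrow> real" where
  "eflow n b t x y = avg (Pow {1..n}) b (\<lambda>\<phi>. of_bool (\<phi> x = t) * qflow n \<phi> x y)"

text \<open>Two requirements meet here: \<open>kap b\<close> has to dominate the relative loss in
  \<open>eflow_ge_eta\<close>, which is at most \<open>3 / sqrt \<mu>\<close>, and
  \<open>b * kap b\<close> has to be of order \<open>1 / b\<close> in
  \<open>sum_fed\<close>.\<close>

definition kap :: "nat \<Rightarrow> real" where
  "kap b = 1 / (4 * (real b)\<^sup>2)"

definition eta :: "nat \<Rightarrow> nat \<Rightarrow> real" where
  "eta b j = (1 - kap b) / (real b * real (Suc j))"

text \<open>The factor of \<open>qflow\<close> makes the expected flow on every edge exactly \<open>eta b (card x)\<close>, so that the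
  flow into a set of positive phase is \<open>1 - kap b\<close> on average.\<close>

definition sflow :: "nat \<Rightarrow> nat \<Rightarrow> (nat set \<Rightarrow> nat) \<Rightarrow> nat set \<Rightarrow> nat set \<Rightarrow> real" where
  "sflow n b \<phi> x y = eta b (card x) / eflow n b (\<phi> x) x y * qflow n \<phi> x y"

lemma sum_of_bool_point: "s < b \<Longrightarrow> (\<Sum>r<b. of_bool (r = s) :: real) = 1" for b :: nat
  by (subst sum.remove[of _ s]) (auto intro!: sum.neutral)

lemma sum_centred: "s < b \<Longrightarrow> (\<Sum>r<b. of_bool (r = s) - 1 / real b) = 0" for b :: nat
  by (simp only: sum_subtractf sum_of_bool_point) simp

lemma sum_centred_sq:
  assumes "s < b"
  shows "(\<Sum>r<b. (of_bool (r = s) - 1 / real b)\<^sup>2) \<le> 1"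
proof -
  have "(\<Sum>r<b. (of_bool (r = s) - 1 / real b)\<^sup>2)
      = (\<Sum>r<b. of_bool (r = s) * (1 - 2 / real b) + 1 / (real b)\<^sup>2)"
    by (rule sum.cong) (auto simp: power2_eq_square algebra_simps)
  also have "\<dots> = (1 - 2 / real b) + real b * (1 / (real b)\<^sup>2)"
    by (simp only: sum.distrib sum_distrib_right[symmetric] sum_of_bool_point[OF assms]) simp
  also have "\<dots> = 1 - 1 / real b"
    using assms by (simp add: power2_eq_square field_simps)
  finally show ?thesis by simp
qed

lemma avg_two_points:
  assumes "finite V" "b > 0" "x \<in> V" "y \<in> V" "x \<noteq> y" "t < b" "s < b"
  shows "avg V b (\<lambda>\<phi>. of_bool (\<phi> x = t) * of_bool (\<phi> y = s)) = 1 / (real b)\<^sup>2"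
proof -
  define g :: "'a \<Rightarrow> nat \<Rightarrow> real" where "g = (\<lambda>v r. if v = x then of_bool (r = t) else of_bool (r = s))"
  have "avg V b (\<lambda>\<phi>. of_bool (\<phi> x = t) * of_bool (\<phi> y = s)) = avg V b (\<lambda>\<phi>. \<Prod>v\<in>{x, y}. g v (\<phi> v))"
    using assms by (simp add: g_def)
  also have "\<dots> = (\<Prod>v\<in>{x, y}. (\<Sum>s<b. g v s) / real b)"
    using assms by (intro avg_prod) auto
  also have "\<dots> = 1 / (real b)\<^sup>2"
    using assms sum_of_bool_point[of t b] sum_of_bool_point[of s b]
    by (simp add: g_def power2_eq_square)
  finally show ?thesis .
qed

lemma avg_one_point:
  assumes "finite V" "b > 0" "x \<in> V" "t < b"
  shows "avg V b (\<lambda>\<phi>. of_bool (\<phi> x = t)) = 1 / real b"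
proof -
  have "avg V b (\<lambda>\<phi>. of_bool (\<phi> x = t)) = avg V b (\<lambda>\<phi>. \<Prod>v\<in>{x}. of_bool (\<phi> v = t))"
    by simp
  also have "\<dots> = 1 / real b"
    using assms sum_of_bool_point[of t b] by (subst avg_prod) auto
  finally show ?thesis .
qed

text \<open>By independence the mixed terms of the square vanish, each having a centred factor at a
  point other than \<open>x\<close> and \<open>y\<close>; a diagonal term is at most
  \<open>1 / b^3\<close>.\<close>

lemma avg_two_points_variance:
  assumes V: "finite V" "b > 0" "x \<in> V" "y \<in> V" "x \<noteq> y" "t < b" "s < b"
    and T: "T \<subseteq> V" "x \<notin> T" "y \<notin> T" "r < b"
  shows "avg V b (\<lambda>\<phi>. of_bool (\<phi> x = t) * of_bool (\<phi> y = s) *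
      (\<Sum>v\<in>T. of_bool (\<phi> v = r) - 1 / real b)\<^sup>2) \<le> real (card T) / real b ^ 3"
proof -
  have fT: "finite T" using T V finite_subset by blast
  define g :: "'a \<Rightarrow> nat \<Rightarrow> real" where "g = (\<lambda>v i. if v = x then of_bool (i = t)
    else if v = y then of_bool (i = s) else of_bool (i = r) - 1 / real b)"
  have gx: "(\<Sum>i<b. g x i) = 1" and gy: "(\<Sum>i<b. g y i) = 1"
    using V sum_of_bool_point[of t b] sum_of_bool_point[of s b] by (auto simp: g_def)
  have gv: "(\<Sum>i<b. g v i) = 0" if "v \<in> T" for v
  proof -
    have "v \<noteq> x" "v \<noteq> y" using that T by auto
    then show ?thesis using T sum_centred[of r b] by (simp add: g_def)
  qed
  have off: "avg V b (\<lambda>\<phi>. of_bool (\<phi> x = t) * of_bool (\<phi> y = s) *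
      ((of_bool (\<phi> v = r) - 1 / real b) * (of_bool (\<phi> u = r) - 1 / real b))) = 0"
    if uv: "u \<in> T" "v \<in> T" "u \<noteq> v" for u v
  proof -
    have ne: "v \<noteq> x" "v \<noteq> y" "u \<noteq> x" "u \<noteq> y" using uv T by auto
    have "avg V b (\<lambda>\<phi>. of_bool (\<phi> x = t) * of_bool (\<phi> y = s) *
      ((of_bool (\<phi> v = r) - 1 / real b) * (of_bool (\<phi> u = r) - 1 / real b)))
      = avg V b (\<lambda>\<phi>. \<Prod>w\<in>{x, y, v, u}. g w (\<phi> w))"
      using ne uv V by (intro avg_cong) (simp add: g_def)
    also have "\<dots> = (\<Prod>w\<in>{x, y, v, u}. (\<Sum>i<b. g w i) / real b)"
      using uv T V by (intro avg_prod) auto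
    also have "\<dots> = 0"
      using gv uv by (intro prod_zero) auto
    finally show ?thesis .
  qed
  have diag: "avg V b (\<lambda>\<phi>. of_bool (\<phi> x = t) * of_bool (\<phi> y = s) *
      ((of_bool (\<phi> v = r) - 1 / real b) * (of_bool (\<phi> v = r) - 1 / real b))) \<le> 1 / real b ^ 3"
    if v: "v \<in> T" for v
  proof -
    have ne: "v \<noteq> x" "v \<noteq> y" using v T by auto
    define h where "h = (\<lambda>w i. if w = v then (g w i)\<^sup>2 else g w i)"
    have "avg V b (\<lambda>\<phi>. of_bool (\<phi> x = t) * of_bool (\<phi> y = s) *
      ((of_bool (\<phi> v = r) - 1 / real b) * (of_bool (\<phi> v = r) - 1 / real b)))
      = avg V b (\<lambda>\<phi>. \<Prod>w\<in>{x, y, v}. h w (\<phi> w))"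
      using ne V by (intro avg_cong) (simp add: g_def h_def power2_eq_square)
    also have "\<dots> = (\<Prod>w\<in>{x, y, v}. (\<Sum>i<b. h w i) / real b)"
      using v T V by (intro avg_prod) auto
    also have "\<dots> = 1 / real b * (1 / real b) * ((\<Sum>i<b. (of_bool (i = r) - 1 / real b)\<^sup>2) / real b)"
      using ne V gx gy by (simp add: h_def g_def)
    also have "\<dots> \<le> 1 / real b * (1 / real b) * (1 / real b)"
      using T sum_centred_sq[of r b] by (intro mult_left_mono divide_right_mono) auto
    finally show ?thesis by (simp add: power3_eq_cube)
  qed
  have "avg V b (\<lambda>\<phi>. of_bool (\<phi> x = t) * of_bool (\<phi> y = s) *
      (\<Sum>v\<in>T. of_bool (\<phi> v = r) - 1 / real b)\<^sup>2)
    = (\<Sum>v\<in>T. \<Sum>u\<in>T. avg V b (\<lambda>\<phi>. of_bool (\<phi> x = t) * of_bool (\<phi> y = s) *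
      ((of_bool (\<phi> v = r) - 1 / real b) * (of_bool (\<phi> u = r) - 1 / real b))))"
    unfolding avg_sum[symmetric] power2_eq_square
    by (rule avg_cong, subst sum_product) (simp only: sum_distrib_left)
  also have "\<dots> = (\<Sum>v\<in>T. avg V b (\<lambda>\<phi>. of_bool (\<phi> x = t) * of_bool (\<phi> y = s) *
      ((of_bool (\<phi> v = r) - 1 / real b) * (of_bool (\<phi> v = r) - 1 / real b))))"
  proof (rule sum.cong[OF refl])
    fix v assume v: "v \<in> T"
    show "(\<Sum>u\<in>T. avg V b (\<lambda>\<phi>. of_bool (\<phi> x = t) * of_bool (\<phi> y = s) *
      ((of_bool (\<phi> v = r) - 1 / real b) * (of_bool (\<phi> u = r) - 1 / real b)))) =
      avg V b (\<lambda>\<phi>. of_bool (\<phi> x = t) * of_bool (\<phi> y = s) *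
      ((of_bool (\<phi> v = r) - 1 / real b) * (of_bool (\<phi> v = r) - 1 / real b)))"
      by (subst sum.remove[OF fT v], subst sum.neutral) (use off v in auto)
  qed
  also have "\<dots> \<le> (\<Sum>v\<in>T. 1 / real b ^ 3)"
    by (rule sum_mono) (rule diag)
  finally show ?thesis by simp
qed

text \<open>Jensen's inequality is replaced by the tangent \<open>1 / z \<ge> (2m - z) / m\<^sup>2\<close>, and the maximum
  by second moments; the relative loss is of the order of \<open>\<mu> powr (-1/2)\<close>.\<close>

lemma avg_inverse_max:
  fixes q :: nat
  assumes V: "finite V" "b > 0" "x \<in> V" "y \<in> V" "t < b" "s < b"
    and A: "A \<subseteq> V" "y \<in> A" "card A \<le> q" and B: "B \<subseteq> V" "x \<in> B" "card B \<le> q"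
    and AB: "A \<inter> B = {}"
  defines "\<mu> \<equiv> real q / real b"
  shows "avg V b (\<lambda>\<phi>. of_bool (\<phi> x = t) * of_bool (\<phi> y = s) /
      max (real (card {v\<in>A. \<phi> v = s})) (real (card {v\<in>B. \<phi> v = t})))
    \<ge> 1 / ((real b)\<^sup>2 * (1 + \<mu> + 2 * sqrt \<mu>))"
proof -
  have xy: "x \<noteq> y" "x \<notin> A" "y \<notin> B" using A B AB by auto
  have fin: "finite A" "finite B" using A B V finite_subset by auto
  \<comment> \<open>On the event considered, \<open>y\<close> and \<open>x\<close> are certain to be
    counted and give the summand 1; only the other neighbours fluctuate.\<close>
  define A' where "A' = A - {y}"
  define B' where "B' = B - {x}"
  have A': "A' \<subseteq> V" "x \<notin> A'" "y \<notin> A'" "real (card A') \<le> real q"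
    and B': "B' \<subseteq> V" "x \<notin> B'" "y \<notin> B'" "real (card B') \<le> real q"
    using A B xy fin card_mono[of A A'] card_mono[of B B'] by (auto simp: A'_def B'_def)
  have qpos: "q > 0" using A fin by (metis card_gt_0_iff empty_iff gr0I le_zero_eq)
  define a where "a = sqrt \<mu>"
  have \<mu>: "\<mu> > 0" using qpos V by (simp add: \<mu>_def)
  have a: "a > 0" "a * a = \<mu>" using \<mu> by (auto simp: a_def)
  \<comment> \<open>On this event the bound in \<open>zle\<close> has conditional mean at most
    \<open>1 + \<mu> + 3 / 2 * a\<close>: one \<open>a / 2\<close> comes from \<open>amgm\<close>
    and one from each of the two variances. As this is at most \<open>m\<close>, the tangent at
    \<open>m\<close> averages to at least \<open>1 / m\<close>.\<close>
  define m where "m = 1 + \<mu> + 2 * a"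
  have m: "m > 0" using \<mu> a by (simp add: m_def)
  define XA where "XA = (\<lambda>\<phi>. (\<Sum>v\<in>A'. of_bool (\<phi> v = s) - 1 / real b))"
  define XB where "XB = (\<lambda>\<phi>. (\<Sum>v\<in>B'. of_bool (\<phi> v = t) - 1 / real b))"
  define I :: "('a \<Rightarrow> nat) \<Rightarrow> real" where "I = (\<lambda>\<phi>. of_bool (\<phi> x = t) * of_bool (\<phi> y = s))"
  have cardA: "real (card {v\<in>A. \<phi> v = s}) = 1 + (XA \<phi> + real (card A') / real b)" if "\<phi> y = s" for \<phi>
  proof -
    have "{v\<in>A. \<phi> v = s} = insert y {v\<in>A'. \<phi> v = s}" using that A by (auto simp: A'_def)
    then have "card {v\<in>A. \<phi> v = s} = Suc (card {v\<in>A'. \<phi> v = s})"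
      using fin by (simp add: A'_def)
    moreover have "real (card {v\<in>A'. \<phi> v = s}) = (\<Sum>v\<in>A'. of_bool (\<phi> v = s))"
      using fin by (simp add: A'_def Int_def)
    ultimately show ?thesis by (simp add: XA_def sum_subtractf)
  qed
  have cardB: "real (card {v\<in>B. \<phi> v = t}) = 1 + (XB \<phi> + real (card B') / real b)" if "\<phi> x = t" for \<phi>
  proof -
    have "{v\<in>B. \<phi> v = t} = insert x {v\<in>B'. \<phi> v = t}" using that B by (auto simp: B'_def)
    then have "card {v\<in>B. \<phi> v = t} = Suc (card {v\<in>B'. \<phi> v = t})"
      using fin by (simp add: B'_def)
    moreover have "real (card {v\<in>B'. \<phi> v = t}) = (\<Sum>v\<in>B'. of_bool (\<phi> v = t))"
      using fin by (simp add: B'_def Int_def)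
    ultimately show ?thesis by (simp add: XB_def sum_subtractf)
  qed
  \<comment> \<open>The maximum of the two deviations is controlled by adding both squares. The
    scale \<open>a\<close> is that of a standard deviation, so no order of magnitude is
    lost.\<close>
  have amgm: "z \<le> a / 2 + z\<^sup>2 / (2 * a)" for z :: real
  proof -
    have "0 \<le> (z - a)\<^sup>2 / (2 * a)" using a by simp
    also have "(z - a)\<^sup>2 / (2 * a) = z\<^sup>2 / (2 * a) - z + a / 2"
      using a by (simp add: power2_eq_square field_simps)
    finally show ?thesis by simp
  qed
  have pt: "I \<phi> * ((2 * m - (1 + \<mu> + a / 2 + ((XA \<phi>)\<^sup>2 + (XB \<phi>)\<^sup>2) / (2 * a))) / m\<^sup>2)
      \<le> of_bool (\<phi> x = t) * of_bool (\<phi> y = s) /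
      max (real (card {v\<in>A. \<phi> v = s})) (real (card {v\<in>B. \<phi> v = t}))" for \<phi>
  proof (cases "\<phi> x = t \<and> \<phi> y = s")
    case True
    define z where "z = max (real (card {v\<in>A. \<phi> v = s})) (real (card {v\<in>B. \<phi> v = t}))"
    have "y \<in> {v\<in>A. \<phi> v = s}" using True A by simp
    then have "card {v\<in>A. \<phi> v = s} > 0" using fin card_gt_0_iff by fastforce
    then have zpos: "z > 0" by (simp add: z_def)
    have "real (card A') / real b \<le> \<mu>" "real (card B') / real b \<le> \<mu>"
      using A' B' by (auto simp: \<mu>_def intro: divide_right_mono)
    moreover have "0 \<le> (XA \<phi>)\<^sup>2 / (2 * a)" "0 \<le> (XB \<phi>)\<^sup>2 / (2 * a)" using a by simp_all
    ultimately have zle: "z \<le> 1 + \<mu> + a / 2 + ((XA \<phi>)\<^sup>2 + (XB \<phi>)\<^sup>2) / (2 * a)"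
      using cardA[of \<phi>] cardB[of \<phi>] True amgm[of "XA \<phi>"] amgm[of "XB \<phi>"]
      unfolding z_def add_divide_distrib by linarith
    have "(2 * m - z) / m\<^sup>2 \<le> 1 / z"
    proof -
      have "0 \<le> (z - m)\<^sup>2" by simp
      then have "(2 * m - z) * z \<le> m\<^sup>2" by (simp add: power2_eq_square algebra_simps)
      then show ?thesis using m zpos by (simp add: field_simps)
    qed
    moreover have "(2 * m - (1 + \<mu> + a / 2 + ((XA \<phi>)\<^sup>2 + (XB \<phi>)\<^sup>2) / (2 * a))) / m\<^sup>2 \<le> (2 * m - z) / m\<^sup>2"
      using zle by (intro divide_right_mono) auto
    ultimately show ?thesis
      using True by (simp add: I_def z_def[symmetric])
  qed (auto simp: I_def)
  have I1: "avg V b I = 1 / (real b)\<^sup>2"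
    unfolding I_def using V xy by (intro avg_two_points) auto
  have "real (card A') / real b ^ 3 \<le> \<mu> / (real b)\<^sup>2" "real (card B') / real b ^ 3 \<le> \<mu> / (real b)\<^sup>2"
    using A' B' V by (auto simp: \<mu>_def power2_eq_square power3_eq_cube mult.assoc divide_right_mono)
  then have I2: "avg V b (\<lambda>\<phi>. I \<phi> * (XA \<phi>)\<^sup>2) \<le> \<mu> / (real b)\<^sup>2" "avg V b (\<lambda>\<phi>. I \<phi> * (XB \<phi>)\<^sup>2) \<le> \<mu> / (real b)\<^sup>2"
    using avg_two_points_variance[OF V(1,2,3,4) xy(1) V(5,6) A'(1,2,3) V(6)]
      avg_two_points_variance[OF V(1,2,3,4) xy(1) V(5,6) B'(1,2,3) V(5)]
    by (auto simp: I_def XA_def XB_def)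
  have "1 / ((real b)\<^sup>2 * m) = (m / (real b)\<^sup>2) / m\<^sup>2"
    using m V by (simp add: power2_eq_square)
  also have "\<dots> \<le> (1 / (real b)\<^sup>2 * (2 * m - (1 + \<mu> + a / 2))
      - (\<mu> / (real b)\<^sup>2 + \<mu> / (real b)\<^sup>2) / (2 * a)) / m\<^sup>2"
  proof (rule divide_right_mono)
    have "(\<mu> / (real b)\<^sup>2 + \<mu> / (real b)\<^sup>2) / (2 * a) = a / (real b)\<^sup>2"
      using a V by (simp add: a(2)[symmetric] field_simps)
    moreover have "m \<le> 2 * m - (1 + \<mu> + a / 2) - a"
      using a by (simp add: m_def)
    then have "m / (real b)\<^sup>2 \<le> (2 * m - (1 + \<mu> + a / 2) - a) / (real b)\<^sup>2"
      by (intro divide_right_mono) auto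
    ultimately show "m / (real b)\<^sup>2 \<le> 1 / (real b)\<^sup>2 * (2 * m - (1 + \<mu> + a / 2))
      - (\<mu> / (real b)\<^sup>2 + \<mu> / (real b)\<^sup>2) / (2 * a)"
      by (simp only: mult_1_left times_divide_eq_left diff_divide_distrib)
  qed simp
  also have "\<dots> \<le> ((2 * m - (1 + \<mu> + a / 2)) * avg V b I
      - (avg V b (\<lambda>\<phi>. I \<phi> * (XA \<phi>)\<^sup>2) + avg V b (\<lambda>\<phi>. I \<phi> * (XB \<phi>)\<^sup>2)) / (2 * a)) / m\<^sup>2"
    using I2 a by (intro divide_right_mono diff_mono add_mono) (auto simp: I1)
  also have "\<dots> = avg V b (\<lambda>\<phi>. I \<phi> * ((2 * m - (1 + \<mu> + a / 2 + ((XA \<phi>)\<^sup>2 + (XB \<phi>)\<^sup>2) / (2 * a))) / m\<^sup>2))"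
  proof -
    have "avg V b (\<lambda>\<phi>. I \<phi> * ((2 * m - (1 + \<mu> + a / 2 + ((XA \<phi>)\<^sup>2 + (XB \<phi>)\<^sup>2) / (2 * a))) / m\<^sup>2))
      = avg V b (\<lambda>\<phi>. (2 * m - (1 + \<mu> + a / 2)) / m\<^sup>2 * I \<phi>
         - (1 / (2 * a * m\<^sup>2)) * (I \<phi> * (XA \<phi>)\<^sup>2 + I \<phi> * (XB \<phi>)\<^sup>2))"
      using a m by (intro avg_cong) (simp add: field_simps)
    also have "\<dots> = (2 * m - (1 + \<mu> + a / 2)) / m\<^sup>2 * avg V b I
        - 1 / (2 * a * m\<^sup>2) * (avg V b (\<lambda>\<phi>. I \<phi> * (XA \<phi>)\<^sup>2) + avg V b (\<lambda>\<phi>. I \<phi> * (XB \<phi>)\<^sup>2))"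
      by (simp only: avg_diff avg_cmult avg_add)
    also have "\<dots> = ((2 * m - (1 + \<mu> + a / 2)) * avg V b I
      - (avg V b (\<lambda>\<phi>. I \<phi> * (XA \<phi>)\<^sup>2) + avg V b (\<lambda>\<phi>. I \<phi> * (XB \<phi>)\<^sup>2)) / (2 * a)) / m\<^sup>2"
      by (subst diff_divide_distrib) (simp only: divide_divide_eq_left times_divide_eq_left mult_1_left)
    finally show ?thesis by (rule sym)
  qed
  also have "\<dots> \<le> avg V b (\<lambda>\<phi>. of_bool (\<phi> x = t) * of_bool (\<phi> y = s) /
      max (real (card {v\<in>A. \<phi> v = s})) (real (card {v\<in>B. \<phi> v = t})))"
    by (rule avg_mono) (rule pt)
  finally show ?thesis
    by (simp add: m_def a_def)
qed

text \<open>\<open>cfl\<close> is the capacity left at \<open>x\<close>, and \<open>rfl\<close>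
  below the demand left at \<open>y\<close>, after the flow inside runs. The far pairs have to match
  the two.\<close>

definition cfl :: "nat \<Rightarrow> nat \<Rightarrow> (nat set \<Rightarrow> nat) \<Rightarrow> nat set \<Rightarrow> real" where
  "cfl n b \<phi> x = 1 - (\<Sum>y\<in>above n x (Suc (card x)). sflow n b \<phi> x y)"

definition rfl :: "nat \<Rightarrow> nat \<Rightarrow> (nat set \<Rightarrow> nat) \<Rightarrow> nat set \<Rightarrow> real" where
  "rfl n b \<phi> y = 1 - (\<Sum>x\<in>below y (card y - 1). sflow n b \<phi> x y)"

lemma kap_bounds: "b \<ge> 1 \<Longrightarrow> 0 < kap b" "b \<ge> 1 \<Longrightarrow> kap b \<le> 1 / 4"
  by (auto simp: kap_def field_simps)

lemma eta_pos: "b \<ge> 1 \<Longrightarrow> 0 < eta b j"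
  using kap_bounds[of b] by (auto simp: eta_def)

lemma qflow_nonneg: "0 \<le> qflow n \<phi> x y"
  by (simp add: qflow_def updeg_def)

text \<open>Above the middle both degrees are at most \<open>Suc j\<close>, so
  \<open>avg_inverse_max\<close> applies with mean \<open>Suc j / b\<close>. The hypothesis on
  \<open>b ^ 5\<close> implies \<open>12 * b^2 <= sqrt \<mu>\<close>, that is
  \<open>3 <= kap b * sqrt \<mu>\<close>, and then \<open>kap b * \<mu>\<close> absorbs
  \<open>1 + 2 * sqrt \<mu>\<close>.\<close>

lemma eflow_ge_eta:
  assumes x: "x \<in> level n j" and y: "y \<in> above n x (Suc j)" and t: "Suc t < b"
    and j: "n \<le> 2 * j + 1" "144 * b ^ 5 \<le> Suc j"
  shows "eta b j \<le> eflow n b t x y"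
proof -
  define \<mu> where "\<mu> = real (Suc j) / real b"
  have b: "b > 0" using t by simp
  have yl: "y \<in> level n (Suc j)" using y above_subset_level by blast
  have fy: "finite y" and cy: "card y = Suc j" and cx: "card x = j"
    using yl x finite_mem_level[OF yl] by (auto simp: level_def)
  have yx: "x \<in> below y j" using mem_above_iff[OF x] y by blast
  have cA: "card (above n x (Suc j)) \<le> Suc j"
    using card_above[OF x, of "Suc j"] j by simp
  have cB: "card (below y j) \<le> Suc j"
    using card_below[OF fy] cy by simp
  have sub: "above n x (Suc j) \<subseteq> Pow {1..n}" "below y j \<subseteq> Pow {1..n}"
    using yl by (auto simp: above_def below_def level_def)
  have "1 / ((real b)\<^sup>2 * (1 + \<mu> + 2 * sqrt \<mu>))
    \<le> avg (Pow {1..n}) b (\<lambda>\<phi>. of_bool (\<phi> x = t) * of_bool (\<phi> y = Suc t) /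
      max (real (card {v\<in>above n x (Suc j). \<phi> v = Suc t})) (real (card {v\<in>below y j. \<phi> v = t})))"
    unfolding \<mu>_def
    by (rule avg_inverse_max) (use b t y yx cA cB sub in \<open>auto simp: above_def below_def\<close>)
  also have "\<dots> = eflow n b t x y"
    unfolding eflow_def
    by (rule avg_cong) (auto simp: qflow_def updeg_def downdeg_def cx cy)
  finally have 1: "1 / ((real b)\<^sup>2 * (1 + \<mu> + 2 * sqrt \<mu>)) \<le> eflow n b t x y" .
  have "144 * real b ^ 5 \<le> real (Suc j)"
    using j(2) by (metis of_nat_le_iff of_nat_mult of_nat_numeral of_nat_power)
  then have "144 * real b ^ 4 \<le> \<mu>"
    using b by (simp add: \<mu>_def field_simps eval_nat_numeral)
  then have sq: "12 * (real b)\<^sup>2 \<le> sqrt \<mu>"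
    by (intro real_le_rsqrt) (simp add: power_mult_distrib flip: power_mult)
  have b1: "1 \<le> (real b)\<^sup>2" using b by simp
  have mu: "\<mu> > 0" "sqrt \<mu> * sqrt \<mu> = \<mu>" using b by (auto simp: \<mu>_def)
  have "kap b * \<mu> = kap b * sqrt \<mu> * sqrt \<mu>" using mu by simp
  moreover have "3 \<le> kap b * sqrt \<mu>"
    using sq b by (simp add: kap_def field_simps)
  then have "3 * sqrt \<mu> \<le> kap b * sqrt \<mu> * sqrt \<mu>"
    by (intro mult_right_mono) (use mu in auto)
  ultimately have k\<mu>: "1 + 2 * sqrt \<mu> \<le> kap b * \<mu>"
    using sq b1 by linarith
  have "0 \<le> kap b * (1 + 2 * sqrt \<mu>)"
    using kap_bounds[of b] b mu by simp
  then have "(1 - kap b) * (1 + \<mu> + 2 * sqrt \<mu>) \<le> \<mu>"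
    using k\<mu> by (simp add: algebra_simps)
  moreover define m where "m = 1 + \<mu> + 2 * sqrt \<mu>"
  moreover have "m > 0" using mu by (simp add: m_def add_pos_pos)
  ultimately have "(1 - kap b) / \<mu> \<le> 1 / m"
    using mu(1) by (simp add: field_simps)
  then have "(1 - kap b) / \<mu> / (real b)\<^sup>2 \<le> 1 / m / (real b)\<^sup>2"
    by (intro divide_right_mono) auto
  then have "(1 - kap b) / ((real b)\<^sup>2 * \<mu>) \<le> 1 / ((real b)\<^sup>2 * (1 + \<mu> + 2 * sqrt \<mu>))"
    by (simp add: m_def mult.commute)
  moreover have "eta b j = (1 - kap b) / ((real b)\<^sup>2 * \<mu>)"
    using b by (simp add: eta_def \<mu>_def power2_eq_square)
  ultimately show ?thesis using 1 by linarith
qed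

text \<open>By \<open>eflow_ge_eta\<close> the normalising factor is at most 1, so the normalised
  flow still respects the bound 1 at both ends of every edge.\<close>

lemma sflow_bounds:
  assumes x: "x \<in> level n j" and y: "y \<in> above n x (Suc j)" and \<phi>: "\<phi> \<in> Pow {1..n} \<rightarrow>\<^sub>E {..<b}"
    and j: "n \<le> 2 * j + 1" "144 * b ^ 5 \<le> Suc j"
  shows "0 \<le> sflow n b \<phi> x y" "sflow n b \<phi> x y \<le> qflow n \<phi> x y"
proof -
  have "0 \<le> sflow n b \<phi> x y \<and> sflow n b \<phi> x y \<le> qflow n \<phi> x y"
  proof (cases "\<phi> y = Suc (\<phi> x)")
    case True
    have "y \<in> Pow {1..n}" using y by (auto simp: above_def)
    then have "Suc (\<phi> x) < b" using \<phi> True by (metis PiE_mem lessThan_iff)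
    then have "eta b j \<le> eflow n b (\<phi> x) x y" "0 < eta b j"
      using eflow_ge_eta[OF x y _ j] eta_pos by auto
    moreover define \<rho> where "\<rho> = eta b j / eflow n b (\<phi> x) x y"
    ultimately have "0 \<le> \<rho>" "\<rho> \<le> 1"
      by auto
    moreover have "sflow n b \<phi> x y = \<rho> * qflow n \<phi> x y"
      using x by (simp add: sflow_def \<rho>_def level_def)
    ultimately show ?thesis
      using qflow_nonneg[of n \<phi> x y] by (simp add: mult_left_le_one_le)
  next
    case False
    then show ?thesis by (simp add: sflow_def qflow_def)
  qed
  then show "0 \<le> sflow n b \<phi> x y" "sflow n b \<phi> x y \<le> qflow n \<phi> x y" by auto
qed

lemma sum_qflow_up: "(\<Sum>y\<in>above n x (Suc (card x)). qflow n \<phi> x y) \<le> 1"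
proof -
  have "(\<Sum>y\<in>above n x (Suc (card x)). qflow n \<phi> x y)
      \<le> (\<Sum>y\<in>above n x (Suc (card x)). of_bool (\<phi> y = Suc (\<phi> x)) / updeg n \<phi> x)"
  proof (rule sum_mono)
    fix y assume y: "y \<in> above n x (Suc (card x))"
    show "qflow n \<phi> x y \<le> of_bool (\<phi> y = Suc (\<phi> x)) / updeg n \<phi> x"
    proof (cases "\<phi> y = Suc (\<phi> x)")
      case True
      then have "updeg n \<phi> x > 0"
        using y by (auto simp: updeg_def card_gt_0_iff)
      then show ?thesis using True by (auto simp: qflow_def intro: divide_left_mono)
    qed (simp add: qflow_def)
  qed
  also have "\<dots> = updeg n \<phi> x / updeg n \<phi> x"
    by (simp add: updeg_def sum_divide_distrib[symmetric] Int_def)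
  finally show ?thesis by (simp split: if_splits)
qed

lemma sum_qflow_down:
  assumes "finite y"
  shows "(\<Sum>x\<in>below y (card y - 1). qflow n \<phi> x y) \<le> 1"
proof -
  have "(\<Sum>x\<in>below y (card y - 1). qflow n \<phi> x y)
      \<le> (\<Sum>x\<in>below y (card y - 1). of_bool (Suc (\<phi> x) = \<phi> y) / downdeg \<phi> y)"
  proof (rule sum_mono)
    fix x assume x: "x \<in> below y (card y - 1)"
    show "qflow n \<phi> x y \<le> of_bool (Suc (\<phi> x) = \<phi> y) / downdeg \<phi> y"
    proof (cases "\<phi> y = Suc (\<phi> x)")
      case True
      then have "downdeg \<phi> y > 0"
        using x assms by (auto simp: downdeg_def card_gt_0_iff)
      then show ?thesis using True by (auto simp: qflow_def intro: divide_left_mono)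
    qed (simp add: qflow_def)
  qed
  also have "\<dots> = downdeg \<phi> y / downdeg \<phi> y"
    using assms by (simp add: downdeg_def sum_divide_distrib[symmetric] Int_def)
  finally show ?thesis by (simp split: if_splits)
qed

lemma cfl_bounds:
  assumes x: "x \<in> level n j" and \<phi>: "\<phi> \<in> Pow {1..n} \<rightarrow>\<^sub>E {..<b}"
    and j: "n \<le> 2 * j + 1" "144 * b ^ 5 \<le> Suc j"
  shows "0 \<le> cfl n b \<phi> x" "cfl n b \<phi> x \<le> 1"
proof -
  have cx: "card x = j" using x by (simp add: level_def)
  have "(\<Sum>y\<in>above n x (Suc j). sflow n b \<phi> x y) \<le> (\<Sum>y\<in>above n x (Suc j). qflow n \<phi> x y)"
    by (intro sum_mono sflow_bounds[OF x _ \<phi> j])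
  then show "0 \<le> cfl n b \<phi> x"
    using sum_qflow_up[where x = x and n = n and \<phi> = \<phi>] by (simp add: cfl_def cx)
  show "cfl n b \<phi> x \<le> 1"
    unfolding cfl_def cx using sflow_bounds[OF x _ \<phi> j] by (simp add: sum_nonneg)
qed

lemma rfl_bounds:
  assumes y: "y \<in> level n (Suc j)" and \<phi>: "\<phi> \<in> Pow {1..n} \<rightarrow>\<^sub>E {..<b}"
    and j: "n \<le> 2 * j + 1" "144 * b ^ 5 \<le> Suc j"
  shows "0 \<le> rfl n b \<phi> y" "rfl n b \<phi> y \<le> 1"
proof -
  have cy: "card y - 1 = j" using y by (simp add: level_def)
  have *: "0 \<le> sflow n b \<phi> x y \<and> sflow n b \<phi> x y \<le> qflow n \<phi> x y" if "x \<in> below y j" for x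
  proof -
    have "x \<in> level n j" using that below_subset_level[OF y] by blast
    then show ?thesis using sflow_bounds[OF _ _ \<phi> j] mem_above_iff that y by blast
  qed
  have "(\<Sum>x\<in>below y j. sflow n b \<phi> x y) \<le> (\<Sum>x\<in>below y j. qflow n \<phi> x y)"
    by (intro sum_mono) (use * in auto)
  then show "0 \<le> rfl n b \<phi> y"
    using sum_qflow_down[where y = y and n = n and \<phi> = \<phi>, OF finite_mem_level[OF y]]
    unfolding rfl_def cy by linarith
  show "rfl n b \<phi> y \<le> 1"
    unfolding rfl_def cy using * by (simp add: sum_nonneg)
qed

text \<open>The normalisation cancels the unknown value of \<open>eflow\<close>. Phase
  \<open>b - 1\<close> is the end of a run: no set has phase \<open>b\<close>, hence the value
  0.\<close>

lemma avg_sflow: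
  assumes x: "x \<in> level n j" and y: "y \<in> above n x (Suc j)" and b: "b \<ge> 1"
    and j: "n \<le> 2 * j + 1" "144 * b ^ 5 \<le> Suc j"
  shows "avg (Pow {1..n}) b (\<lambda>\<phi>. of_bool (\<phi> x = t) * sflow n b \<phi> x y) = (if Suc t < b then eta b j else 0)"
proof (cases "Suc t < b")
  case True
  have "avg (Pow {1..n}) b (\<lambda>\<phi>. of_bool (\<phi> x = t) * sflow n b \<phi> x y)
     = avg (Pow {1..n}) b (\<lambda>\<phi>. eta b j / eflow n b t x y * (of_bool (\<phi> x = t) * qflow n \<phi> x y))"
    using x by (intro avg_cong) (auto simp: sflow_def level_def)
  also have "\<dots> = eta b j / eflow n b t x y * eflow n b t x y"
    by (simp only: avg_cmult eflow_def)
  also have "\<dots> = eta b j"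
    using eflow_ge_eta[OF x y True j] eta_pos[OF b, of j] by simp
  finally show ?thesis using True by simp
next
  case False
  have "avg (Pow {1..n}) b (\<lambda>\<phi>. of_bool (\<phi> x = t) * sflow n b \<phi> x y) = avg (Pow {1..n}) b (\<lambda>\<phi>. 0)"
  proof (rule avg_cong)
    fix \<phi> assume \<phi>: "\<phi> \<in> Pow {1..n} \<rightarrow>\<^sub>E {..<b}"
    have "y \<in> Pow {1..n}" using y by (auto simp: above_def)
    then have "\<phi> y < b" using \<phi> by (metis PiE_mem lessThan_iff)
    then show "of_bool (\<phi> x = t) * sflow n b \<phi> x y = 0"
      using False by (auto simp: sflow_def qflow_def)
  qed
  then show ?thesis using False b by (simp add: avg_const)
qed

lemma avg_cfl:
  assumes x: "x \<in> level n j" and t: "t < b"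
    and j: "n \<le> 2 * j + 1" "144 * b ^ 5 \<le> Suc j"
  shows "avg (Pow {1..n}) b (\<lambda>\<phi>. of_bool (\<phi> x = t) * cfl n b \<phi> x)
    = 1 / real b - (if Suc t < b then real (n - j) * eta b j else 0)"
proof -
  have cx: "card x = j" and xV: "x \<in> Pow {1..n}" using x by (auto simp: level_def)
  have "avg (Pow {1..n}) b (\<lambda>\<phi>. of_bool (\<phi> x = t) * cfl n b \<phi> x)
     = avg (Pow {1..n}) b (\<lambda>\<phi>. of_bool (\<phi> x = t) - (\<Sum>y\<in>above n x (Suc j). of_bool (\<phi> x = t) * sflow n b \<phi> x y))"
    by (rule avg_cong) (simp add: cfl_def cx right_diff_distrib sum_distrib_left)
  also have "\<dots> = 1 / real b - (\<Sum>y\<in>above n x (Suc j). if Suc t < b then eta b j else 0)"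
  proof -
    have "(\<Sum>y\<in>above n x (Suc j). avg (Pow {1..n}) b (\<lambda>\<phi>. of_bool (\<phi> x = t) * sflow n b \<phi> x y))
      = (\<Sum>y\<in>above n x (Suc j). if Suc t < b then eta b j else 0)"
      by (rule sum.cong[OF refl], rule avg_sflow[OF x _ _ j]) (use t in auto)
    then show ?thesis
      unfolding avg_diff avg_sum using avg_one_point[of "Pow {1..n}" b x t] xV t by simp
  qed
  finally show ?thesis
    using card_above[OF x, of "Suc j"] by simp
qed

lemma avg_rfl:
  assumes y: "y \<in> level n (Suc j)" and t: "t < b"
    and j: "n \<le> 2 * j + 1" "144 * b ^ 5 \<le> Suc j"
  shows "avg (Pow {1..n}) b (\<lambda>\<phi>. of_bool (\<phi> y = t) * rfl n b \<phi> y)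
    = (if t = 0 then 1 else kap b) / real b"
proof -
  have cy: "card y - 1 = j" "card y = Suc j" and yV: "y \<in> Pow {1..n}" using y by (auto simp: level_def)
  have "avg (Pow {1..n}) b (\<lambda>\<phi>. of_bool (\<phi> y = t) * rfl n b \<phi> y)
     = avg (Pow {1..n}) b (\<lambda>\<phi>. of_bool (\<phi> y = t) - (\<Sum>x\<in>below y j. of_bool (\<phi> y = t) * sflow n b \<phi> x y))"
    by (rule avg_cong) (simp add: rfl_def cy right_diff_distrib sum_distrib_left)
  also have "\<dots> = 1 / real b - (\<Sum>x\<in>below y j. if t = 0 then 0 else eta b j)"
  proof -
    have "(\<Sum>x\<in>below y j. avg (Pow {1..n}) b (\<lambda>\<phi>. of_bool (\<phi> y = t) * sflow n b \<phi> x y))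
      = (\<Sum>x\<in>below y j. if t = 0 then 0 else eta b j)"
    proof (rule sum.cong[OF refl])
      fix x assume x: "x \<in> below y j"
      have xl: "x \<in> level n j" using x below_subset_level[OF y] by blast
      have xy: "y \<in> above n x (Suc j)" using mem_above_iff[OF xl] x y by blast
      show "avg (Pow {1..n}) b (\<lambda>\<phi>. of_bool (\<phi> y = t) * sflow n b \<phi> x y) = (if t = 0 then 0 else eta b j)"
      proof (cases t)
        case 0
        have "avg (Pow {1..n}) b (\<lambda>\<phi>. of_bool (\<phi> y = t) * sflow n b \<phi> x y) = avg (Pow {1..n}) b (\<lambda>\<phi>. 0)"
          by (rule avg_cong) (auto simp: 0 sflow_def qflow_def)
        then show ?thesis using 0 t by (simp add: avg_const)
      next
        case (Suc u)
        have "avg (Pow {1..n}) b (\<lambda>\<phi>. of_bool (\<phi> y = t) * sflow n b \<phi> x y)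
          = avg (Pow {1..n}) b (\<lambda>\<phi>. of_bool (\<phi> x = u) * sflow n b \<phi> x y)"
          by (rule avg_cong) (auto simp: Suc sflow_def qflow_def)
        then show ?thesis using avg_sflow[OF xl xy _ j, of u] Suc t by simp
      qed
    qed
    then show ?thesis
      unfolding avg_diff avg_sum using avg_one_point[of "Pow {1..n}" b y t] yV t by simp
  qed
  also have "\<dots> = 1 / real b - (if t = 0 then 0 else real (Suc j) * eta b j)"
    using card_below[OF finite_mem_level[OF y], of j] cy by (simp del: of_nat_Suc)
  also have "\<dots> = (if t = 0 then 1 else kap b) / real b"
  proof -
    have "real (Suc j) * eta b j = (1 - kap b) / real b"
      by (simp add: eta_def del: of_nat_Suc)
    then show ?thesis by (simp only:) (simp add: diff_divide_distrib)
  qed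
  finally show ?thesis .
qed

section \<open>Concentration\<close>

text \<open>The quantities \<open>cfl n b \<phi> x\<close> and \<open>rfl n b \<phi> x\<close> depend only on the phases in \<open>nbhd n x\<close>.\<close>

definition nbhd :: "nat \<Rightarrow> nat set \<Rightarrow> nat set set" where
  "nbhd n x = {v. v \<subseteq> {1..n} \<and> card ((x - v) \<union> (v - x)) \<le> 2}"

lemma nbhd_sym: "x \<subseteq> {1..n} \<Longrightarrow> v \<in> nbhd n x \<Longrightarrow> x \<in> nbhd n v"
  by (simp add: nbhd_def Un_commute)

lemma finite_nbhd [simp]: "finite (nbhd n x)"
  by (rule finite_subset[of _ "Pow {1..n}"]) (auto simp: nbhd_def)

lemma card_nbhd:
  assumes "x \<subseteq> {1..n}" "n \<ge> 1"
  shows "card (nbhd n x) \<le> 2 * n\<^sup>2"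
proof -
  define f where "f = (\<lambda>(a, c). (x - {a, c}) \<union> ({a, c} - x))"
  have "nbhd n x \<subseteq> insert x (f ` ({1..n} \<times> {1..n}))"
  proof
    fix v assume v: "v \<in> nbhd n x"
    define D where "D = (x - v) \<union> (v - x)"
    have D: "D \<subseteq> {1..n}" "card D \<le> 2" using v assms by (auto simp: nbhd_def D_def)
    have vD: "v = (x - D) \<union> (D - x)" by (auto simp: D_def)
    have fD: "finite D" using D finite_subset by blast
    consider "card D = 0" | "card D = 1" | "card D = 2" using D by linarith
    then show "v \<in> insert x (f ` ({1..n} \<times> {1..n}))"
    proof cases
      case 1
      then show ?thesis using fD vD by simp
    next
      case 2
      then obtain a where "D = {a}" by (meson card_1_singletonE)
      then have "v = f (a, a)" "a \<in> {1..n}" using vD D by (auto simp: f_def)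
      then show ?thesis by blast
    next
      case 3
      then obtain a c where "D = {a, c}" by (meson card_2_iff)
      then have "v = f (a, c)" "a \<in> {1..n}" "c \<in> {1..n}" using vD D by (auto simp: f_def)
      then show ?thesis by blast
    qed
  qed
  then have "card (nbhd n x) \<le> card (insert x (f ` ({1..n} \<times> {1..n})))"
    by (intro card_mono) auto
  also have "\<dots> \<le> Suc (card (f ` ({1..n} \<times> {1..n})))"
    by (rule card_insert_le_m1) auto
  also have "\<dots> \<le> Suc (card ({1..n} \<times> {1..n}))"
    by (simp only: Suc_le_mono) (rule card_image_le, simp)
  also have "\<dots> \<le> 2 * n\<^sup>2"
    using assms by (simp add: power2_eq_square)
  finally show ?thesis .
qed

lemma mem_nbhd_above:
  assumes x: "x \<in> level n j" and y: "y \<in> above n x (Suc j)"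
  shows "y \<in> nbhd n x" "x \<in> nbhd n y"
proof -
  have "finite x" "x \<subseteq> y" "card x = j" "card y = Suc j" "y \<subseteq> {1..n}" "x \<subseteq> {1..n}"
    using x y finite_mem_level[OF x] by (auto simp: level_def above_def)
  then have "x - y = {}" "card (y - x) = 1"
    by (auto simp: card_Diff_subset)
  moreover from this have "(x - y) \<union> (y - x) = y - x" "(y - x) \<union> (x - y) = y - x"
    by blast+
  ultimately have "card ((x - y) \<union> (y - x)) = 1" "card ((y - x) \<union> (x - y)) = 1"
    by metis+
  then have "card ((x - y) \<union> (y - x)) \<le> 2" "card ((y - x) \<union> (x - y)) \<le> 2"
    by linarith+
  then show "y \<in> nbhd n x" "x \<in> nbhd n y"
    using \<open>y \<subseteq> {1..n}\<close> \<open>x \<subseteq> {1..n}\<close> by (simp_all add: nbhd_def)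
qed

lemma mem_nbhd_common_up:
  assumes y: "y \<in> level n (Suc j)" and "x \<in> below y j" "v \<in> below y j"
  shows "v \<in> nbhd n x"
proof -
  have fy: "finite y" "card y = Suc j" "y \<subseteq> {1..n}"
    using y finite_mem_level[OF y] by (auto simp: level_def)
  have x: "x \<subseteq> y" "card x = j" "v \<subseteq> y" "card v = j" using assms by (auto simp: below_def)
  then have "finite x" "finite v" using fy finite_subset by auto
  then have "card (y - x) = 1" "card (y - v) = 1" using x fy by (auto simp: card_Diff_subset)
  moreover have "card (x - v) \<le> card (y - v)" "card (v - x) \<le> card (y - x)"
    using x fy by (intro card_mono; blast)+
  ultimately have "card ((x - v) \<union> (v - x)) \<le> 2"
    using card_Un_le[of "x - v" "v - x"] by linarith
  then show ?thesis using x fy by (auto simp: nbhd_def)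
qed

lemma mem_nbhd_common_down:
  assumes x: "x \<in> level n j" and "y \<in> above n x (Suc j)" "v \<in> above n x (Suc j)"
  shows "v \<in> nbhd n y"
proof -
  have fx: "finite x" "card x = j"
    using x finite_mem_level[OF x] by (auto simp: level_def)
  have y: "x \<subseteq> y" "card y = Suc j" "x \<subseteq> v" "card v = Suc j" "v \<subseteq> {1..n}"
    using assms by (auto simp: above_def)
  then have "finite y" "finite v" by (auto intro: card_ge_0_finite)
  moreover have "card (y - x) = 1" "card (v - x) = 1" using y fx by (auto simp: card_Diff_subset)
  moreover have "card (y - v) \<le> card (y - x)" "card (v - y) \<le> card (v - x)"
    using y \<open>finite y\<close> \<open>finite v\<close> by (intro card_mono; blast)+
  ultimately have "card ((y - v) \<union> (v - y)) \<le> 2"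
    using card_Un_le[of "y - v" "v - y"] by linarith
  then show ?thesis using y by (auto simp: nbhd_def)
qed

lemma cfl_local:
  assumes x: "x \<in> level n j" and eq: "\<And>v. v \<in> nbhd n x \<Longrightarrow> \<phi> v = \<psi> v" 
  shows "cfl n b \<phi> x = cfl n b \<psi> x" "\<phi> x = \<psi> x"
proof -
  have cx: "card x = j" "x \<subseteq> {1..n}" using x by (auto simp: level_def)
  have xx: "\<phi> x = \<psi> x" using cx by (intro eq) (auto simp: nbhd_def)
  show "\<phi> x = \<psi> x" by (fact xx)
  have up: "\<phi> y = \<psi> y" if "y \<in> above n x (Suc j)" for y
    using eq mem_nbhd_above[OF x that] by auto
  have updeg: "updeg n \<phi> x = updeg n \<psi> x"
    using up by (simp add: updeg_def cx xx cong: conj_cong)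
  have "sflow n b \<phi> x y = sflow n b \<psi> x y" if y: "y \<in> above n x (Suc j)" for y
  proof -
    have yl: "y \<in> level n (Suc j)" and xy: "x \<in> below y j"
      using y mem_above_iff[OF x] by auto
    have "\<phi> v = \<psi> v" if "v \<in> below y j" for v
      using eq mem_nbhd_common_up[OF yl xy that] by auto
    then have "downdeg \<phi> y = downdeg \<psi> y"
      using yl up[OF y] by (simp add: downdeg_def level_def cong: conj_cong)
    then show ?thesis using up[OF y] updeg xx by (simp add: sflow_def qflow_def)
  qed
  then show "cfl n b \<phi> x = cfl n b \<psi> x" by (simp add: cfl_def cx)
qed

lemma rfl_local:
  assumes y: "y \<in> level n (Suc j)" and eq: "\<And>v. v \<in> nbhd n y \<Longrightarrow> \<phi> v = \<psi> v" 
  shows "rfl n b \<phi> y = rfl n b \<psi> y" "\<phi> y = \<psi> y"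
proof -
  have cy: "card y = Suc j" "y \<subseteq> {1..n}" using y by (auto simp: level_def)
  have yy: "\<phi> y = \<psi> y" using cy by (intro eq) (auto simp: nbhd_def)
  show "\<phi> y = \<psi> y" by (fact yy)
  have down: "\<phi> x = \<psi> x" if "x \<in> below y j" for x
  proof -
    have xl: "x \<in> level n j" using that below_subset_level[OF y] by blast
    then show ?thesis using eq mem_nbhd_above[OF xl] mem_above_iff[OF xl] that y by blast
  qed
  have downdeg: "downdeg \<phi> y = downdeg \<psi> y"
    using down by (simp add: downdeg_def cy yy cong: conj_cong)
  have "sflow n b \<phi> x y = sflow n b \<psi> x y" if x: "x \<in> below y j" for x
  proof -
    have xl: "x \<in> level n j" using x below_subset_level[OF y] by blast
    have xy: "y \<in> above n x (Suc j)" using mem_above_iff[OF xl] x y by blast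
    have "\<phi> v = \<psi> v" if "v \<in> above n x (Suc j)" for v
      using eq mem_nbhd_common_down[OF xl xy that] by auto
    then have "updeg n \<phi> x = updeg n \<psi> x"
      using xl down[OF x] by (simp add: updeg_def level_def cong: conj_cong)
    then show ?thesis using down[OF x] downdeg yy by (simp add: sflow_def qflow_def)
  qed
  then show "rfl n b \<phi> y = rfl n b \<psi> y" by (simp add: rfl_def cy)
qed

section \<open>Tail bounds and the choice of a colouring\<close>

text \<open>A summand changes only if the altered point lies in its neighbourhood, and then by at
  most 1; so \<open>c v\<close> counts the summands that see \<open>v\<close>. Neighbourhoods have
  at most \<open>2 * n^2\<close> points, which bounds each \<open>c v\<close> as well as their sum,
  and the sum of squares by \<open>4 * n^4 * card L\<close>.\<close>

lemma local_sum_tail: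
  fixes f :: "(nat set \<Rightarrow> nat) \<Rightarrow> nat set \<Rightarrow> real"
  assumes L: "L \<subseteq> Pow {1..n}" "L \<noteq> {}" and nb: "n \<ge> 1" "b \<ge> 1"
    and loc: "\<And>x \<phi> \<psi>. x \<in> L \<Longrightarrow> (\<And>v. v \<in> nbhd n x \<Longrightarrow> \<phi> v = \<psi> v) \<Longrightarrow> f \<phi> x = f \<psi> x"
    and bd: "\<And>x \<phi> \<psi>. x \<in> L \<Longrightarrow> \<phi> \<in> Pow {1..n} \<rightarrow>\<^sub>E {..<b} \<Longrightarrow> \<psi> \<in> Pow {1..n} \<rightarrow>\<^sub>E {..<b} \<Longrightarrow> \<bar>f \<phi> x - f \<psi> x\<bar> \<le> 1"
    and t: "0 \<le> t" "t \<le> real (card L)"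
  shows "avg (Pow {1..n}) b (\<lambda>\<phi>. of_bool ((\<Sum>x\<in>L. f \<phi> x) \<ge> avg (Pow {1..n}) b (\<lambda>\<phi>. \<Sum>x\<in>L. f \<phi> x) + t))
     \<le> exp (- t\<^sup>2 / (16 * real n ^ 4 * real (card L)))"
proof -
  have fL: "finite L" using L finite_subset by blast
  have cL: "real (card L) > 0" using L fL by (simp add: card_gt_0_iff)
  \<comment> \<open>The minimiser of \<open>4 * n^4 * card L * l^2 - l * t\<close>.\<close>
  define l where "l = t / (8 * real n ^ 4 * real (card L))"
  define c where "c = (\<lambda>v. real (card {x\<in>L. v \<in> nbhd n x}))"
  have n0: "real n > 0" using nb by simp
  have cv: "c v \<le> 2 * (real n)\<^sup>2" if "v \<in> Pow {1..n}" for v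
  proof -
    have "card {x\<in>L. v \<in> nbhd n x} \<le> card (nbhd n v)"
      using L nbhd_sym by (intro card_mono) auto
    also have "\<dots> \<le> 2 * n\<^sup>2" using that nb by (intro card_nbhd) auto
    finally have "real (card {x\<in>L. v \<in> nbhd n x}) \<le> real (2 * n\<^sup>2)"
      by (simp only: of_nat_le_iff)
    then show ?thesis by (simp add: c_def)
  qed
  have l0: "l \<ge> 0" using t by (simp add: l_def)
  have "(\<Sum>v\<in>Pow {1..n}. (c v)\<^sup>2) \<le> (\<Sum>v\<in>Pow {1..n}. 2 * (real n)\<^sup>2 * c v)"
    by (rule sum_mono, subst power2_eq_square, intro mult_right_mono cv) (auto simp: c_def)
  also have "\<dots> = 2 * (real n)\<^sup>2 * (\<Sum>v\<in>Pow {1..n}. \<Sum>x\<in>L. of_bool (v \<in> nbhd n x))"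
    using fL by (simp add: c_def sum_distrib_left[symmetric] Int_def)
  also have "\<dots> = 2 * (real n)\<^sup>2 * (\<Sum>x\<in>L. \<Sum>v\<in>Pow {1..n}. of_bool (v \<in> nbhd n x))"
    by (subst sum.swap) simp
  also have "\<dots> \<le> 2 * (real n)\<^sup>2 * (\<Sum>x\<in>L. 2 * (real n)\<^sup>2)"
  proof (intro mult_left_mono sum_mono)
    fix x assume x: "x \<in> L"
    have "(\<Sum>v\<in>Pow {1..n}. of_bool (v \<in> nbhd n x)) = real (card (Pow {1..n} \<inter> nbhd n x))"
      by (simp add: Int_def)
    also have "\<dots> \<le> real (card (nbhd n x))"
      by (simp add: card_mono)
    also have "\<dots> \<le> real (2 * n\<^sup>2)"
      using x L nb by (simp only: of_nat_le_iff) (intro card_nbhd, auto)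
    finally show "(\<Sum>v\<in>Pow {1..n}. of_bool (v \<in> nbhd n x)) \<le> 2 * (real n)\<^sup>2" by simp
  qed auto
  also have "\<dots> = 4 * real n ^ 4 * real (card L)"
    by (simp add: power4_eq_xxxx power2_eq_square)
  finally have sumc: "(\<Sum>v\<in>Pow {1..n}. (c v)\<^sup>2) \<le> 4 * real n ^ 4 * real (card L)" .
  have "avg (Pow {1..n}) b (\<lambda>\<phi>. of_bool ((\<Sum>x\<in>L. f \<phi> x) \<ge> avg (Pow {1..n}) b (\<lambda>\<phi>. \<Sum>x\<in>L. f \<phi> x) + t))
     \<le> exp (l\<^sup>2 * (\<Sum>v\<in>Pow {1..n}. (c v)\<^sup>2) - l * t)"
  proof (rule bounded_differences_tail)
    fix v :: "nat set" assume v: "v \<in> Pow {1..n}"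
    have "l * c v \<le> l * (2 * (real n)\<^sup>2)" using cv[OF v] l0 by (intro mult_left_mono)
    also have "\<dots> = t / (4 * (real n)\<^sup>2 * real (card L))"
      using n0 cL by (simp add: l_def power4_eq_xxxx power2_eq_square field_simps)
    also have "\<dots> \<le> 1"
    proof -
      have "1 * real (card L) \<le> 4 * (real n)\<^sup>2 * real (card L)"
        using one_le_power[of "real n" 2] nb by (intro mult_right_mono) (linarith | simp)+
      then have "t \<le> 4 * (real n)\<^sup>2 * real (card L)" using t by linarith
      then show ?thesis using cL n0 by (simp add: divide_le_eq)
    qed
    finally show "l * c v \<le> 1" .
  next
    fix \<phi> v s assume *: "\<phi> \<in> Pow {1..n} \<rightarrow>\<^sub>E {..<b}" "v \<in> Pow {1..n}" "s < b"
    have \<phi>': "\<phi>(v := s) \<in> Pow {1..n} \<rightarrow>\<^sub>E {..<b}"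
      using PiE_fun_upd[of s "\<lambda>_. {..<b}" v \<phi> "Pow {1..n}"] * by (simp add: insert_absorb)
    have "\<bar>\<Sum>x\<in>L. f (\<phi>(v := s)) x - f \<phi> x\<bar> \<le> (\<Sum>x\<in>L. of_bool (v \<in> nbhd n x))"
    proof (rule order_trans[OF sum_abs sum_mono])
      fix x assume x: "x \<in> L"
      show "\<bar>f (\<phi>(v := s)) x - f \<phi> x\<bar> \<le> of_bool (v \<in> nbhd n x)"
      proof (cases "v \<in> nbhd n x")
        case True
        then show ?thesis using bd[OF x \<phi>' *(1)] by simp
      next
        case False
        then have "f (\<phi>(v := s)) x = f \<phi> x"
          using x by (intro loc) auto
        then show ?thesis by simp
      qed
    qed
    then show "\<bar>(\<Sum>x\<in>L. f (\<phi>(v := s)) x) - (\<Sum>x\<in>L. f \<phi> x)\<bar> \<le> c v"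
      using fL by (simp add: sum_subtractf c_def Int_def)
  qed (use l0 nb in auto)
  also have "\<dots> \<le> exp (- t\<^sup>2 / (16 * real n ^ 4 * real (card L)))"
  proof -
    have "l\<^sup>2 * (\<Sum>v\<in>Pow {1..n}. (c v)\<^sup>2) \<le> l\<^sup>2 * (4 * real n ^ 4 * real (card L))"
      using sumc by (intro mult_left_mono) auto
    also have "\<dots> = t\<^sup>2 / (16 * real n ^ 4 * real (card L))"
      using n0 cL by (simp add: l_def power_divide power_mult_distrib power2_eq_square)
    finally have "l\<^sup>2 * (\<Sum>v\<in>Pow {1..n}. (c v)\<^sup>2) \<le> t\<^sup>2 / (16 * real n ^ 4 * real (card L))" .
    moreover have "l * t = 2 * (t\<^sup>2 / (16 * real n ^ 4 * real (card L)))"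
      by (simp add: l_def power2_eq_square)
    ultimately have "l\<^sup>2 * (\<Sum>v\<in>Pow {1..n}. (c v)\<^sup>2) - l * t \<le> - (t\<^sup>2 / (16 * real n ^ 4 * real (card L)))"
      by linarith
    then show ?thesis by simp
  qed
  finally show ?thesis .
qed

text \<open>\<open>cmean n b j t\<close> and \<open>rmean b t\<close> are the expectations of \<open>of_bool (\<phi> x = t) * cfl n b \<phi> x\<close> for
  \<open>x\<close> of size \<open>j\<close>, and of \<open>of_bool (\<phi> y = t) * rfl n b \<phi> y\<close>.\<close>

definition cmean :: "nat \<Rightarrow> nat \<Rightarrow> nat \<Rightarrow> nat \<Rightarrow> real" where
  "cmean n b j t = 1 / real b - (if Suc t < b then real (n - j) * eta b j else 0)"

definition rmean :: "nat \<Rightarrow> nat \<Rightarrow> real" where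
  "rmean b t = (if t = 0 then 1 else kap b) / real b"

lemma cmean_bounds:
  assumes "b \<ge> 1" "n \<le> 2 * j + 1"
  shows "kap b / real b \<le> cmean n b j t" "cmean n b j t \<le> 1"
proof -
  have k: "0 < kap b" "kap b \<le> 1 / 4" using kap_bounds assms by auto
  have "real (n - j) * eta b j \<le> real (Suc j) * eta b j"
    using eta_pos[of b j] assms by (intro mult_right_mono) auto
  also have "\<dots> = (1 - kap b) / real b"
    by (simp add: eta_def del: of_nat_Suc)
  finally have "real (n - j) * eta b j \<le> 1 / real b - kap b / real b"
    by (simp add: diff_divide_distrib)
  moreover have "kap b / real b \<le> 1 / real b"
    using k assms by (intro divide_right_mono) auto
  ultimately show "kap b / real b \<le> cmean n b j t"
    by (simp add: cmean_def)
  have "1 / real b \<le> 1" using assms by simp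
  moreover have "0 \<le> real (n - j) * eta b j" using eta_pos[of b j] assms by simp
  ultimately show "cmean n b j t \<le> 1" by (simp add: cmean_def)
qed

lemma rmean_bounds:
  assumes "b \<ge> 1"
  shows "kap b / real b \<le> rmean b t" "rmean b t \<le> 1"
proof -
  have k: "0 < kap b" "kap b \<le> 1 / 4" using kap_bounds assms by auto
  then show "kap b / real b \<le> rmean b t" "rmean b t \<le> 1"
    using assms by (auto simp: rmean_def divide_simps)
qed

text \<open>A relative deviation of \<open>1 / n\<close> from a mean as small as
  \<open>kap b / b = 1 / (4 * b^3)\<close> has to be excluded with probability
  \<open>exp (- 3 * n)\<close>. This takes \<open>768 * n^7 * b^6\<close> terms, and
  \<open>b^6 <= n^2\<close>.\<close>

lemma deviation_exponent:
  assumes b: "b \<ge> 1" "b ^ 5 \<le> n" and C: "768 * real n ^ 9 \<le> C" and m: "kap b / real b \<le> m"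
  shows "- (C * m / real n)\<^sup>2 / (16 * real n ^ 4 * C) \<le> - (3 * real n)"
proof -
  have n: "real n > 0" using b by (metis less_le_trans of_nat_0_less_iff zero_less_power zero_less_one order_less_le_trans)
  have C0: "C > 0" using C n by (smt (verit) zero_less_power mult_pos_pos)
  have b0: "real b > 0" using b by simp
  have "b ^ 1 \<le> b ^ 5" using b by (intro power_increasing) auto
  then have "b \<le> n" using b by simp
  then have "real b ^ 5 * real b \<le> real n * real n"
    using b by (intro mult_mono) (auto simp flip: of_nat_power)
  then have b6: "real b ^ 6 \<le> (real n)\<^sup>2" by (simp add: eval_nat_numeral mult.assoc)
  have kb: "0 \<le> kap b / real b" using kap_bounds[of b] b by simp
  have "3 * real n * (256 * real n ^ 6 * real b ^ 6) \<le> 3 * real n * (256 * real n ^ 6 * (real n)\<^sup>2)"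
    using b6 n by (intro mult_left_mono) auto
  also have "\<dots> = 768 * real n ^ 9" by (simp add: eval_nat_numeral)
  also have "\<dots> \<le> C" by (rule C)
  finally have "3 * real n \<le> C / (256 * real n ^ 6 * real b ^ 6)"
    using n b0 by (simp add: le_divide_eq)
  also have "\<dots> = C * (kap b / real b)\<^sup>2 / (16 * real n ^ 6)"
    using b0 by (simp add: kap_def field_simps eval_nat_numeral)
  also have "\<dots> \<le> C * m\<^sup>2 / (16 * real n ^ 6)"
    using m kb C0 by (intro divide_right_mono mult_left_mono power_mono) auto
  also have "\<dots> = (C * m / real n)\<^sup>2 / (16 * real n ^ 4 * C)"
    using n C0 by (simp add: field_simps eval_nat_numeral)
  finally show ?thesis by simp
qed

text \<open>This is the purpose of the distance 16: \<open>(n / 64)^16\<close> exceeds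
  \<open>n^9\<close> by seven powers of \<open>n\<close>, which from \<open>2 ^ 16\<close> on pay
  for the constants.\<close>

lemma binomial_16_large:
  assumes n: "n \<ge> 2 ^ 16" and m: "n \<le> 4 * m"
  shows "768 * real n ^ 9 \<le> real (m choose 16)"
proof -
  have m16: "16 \<le> m" using n m by simp
  have "768 * (64::real) ^ 16 \<le> (2 ^ 16) ^ 7" by simp
  also have "\<dots> \<le> real n ^ 7"
    using n by (intro power_mono) (metis of_nat_le_iff of_nat_numeral of_nat_power, simp)
  finally have "768 * 64 ^ 16 * real n ^ 9 \<le> real n ^ 7 * real n ^ 9"
    by (intro mult_right_mono) auto
  also have "\<dots> = real n ^ 16" by (simp flip: power_add)
  finally have "768 * real n ^ 9 \<le> real n ^ 16 / 64 ^ 16"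
    by (simp add: le_divide_eq)
  also have "\<dots> = (real n / 64) ^ 16" by (simp only: power_divide)
  also have "\<dots> \<le> (real m / real 16) ^ 16"
    using m by (intro power_mono) auto
  also have "\<dots> \<le> real (m choose 16)"
    using binomial_ge_n_over_k_pow_k[of 16 m, where 'a = real] m16 by simp
  finally show ?thesis .
qed

text \<open>A union bound over all sets, all phases and two kinds of failure:
  \<open>2 * b * 2^n\<close> events of probability at most \<open>exp (- 3 * n)\<close>. The
  condition \<open>4 * hi <= 3 * n\<close> leaves at least \<open>n / 4\<close> elements outside
  every lower set, as \<open>binomial_16_large\<close> requires. Only distance 16 is treated; larger
  distances follow by double counting.\<close>

lemma good_colouring:
  assumes n: "n \<ge> 2 ^ 16" and b: "b \<ge> 1" "b ^ 5 \<le> n" "144 * b ^ 5 \<le> lo"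
    and lo: "n \<le> 2 * lo + 1" and hi: "4 * hi \<le> 3 * n"
  shows "\<exists>\<phi>\<in>Pow {1..n} \<rightarrow>\<^sub>E {..<b}.
    (\<forall>j y t. lo \<le> j \<longrightarrow> j \<le> hi \<longrightarrow> y \<in> level n (j + 16) \<longrightarrow> t < b \<longrightarrow>
       (1 - 1 / real n) * real ((j + 16) choose j) * cmean n b j t
         \<le> (\<Sum>x\<in>below y j. of_bool (\<phi> x = t) * cfl n b \<phi> x)) \<and>
    (\<forall>j x t. lo < j + 16 \<longrightarrow> j + 16 \<le> hi \<longrightarrow> x \<in> level n j \<longrightarrow> t < b \<longrightarrow>
       (\<Sum>y\<in>above n x (j + 16). of_bool (\<phi> y = t) * rfl n b \<phi> y)
         \<le> (1 + 1 / real n) * real ((n - j) choose 16) * rmean b t)"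
proof -
  let ?V = "Pow {1..n}"
  let ?\<Omega> = "?V \<rightarrow>\<^sub>E {..<b}"
  have n1: "n \<ge> 1" using n by (simp add: order_trans[of 1 "2^16"])
  define cbad where "cbad = (\<lambda>y t \<phi>. \<exists>j. lo \<le> j \<and> j \<le> hi \<and> card y = j + 16 \<and>
    (\<Sum>x\<in>below y j. of_bool (\<phi> x = t) * cfl n b \<phi> x) < (1 - 1 / real n) * real ((j + 16) choose j) * cmean n b j t)"
  define rbad where "rbad = (\<lambda>x t \<phi>. lo < card x + 16 \<and> card x + 16 \<le> hi \<and>
    (\<Sum>y\<in>above n x (card x + 16). of_bool (\<phi> y = t) * rfl n b \<phi> y)
     > (1 + 1 / real n) * real ((n - card x) choose 16) * rmean b t)"
  have cprob: "avg ?V b (\<lambda>\<phi>. of_bool (cbad y t \<phi>)) \<le> exp (- (3 * real n))"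
    if y: "y \<in> ?V" and t: "t < b" for y t
  proof (cases "\<exists>j. lo \<le> j \<and> j \<le> hi \<and> card y = j + 16")
    case True
    then obtain j where j: "lo \<le> j" "j \<le> hi" "card y = j + 16" by blast
    have fy: "finite y" using y finite_subset[of y "{1..n}"] by auto
    have jj: "n \<le> 2 * j + 1" "144 * b ^ 5 \<le> Suc j" using j b lo by auto
    define L where "L = below y j"
    have LV: "L \<subseteq> ?V" using y by (auto simp: L_def below_def)
    have Ll: "x \<in> level n j" if "x \<in> L" for x
      using that y by (auto simp: L_def below_def level_def)
    have cL: "card L = (j + 16) choose 16"
      using card_below[OF fy, of j] j binomial_symmetric[of 16 "j + 16"] by (simp add: L_def)
    have big: "768 * real n ^ 9 \<le> real (card L)"
      unfolding cL using j lo n by (intro binomial_16_large) auto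
    have Lne: "L \<noteq> {}" using big n1 by auto
    \<comment> \<open>The sign turns the lower tail needed here into the upper tail of
      \<open>local_sum_tail\<close>.\<close>
    define f where "f = (\<lambda>\<phi> x. - (of_bool (\<phi> x = t) * cfl n b \<phi> x))"
    have avgf: "avg ?V b (\<lambda>\<phi>. \<Sum>x\<in>L. f \<phi> x) = - (real (card L) * cmean n b j t)"
    proof -
      have "avg ?V b (\<lambda>\<phi>. \<Sum>x\<in>L. f \<phi> x) = (\<Sum>x\<in>L. avg ?V b (\<lambda>\<phi>. -1 * (of_bool (\<phi> x = t) * cfl n b \<phi> x)))"
        by (subst avg_sum) (simp add: f_def)
      also have "\<dots> = (\<Sum>x\<in>L. - cmean n b j t)"
        by (rule sum.cong[OF refl], subst avg_cmult, subst avg_cfl[OF Ll t jj]) (auto simp: cmean_def)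
      finally show ?thesis by simp
    qed
    define s where "s = real (card L) * cmean n b j t / real n"
    have cm: "kap b / real b \<le> cmean n b j t" "cmean n b j t \<le> 1"
      using cmean_bounds[OF b(1) jj(1), of t] by auto
    have cm0: "0 \<le> cmean n b j t" using cm kap_bounds[OF b(1)] by (meson divide_nonneg_nonneg less_imp_le of_nat_0_le_iff order_trans)
    have "s \<le> real (card L)"
    proof -
      have "cmean n b j t / real n \<le> 1" using cm cm0 n1 by (simp add: divide_le_eq)
      then show ?thesis unfolding s_def times_divide_eq_right[symmetric] by (intro mult_left_le) auto
    qed
    moreover have "0 \<le> s" using cm0 by (simp add: s_def)
    ultimately have "avg ?V b (\<lambda>\<phi>. of_bool ((\<Sum>x\<in>L. f \<phi> x) \<ge> avg ?V b (\<lambda>\<phi>. \<Sum>x\<in>L. f \<phi> x) + s))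
       \<le> exp (- s\<^sup>2 / (16 * real n ^ 4 * real (card L)))"
    proof (intro local_sum_tail LV Lne n1 b(1))
      fix x and \<phi> \<psi> :: "nat set \<Rightarrow> nat" assume x: "x \<in> L" and eq: "\<And>v. v \<in> nbhd n x \<Longrightarrow> \<phi> v = \<psi> v"
      have "cfl n b \<phi> x = cfl n b \<psi> x" "\<phi> x = \<psi> x"
        using cfl_local[where \<phi> = \<phi> and \<psi> = \<psi>, OF Ll[OF x]] eq by blast+
      then show "f \<phi> x = f \<psi> x" by (simp add: f_def)
    next
      fix x \<phi> \<psi> assume *: "x \<in> L" "\<phi> \<in> ?\<Omega>" "\<psi> \<in> ?\<Omega>"
      show "\<bar>f \<phi> x - f \<psi> x\<bar> \<le> 1"
        using cfl_bounds[OF Ll[OF *(1)] *(2) jj] cfl_bounds[OF Ll[OF *(1)] *(3) jj] by (auto simp: f_def)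
    qed auto
    also have "\<dots> \<le> exp (- (3 * real n))"
      unfolding s_def using deviation_exponent[OF b(1,2) big cm(1)] by simp
    finally have *: "avg ?V b (\<lambda>\<phi>. of_bool ((\<Sum>x\<in>L. f \<phi> x) \<ge> avg ?V b (\<lambda>\<phi>. \<Sum>x\<in>L. f \<phi> x) + s)) \<le> exp (- (3 * real n))" .
    have "avg ?V b (\<lambda>\<phi>. of_bool (cbad y t \<phi>))
      \<le> avg ?V b (\<lambda>\<phi>. of_bool ((\<Sum>x\<in>L. f \<phi> x) \<ge> avg ?V b (\<lambda>\<phi>. \<Sum>x\<in>L. f \<phi> x) + s))"
    proof (rule avg_mono)
      fix \<phi>
      have "(\<Sum>x\<in>L. f \<phi> x) \<ge> - (real (card L) * cmean n b j t) + s" if "cbad y t \<phi>"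
      proof -
        have "(\<Sum>x\<in>L. of_bool (\<phi> x = t) * cfl n b \<phi> x) < (1 - 1 / real n) * real ((j + 16) choose j) * cmean n b j t"
          using that j by (auto simp: cbad_def L_def)
        moreover have "(j + 16) choose j = card L"
          using cL binomial_symmetric[of 16 "j + 16"] by simp
        ultimately show ?thesis
          by (simp add: f_def sum_negf s_def algebra_simps)
      qed
      then show "of_bool (cbad y t \<phi>) \<le> (of_bool ((\<Sum>x\<in>L. f \<phi> x) \<ge> avg ?V b (\<lambda>\<phi>. \<Sum>x\<in>L. f \<phi> x) + s) :: real)"
        unfolding avgf by simp
    qed
    then show ?thesis using * by linarith
  next
    case False
    then have "\<not> cbad y t \<phi>" for \<phi> by (auto simp: cbad_def)
    then show ?thesis using b by (simp add: avg_const)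
  qed
  have rprob: "avg ?V b (\<lambda>\<phi>. of_bool (rbad x t \<phi>)) \<le> exp (- (3 * real n))"
    if x: "x \<in> ?V" and t: "t < b" for x t
  proof (cases "lo < card x + 16 \<and> card x + 16 \<le> hi")
    case True
    define i where "i = card x"
    \<comment> \<open>The sets summed over have size \<open>i + 16 = Suc j\<close>, the form in
      which \<open>avg_rfl\<close> and \<open>rfl_bounds\<close> are stated.\<close>
    define j where "j = i + 15"
    have xl: "x \<in> level n i" using x by (simp add: level_def i_def)
    have jj: "n \<le> 2 * j + 1" "144 * b ^ 5 \<le> Suc j" using True b lo by (auto simp: j_def i_def)
    define L where "L = above n x (i + 16)"
    have LV: "L \<subseteq> ?V" by (auto simp: L_def above_def)
    have Ll: "y \<in> level n (Suc j)" if "y \<in> L" for y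
      using that by (auto simp: L_def above_def level_def j_def)
    have cL: "card L = (n - i) choose 16"
      using card_above[OF xl, of "i + 16"] by (simp add: L_def)
    have big: "768 * real n ^ 9 \<le> real (card L)"
      unfolding cL using True hi n by (intro binomial_16_large) (auto simp: i_def)
    have Lne: "L \<noteq> {}" using big n1 by auto
    define f where "f = (\<lambda>\<phi> y. of_bool (\<phi> y = t) * rfl n b \<phi> y)"
    have avgf: "avg ?V b (\<lambda>\<phi>. \<Sum>y\<in>L. f \<phi> y) = real (card L) * rmean b t"
    proof -
      have "avg ?V b (\<lambda>\<phi>. \<Sum>y\<in>L. f \<phi> y) = (\<Sum>y\<in>L. avg ?V b (\<lambda>\<phi>. of_bool (\<phi> y = t) * rfl n b \<phi> y))"
        by (subst avg_sum) (simp add: f_def)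
      also have "\<dots> = (\<Sum>y\<in>L. rmean b t)"
        by (rule sum.cong[OF refl], subst avg_rfl[OF Ll t jj]) (auto simp: rmean_def)
      finally show ?thesis by simp
    qed
    define s where "s = real (card L) * rmean b t / real n"
    have cm: "kap b / real b \<le> rmean b t" "rmean b t \<le> 1"
      using rmean_bounds[OF b(1), of t] by auto
    have cm0: "0 \<le> rmean b t" using cm kap_bounds[OF b(1)] by (meson divide_nonneg_nonneg less_imp_le of_nat_0_le_iff order_trans)
    have "s \<le> real (card L)"
    proof -
      have "rmean b t / real n \<le> 1" using cm cm0 n1 by (simp add: divide_le_eq)
      then show ?thesis unfolding s_def times_divide_eq_right[symmetric] by (intro mult_left_le) auto
    qed
    moreover have "0 \<le> s" using cm0 by (simp add: s_def)
    ultimately have "avg ?V b (\<lambda>\<phi>. of_bool ((\<Sum>x\<in>L. f \<phi> x) \<ge> avg ?V b (\<lambda>\<phi>. \<Sum>x\<in>L. f \<phi> x) + s))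
       \<le> exp (- s\<^sup>2 / (16 * real n ^ 4 * real (card L)))"
    proof (intro local_sum_tail LV Lne n1 b(1))
      fix x and \<phi> \<psi> :: "nat set \<Rightarrow> nat" assume x: "x \<in> L" and eq: "\<And>v. v \<in> nbhd n x \<Longrightarrow> \<phi> v = \<psi> v"
      have "rfl n b \<phi> x = rfl n b \<psi> x" "\<phi> x = \<psi> x"
        using rfl_local[where \<phi> = \<phi> and \<psi> = \<psi>, OF Ll[OF x]] eq by blast+
      then show "f \<phi> x = f \<psi> x" by (simp add: f_def)
    next
      fix x \<phi> \<psi> assume *: "x \<in> L" "\<phi> \<in> ?\<Omega>" "\<psi> \<in> ?\<Omega>"
      show "\<bar>f \<phi> x - f \<psi> x\<bar> \<le> 1"
        using rfl_bounds[OF Ll[OF *(1)] *(2) jj] rfl_bounds[OF Ll[OF *(1)] *(3) jj] by (auto simp: f_def)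
    qed auto
    also have "\<dots> \<le> exp (- (3 * real n))"
      unfolding s_def using deviation_exponent[OF b(1,2) big cm(1)] by simp
    finally have *: "avg ?V b (\<lambda>\<phi>. of_bool ((\<Sum>x\<in>L. f \<phi> x) \<ge> avg ?V b (\<lambda>\<phi>. \<Sum>x\<in>L. f \<phi> x) + s)) \<le> exp (- (3 * real n))" .
    have "avg ?V b (\<lambda>\<phi>. of_bool (rbad x t \<phi>))
      \<le> avg ?V b (\<lambda>\<phi>. of_bool ((\<Sum>x\<in>L. f \<phi> x) \<ge> avg ?V b (\<lambda>\<phi>. \<Sum>x\<in>L. f \<phi> x) + s))"
    proof (rule avg_mono)
      fix \<phi>
      have "(\<Sum>x\<in>L. f \<phi> x) \<ge> real (card L) * rmean b t + s" if "rbad x t \<phi>"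
      proof -
        have "(\<Sum>y\<in>L. f \<phi> y) > (1 + 1 / real n) * real (card L) * rmean b t"
          using that unfolding rbad_def i_def[symmetric] L_def[symmetric] cL f_def by blast
        then show ?thesis by (simp add: s_def algebra_simps)
      qed
      then show "of_bool (rbad x t \<phi>) \<le> (of_bool ((\<Sum>x\<in>L. f \<phi> x) \<ge> avg ?V b (\<lambda>\<phi>. \<Sum>x\<in>L. f \<phi> x) + s) :: real)"
        unfolding avgf by simp
    qed
    then show ?thesis using * by linarith
  next
    case False
    then have "\<not> rbad x t \<phi>" for \<phi> by (auto simp: rbad_def)
    then show ?thesis using b by (simp add: avg_const)
  qed
  define P where "P = (\<lambda>(y, t, k) \<phi>. if k then cbad y t \<phi> else rbad y t \<phi>)"
  have "(\<Sum>i\<in>?V \<times> {..<b} \<times> (UNIV :: bool set). avg ?V b (\<lambda>\<phi>. of_bool (P i \<phi>)))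
     \<le> (\<Sum>i\<in>?V \<times> {..<b} \<times> (UNIV :: bool set). exp (- (3 * real n)))"
  proof (rule sum_mono)
    fix i assume "i \<in> ?V \<times> {..<b} \<times> (UNIV :: bool set)"
    then obtain y t k where i: "i = (y, t, k)" "y \<in> ?V" "t < b" by auto
    show "avg ?V b (\<lambda>\<phi>. of_bool (P i \<phi>)) \<le> exp (- (3 * real n))"
      using cprob[OF i(2,3)] rprob[OF i(2,3)] by (cases k) (simp_all add: P_def i(1))
  qed
  also have "\<dots> = 2 ^ n * (real b * 2) * exp (- (3 * real n))"
    by (simp add: card_cartesian_product card_Pow)
  also have "\<dots> < 1"
  proof -
    have "b ^ 1 \<le> b ^ 5" using b by (intro power_increasing) auto
    then have "real b \<le> real n" using b by simp
    moreover have "2 * real n < exp (real n)"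
    proof -
      have "0 < (real n - 1)\<^sup>2 / 2 + 1 / 2" by (simp add: add_nonneg_pos)
      then have "2 * real n < 1 + real n + (real n)\<^sup>2 / 2" by (simp add: power2_eq_square field_simps)
      also have "\<dots> \<le> exp (real n)" by (rule exp_lower_Taylor_quadratic) simp
      finally show ?thesis .
    qed
    ultimately have "real b * 2 < exp (real n)" by linarith
    moreover have "2 ^ n \<le> exp (real n)"
      using power_mono[of 2 "exp 1::real" n] exp_ge_add_one_self[of 1] by (simp flip: exp_of_nat_mult)
    ultimately have "2 ^ n * (real b * 2) \<le> exp (real n) * exp (real n)"
      by (intro mult_mono) auto
    then have "2 ^ n * (real b * 2) * exp (- (3 * real n)) \<le> exp (real n) * exp (real n) * exp (- (3 * real n))"
      by (intro mult_right_mono) auto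
    also have "\<dots> = exp (- real n)" by (simp flip: exp_add)
    also have "\<dots> < 1" using n1 by simp
    finally show ?thesis .
  qed
  finally obtain \<phi> where \<phi>: "\<phi> \<in> ?\<Omega>" "\<forall>i\<in>?V \<times> {..<b} \<times> UNIV. \<not> P i \<phi>"
    using union_bound_colouring[where V = ?V and b = b and I = "?V \<times> {..<b} \<times> UNIV" and P = P] b by auto
  then have good: "\<not> cbad y t \<phi>" "\<not> rbad y t \<phi>" if "y \<in> ?V" "t < b" for y t
  proof -
    have "\<not> P (y, t, True) \<phi>" "\<not> P (y, t, False) \<phi>" using \<phi>(2) that by blast+
    then show "\<not> cbad y t \<phi>" "\<not> rbad y t \<phi>" by (simp_all add: P_def)
  qed
  show ?thesis
  proof (intro bexI[OF _ \<phi>(1)] conjI allI impI)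
    fix j y t assume "lo \<le> j" "j \<le> hi" "y \<in> level n (j + 16)" "t < b"
    then show "(1 - 1 / real n) * real ((j + 16) choose j) * cmean n b j t
         \<le> (\<Sum>x\<in>below y j. of_bool (\<phi> x = t) * cfl n b \<phi> x)"
      using good(1)[of y t] by (force simp: cbad_def level_def not_less)
  next
    fix j x t assume "lo < j + 16" "j + 16 \<le> hi" "x \<in> level n j" "t < b"
    then show "(\<Sum>y\<in>above n x (j + 16). of_bool (\<phi> y = t) * rfl n b \<phi> y)
         \<le> (1 + 1 / real n) * real ((n - j) choose 16) * rmean b t"
      using good(2)[of x t] by (auto simp: rbad_def level_def not_less)
  qed
qed

text \<open>The estimate at distance 16 is averaged over the sets \<open>u\<close> of size
  \<open>j + 16\<close> below \<open>y\<close>, so larger distances cost no further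
  probability.\<close>

lemma spread_below:
  assumes y: "y \<in> level n k" and j: "j + 16 \<le> k"
    and base: "\<And>u. u \<in> level n (j + 16) \<Longrightarrow> A * real ((j + 16) choose j) \<le> (\<Sum>x\<in>below u j. c x)"
  shows "A * real (k choose j) \<le> (\<Sum>x\<in>below y j. c x)"
proof -
  have fy: "finite y" and cy: "card y = k" using y finite_mem_level[OF y] by (auto simp: level_def)
  have "(A * real (k choose j)) * real ((k - j) choose 16) = A * real ((k choose (j + 16)) * ((j + 16) choose j))"
    using choose_mult[of j "j + 16" k] j by simp
  also have "\<dots> = (\<Sum>u\<in>below y (j + 16). A * real ((j + 16) choose j))"
    using card_below[OF fy, of "j + 16"] cy by simp
  also have "\<dots> \<le> (\<Sum>u\<in>below y (j + 16). \<Sum>x\<in>below u j. c x)"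
    using below_subset_level[OF y] by (intro sum_mono base) auto
  also have "\<dots> = (\<Sum>x\<in>below y j. c x) * real ((k - j) choose 16)"
    using sum_below_intermediate[OF fy, of j "j + 16" c] cy j by simp
  finally show ?thesis
    using j by (subst (asm) mult_le_cancel_right) (auto simp: binomial_eq_0_iff)
qed

lemma spread_above:
  assumes x: "x \<in> level n i" and k: "i + 16 \<le> k" "k \<le> n"
    and base: "\<And>u. u \<in> level n (k - 16) \<Longrightarrow> (\<Sum>y\<in>above n u k. c y) \<le> A * real ((n - (k - 16)) choose 16)"
  shows "(\<Sum>y\<in>above n x k. c y) \<le> A * real ((n - i) choose (k - i))"
proof -
  have e: "k - (k - 16) = 16" "k - 16 - i \<le> k - i" "(n - i) - (k - 16 - i) = n - (k - 16)" "(k - i) - (k - 16 - i) = 16"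
    using k by auto
  have "(\<Sum>y\<in>above n x k. c y) * real ((k - i) choose (k - 16 - i)) = (\<Sum>u\<in>above n x (k - 16). \<Sum>y\<in>above n u k. c y)"
    using sum_above_intermediate[OF x, of "k - 16" k c] k by simp
  also have "\<dots> \<le> (\<Sum>u\<in>above n x (k - 16). A * real ((n - (k - 16)) choose 16))"
    using above_subset_level by (intro sum_mono base) auto
  also have "\<dots> = A * real (((n - i) choose (k - 16 - i)) * ((n - (k - 16)) choose 16))"
    using card_above[OF x, of "k - 16"] k by simp
  also have "\<dots> = (A * real ((n - i) choose (k - i))) * real ((k - i) choose (k - 16 - i))"
  proof -
    have "((n - i) choose (k - 16 - i)) * ((n - (k - 16)) choose 16) = ((n - i) choose (k - i)) * ((k - i) choose (k - 16 - i))"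
      using choose_mult[of "k - 16 - i" "k - i" "n - i"] k unfolding e by simp
    then show ?thesis by (simp only: of_nat_mult mult.assoc)
  qed
  finally show ?thesis
    using k by (subst (asm) mult_le_cancel_right) (auto simp: binomial_eq_0_iff)
qed

section \<open>Transport between blocks\<close>

text \<open>The projection of \<open>z\<close> to the interval from \<open>u\<close> to
  \<open>v\<close>. Lengths of intersections become differences of projections, and sums over
  consecutive intervals telescope.\<close>

definition clamp :: "real \<Rightarrow> real \<Rightarrow> real \<Rightarrow> real" where
  "clamp u v z = max u (min v z)"

text \<open>Both sides are the length of the intersection of \<open>[p, q]\<close> and
  \<open>[u, v]\<close>.\<close>

lemma clamp_swap: "p \<le> q \<Longrightarrow> u \<le> v \<Longrightarrow> clamp u v q - clamp u v p = clamp p q v - clamp p q u"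
  unfolding clamp_def max_def min_def by (smt (verit))

lemma clamp_mono: "p \<le> q \<Longrightarrow> clamp u v p \<le> clamp u v q"
  unfolding clamp_def by (intro max.mono min.mono) auto

lemma clamp_bounds: "u \<le> v \<Longrightarrow> u \<le> clamp u v z \<and> clamp u v z \<le> v"
  by (auto simp: clamp_def)

lemma clamp_low: "u \<le> v \<Longrightarrow> z \<le> u \<Longrightarrow> clamp u v z = u"
  by (simp add: clamp_def)

lemma clamp_high: "u \<le> v \<Longrightarrow> v \<le> z \<Longrightarrow> clamp u v z = v"
  by (simp add: clamp_def)

text \<open>Change of variables from levels to runs \<open>h = j - s\<close>. A run begun below
  \<open>k0\<close> enters at level \<open>k0\<close> with phase \<open>k0 - h\<close>, so the first
  run is \<open>k0 + 1 - b\<close>.\<close>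

lemma sum_phase_reindex:
  fixes F :: "nat \<Rightarrow> nat \<Rightarrow> real"
  assumes "b \<le> k0" "k0 \<le> k1"
  shows "(\<Sum>j=k0..k1. \<Sum>s<b. F (j - s) s)
    = (\<Sum>h=k0+1-b..k1. \<Sum>s<b. if k0 \<le> h + s \<and> h + s \<le> k1 then F h s else 0)"
proof -
  have "(\<Sum>j=k0..k1. F (j - s) s) = (\<Sum>h=k0+1-b..k1. if k0 \<le> h + s \<and> h + s \<le> k1 then F h s else 0)"
    if s: "s < b" for s
  proof -
    have "(\<Sum>j=k0..k1. F (j - s) s) = (\<Sum>h\<in>{h\<in>{k0+1-b..k1}. k0 \<le> h + s \<and> h + s \<le> k1}. F h s)"
      by (rule sum.reindex_bij_witness[where i = "\<lambda>h. h + s" and j = "\<lambda>j. j - s"]) (use s assms in auto)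
    also have "\<dots> = (\<Sum>h=k0+1-b..k1. if k0 \<le> h + s \<and> h + s \<le> k1 then F h s else 0)"
      by (rule sum.inter_filter) simp
    finally show ?thesis .
  qed
  then show ?thesis by (subst (1 2) sum.swap) simp
qed

text \<open>\<open>a0\<close> is the starting level, at or above the middle; \<open>k0\<close> and
  \<open>k1\<close> are the first and the last level that are organised in blocks.\<close>

locale blocks =
  fixes n b a0 k0 k1 :: nat
  assumes b20: "20 \<le> b" and bk0: "b \<le> k0" and na0: "n \<le> 2 * a0" and a0k0: "a0 + 16 \<le> k0"
    and k01: "k0 < k1" and k1n: "k1 < n"
begin

text \<open>Block \<open>(j, s)\<close> consists of the sets of size \<open>j\<close> and phase \<open>s\<close>; it belongs to the run \<open>j - s\<close>.
  Run \<open>h\<close> has mass \<open>m h\<close> (only its part from level \<open>k0\<close> on exists), and the runs are laid out as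
  consecutive intervals starting at \<open>A h\<close>. A run \<open>g\<close> is fed by the runs whose intervals, shifted by
  \<open>lam\<close>, meet that of \<open>g\<close>; the inflation by \<open>1 + ep\<close> absorbs the error of the concentration.
  Targets that the shifted intervals do not cover are fed by the reservoir, i.e. by the capacity
  that the levels from \<open>a0\<close> to \<open>k0 - 16\<close> do not use.\<close>

definition N :: "nat \<Rightarrow> real" where "N k = real (n choose k)"
definition ep :: real where "ep = 4 / real n"
definition m :: "nat \<Rightarrow> real" where "m h = N (max h k0) / real b"
definition A :: "nat \<Rightarrow> real" where "A g = (\<Sum>h=k0+1-b..<g. m h)"
definition lam :: real where "lam = N k0 * (1 + 18 / real b)"
definition overlap :: "nat \<Rightarrow> nat \<Rightarrow> real" where
  "overlap h g = clamp ((1 + ep) * A g) ((1 + ep) * A (Suc g)) (A (Suc h) + lam)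
    - clamp ((1 + ep) * A g) ((1 + ep) * A (Suc g)) (A h + lam)"
definition fed :: "nat \<Rightarrow> nat \<Rightarrow> bool" where
  "fed k t \<longleftrightarrow> (1 + ep) * A (k - t) < lam + (if t = 0 then 0 else N k0)"
definition PR :: "nat \<Rightarrow> nat \<Rightarrow> nat \<Rightarrow> real" where
  "PR k t j = (if fed k t then (N j - N (Suc j)) / (N a0 - N (k0 - 15)) else 0)"
definition outflow :: "nat \<Rightarrow> nat \<Rightarrow> real" where
  "outflow j s = (if Suc s < b then N j - N (Suc j) else N j) / real b"
text \<open>\<open>P k t j s\<close> is the share of the residual demand of block \<open>(k, t)\<close> that block \<open>(j, s)\<close> serves.
  A first block (\<open>t = 0\<close>) takes what leaves a run for good; any other block \<open>(k, t)\<close> takes from phase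
  \<open>t - 1\<close> what the flow inside a run misses.\<close>

definition P :: "nat \<Rightarrow> nat \<Rightarrow> nat \<Rightarrow> nat \<Rightarrow> real" where
  "P k t j s = (if fed k t then 0
    else if t = 0 then overlap (j - s) k / ((1 + ep) * m k) * (outflow j s / m (j - s))
    else if Suc s = t then overlap (j - s) (k - t) / ((1 + ep) * m (k - t)) else 0)"
definition pos :: "nat \<Rightarrow> nat \<Rightarrow> nat" where
  "pos j s = k0 + nat \<lfloor>real b * A (j - s) / N k0\<rfloor> + s"
definition R :: "nat \<Rightarrow> nat \<Rightarrow> real" where "R k t = N k * rmean b t"
definition C :: "nat \<Rightarrow> nat \<Rightarrow> real" where "C j s = N j * cmean n b j s"

lemma b0: "b > 0" using b20 by simp

lemma n0: "n > 0" using k1n by simp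

lemma ep0: "ep > 0" using n0 by (simp add: ep_def)

lemma N_pos: "k \<le> n \<Longrightarrow> N k > 0"
  by (simp add: N_def)

lemma N_nonneg: "N k \<ge> 0"
  by (simp add: N_def)

lemma N_anti: "a0 \<le> j \<Longrightarrow> j \<le> k \<Longrightarrow> N k \<le> N j"
  using binomial_antimono[of n j k] na0 by (simp add: N_def)

lemma Nk0: "N k0 > 0" using N_pos k01 k1n by simp

lemma m_pos: "h \<le> k1 \<Longrightarrow> m h > 0"
  unfolding m_def using N_pos[of "max h k0"] k01 k1n b0 by simp

lemma m_nonneg: "m h \<ge> 0"
  unfolding m_def using N_nonneg by simp

lemma m_le: "m h \<le> N k0 / real b"
  unfolding m_def using N_anti[of k0 "max h k0"] a0k0 by (intro divide_right_mono) auto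

lemma m_eq: "k0 \<le> h \<Longrightarrow> m h = N h / real b"
  by (simp add: m_def max_def)

lemma A_Suc: "k0 + 1 - b \<le> g \<Longrightarrow> A (Suc g) = A g + m g"
  by (simp add: A_def)

lemma A_mono: "g \<le> h \<Longrightarrow> A g \<le> A h"
  unfolding A_def using m_nonneg by (intro sum_mono2) auto

lemma A_nonneg: "0 \<le> A g"
  unfolding A_def using m_nonneg by (intro sum_nonneg) auto

lemma A_start: "A (k0 + 1 - b) = 0"
  by (simp add: A_def)

lemma A_Suc_k0: "A (Suc k0) = N k0"
proof -
  have "A (Suc k0) = (\<Sum>h=k0+1-b..<Suc k0. N k0 / real b)"
    unfolding A_def by (rule sum.cong) (auto simp: m_def max_def)
  also have "\<dots> = N k0"
    using bk0 b0 by (simp add: Suc_diff_le)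
  finally show ?thesis .
qed

lemma A_diff_le:
  assumes "h \<le> g"
  shows "A g - A h \<le> real (g - h) * (N k0 / real b)"
  using assms
proof (induction g rule: dec_induct)
  case (step g)
  have "A (Suc g) \<le> A g + m g"
    using m_nonneg by (cases "k0 + 1 - b \<le> g") (auto simp: A_def)
  moreover have "real (Suc g - h) * (N k0 / real b) = real (g - h) * (N k0 / real b) + N k0 / real b"
    using step.hyps by (simp add: Suc_diff_le distrib_right add_divide_distrib)
  ultimately show ?case using step.IH m_le[of g] by linarith
qed simp

lemma overlap_nonneg: "0 \<le> overlap h g"
  unfolding overlap_def using clamp_mono[of "A h + lam" "A (Suc h) + lam"] A_mono[of h "Suc h"] by simp

lemma overlap_alt: "overlap h g = clamp (A h + lam) (A (Suc h) + lam) ((1 + ep) * A (Suc g))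
    - clamp (A h + lam) (A (Suc h) + lam) ((1 + ep) * A g)"
  unfolding overlap_def using A_mono[of h "Suc h"] A_mono[of g "Suc g"] ep0
  by (intro clamp_swap) (auto intro: mult_left_mono)

lemma overlap_pos:
  assumes "overlap h g \<noteq> 0"
  shows "(1 + ep) * A (Suc g) > A h + lam" "(1 + ep) * A g < A (Suc h) + lam"
proof -
  have le: "A h + lam \<le> A (Suc h) + lam" "(1 + ep) * A g \<le> (1 + ep) * A (Suc g)"
    using A_mono[of h "Suc h"] A_mono[of g "Suc g"] ep0 by (auto intro: mult_left_mono)
  show "(1 + ep) * A (Suc g) > A h + lam"
  proof (rule ccontr)
    assume "\<not> (1 + ep) * A (Suc g) > A h + lam"
    then have "overlap h g = (1 + ep) * A (Suc g) - (1 + ep) * A (Suc g)"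
      unfolding overlap_def using le by (intro arg_cong2[of _ _ _ _ "(-)"] clamp_high) auto
    then show False using assms by simp
  qed
  show "(1 + ep) * A g < A (Suc h) + lam"
  proof (rule ccontr)
    assume "\<not> (1 + ep) * A g < A (Suc h) + lam"
    then have "overlap h g = (1 + ep) * A g - (1 + ep) * A g"
      unfolding overlap_def using le by (intro arg_cong2[of _ _ _ _ "(-)"] clamp_low) auto
    then show False using assms by simp
  qed
qed

text \<open>The inflated target intervals are consecutive, so their parts inside the shifted
  interval of \<open>h\<close> add up to at most its length.\<close>

lemma sum_overlap_targets: "(\<Sum>g=k0+1-b..k1. overlap h g) \<le> m h"
proof -
  define f where "f = (\<lambda>g. clamp (A h + lam) (A (Suc h) + lam) ((1 + ep) * A g))"
  have "(\<Sum>g=k0+1-b..k1. overlap h g) = (\<Sum>g=k0+1-b..k1. f (Suc g) - f g)"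
    by (simp add: overlap_alt f_def)
  also have "\<dots> = f (Suc k1) - f (k0 + 1 - b)"
    using k01 by (intro sum_Suc_diff) simp
  also have "\<dots> \<le> (A (Suc h) + lam) - (A h + lam)"
    unfolding f_def using clamp_bounds A_mono[of h "Suc h"] by (intro diff_mono) auto
  also have "\<dots> \<le> m h"
    using m_nonneg by (cases "k0 + 1 - b \<le> h") (auto simp: A_def)
  finally show ?thesis .
qed

lemma sum_overlap_targets_subset:
  assumes "I \<subseteq> {k0+1-b..k1}"
  shows "(\<Sum>g\<in>I. overlap h g) \<le> m h"
proof -
  have "(\<Sum>g\<in>I. overlap h g) \<le> (\<Sum>g=k0+1-b..k1. overlap h g)"
    using assms overlap_nonneg by (intro sum_mono2) auto
  then show ?thesis using sum_overlap_targets[of h] by linarith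
qed

end

text \<open>\<open>epA\<close> limits the total effect of the inflation to one run mass
  \<open>N k0 / b\<close>; \<open>reservoir\<close> provides for 20 such masses, the amount counted
  in \<open>sum_fed\<close>.\<close>

locale calibrated_blocks = blocks +
  assumes epA: "ep * A (Suc k1) \<le> N k0 / real b"
    and reservoir: "(1 + ep) * (N k0 * 20 / real b) \<le> N a0 - N (k0 - 15)"
begin

lemma lam_ge: "N k0 \<le> lam"
  unfolding lam_def using Nk0 b0 by (simp add: field_simps)

lemma epA_le: "g \<le> Suc k1 \<Longrightarrow> ep * A g \<le> N k0 / real b"
  using epA A_mono[of g "Suc k1"] ep0 by (meson mult_left_mono less_imp_le order_trans)

text \<open>The shifted intervals of all runs cover everything from \<open>lam\<close> to
  \<open>A (Suc k1) + lam\<close>. The inflated target interval does not reach beyond, as inflation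
  adds at most \<open>N k0 / b\<close>, which is less than \<open>lam\<close>.\<close>

lemma sum_overlap_sources:
  assumes "lam \<le> (1 + ep) * A g" "k0 + 1 - b \<le> g" "g \<le> k1"
  shows "(\<Sum>h=k0+1-b..k1. overlap h g) = (1 + ep) * m g"
proof -
  define f where "f = (\<lambda>h. clamp ((1 + ep) * A g) ((1 + ep) * A (Suc g)) (A h + lam))"
  have "(\<Sum>h=k0+1-b..k1. overlap h g) = (\<Sum>h=k0+1-b..k1. f (Suc h) - f h)"
    by (simp add: overlap_def f_def)
  also have "\<dots> = f (Suc k1) - f (k0 + 1 - b)"
    using k01 by (intro sum_Suc_diff) simp
  also have "f (k0 + 1 - b) = (1 + ep) * A g"
    using assms A_start A_mono[of g "Suc g"] ep0 by (simp add: f_def clamp_def)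
  also have "f (Suc k1) = (1 + ep) * A (Suc g)"
  proof -
    have "N k0 / real b \<le> N k0 / 1"
      using b0 Nk0 by (intro divide_left_mono) auto
    then have "ep * A (Suc g) \<le> lam"
      using epA_le[of "Suc g"] lam_ge assms by simp
    moreover have "A (Suc g) \<le> A (Suc k1)"
      using A_mono assms by simp
    ultimately have "(1 + ep) * A (Suc g) \<le> A (Suc k1) + lam"
      by (simp add: algebra_simps)
    moreover have "(1 + ep) * A g \<le> (1 + ep) * A (Suc g)"
      using A_mono[of g "Suc g"] ep0 by (intro mult_left_mono) auto
    ultimately show ?thesis by (simp add: f_def clamp_def)
  qed
  finally show ?thesis
    using A_Suc[of g] assms by (simp add: algebra_simps)
qed

text \<open>The shift \<open>lam\<close> is \<open>b + 18\<close> maximal run masses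
  \<open>N k0 / b\<close>. One is lost to the inflation and one to the width of the target interval.
  The gap in run numbers keeps levels at least 16 apart whatever the phases are; the gap in
  \<open>A\<close> raises \<open>pos\<close> by \<open>b\<close>, which outweighs any drop of the
  phase.\<close>

lemma overlap_gap:
  assumes "overlap h g \<noteq> 0" "g \<le> k1"  "k0 + 1 - b \<le> g"
  shows "h + b + 17 \<le> g" "A h + N k0 \<le> A g"
proof -
  have "(1 + ep) * A (Suc g) > A h + lam" using overlap_pos assms by blast
  then have 1: "A (Suc g) - A h > lam - N k0 / real b"
  proof -
    have "(1 + ep) * A (Suc g) = A (Suc g) + ep * A (Suc g)" by (simp add: algebra_simps)
    moreover have "ep * A (Suc g) \<le> N k0 / real b" using epA_le[of "Suc g"] assms by simp
    ultimately show ?thesis using \<open>(1 + ep) * A (Suc g) > A h + lam\<close> by linarith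
  qed
  have 2: "lam - N k0 / real b = real (b + 17) * (N k0 / real b)"
    using b0 by (simp add: lam_def field_simps)
  have "h \<le> Suc g"
  proof (rule ccontr)
    assume "\<not> h \<le> Suc g"
    then have "A (Suc g) \<le> A h" using A_mono by simp
    moreover have "0 \<le> real (b + 17) * (N k0 / real b)" using Nk0 by simp
    ultimately show False using 1 2 by linarith
  qed
  then have "real (b + 17) * (N k0 / real b) < real (Suc g - h) * (N k0 / real b)"
    using A_diff_le[of h "Suc g"] 1 2 by linarith
  then have "real (b + 17) < real (Suc g - h)"
    by (rule mult_right_less_imp_less) (use Nk0 in simp)
  then have "b + 17 < Suc g - h" by linarith
  then show "h + b + 17 \<le> g" by linarith
  have "A (Suc g) = A g + m g" using A_Suc assms by simp
  then have "A g - A h > real (b + 17) * (N k0 / real b) - N k0 / real b"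
    using 1 2 m_le[of g] by linarith
  also have "real (b + 17) * (N k0 / real b) - N k0 / real b = N k0 + 16 * (N k0 / real b)"
    using b0 by (simp add: field_simps)
  finally have "A g - A h > N k0 + 16 * (N k0 / real b)" .
  moreover have "0 \<le> N k0 / real b" using Nk0 by simp
  ultimately show "A h + N k0 \<le> A g" by linarith
qed

text \<open>\<open>pos\<close> measures \<open>A\<close> in units of \<open>N k0 / b\<close>. A gap
  of \<open>N k0\<close> is worth exactly \<open>b\<close> units, an integer, so rounding down does
  no harm.\<close>

lemma pos_gap:
  assumes "A (j - s) + N k0 \<le> A (k - t)"
  shows "pos j s + b + t \<le> pos k t + s"
proof -
  have "real b * A (j - s) / N k0 + real b \<le> real b * A (k - t) / N k0"
  proof -
    have "real b * A (j - s) / N k0 + real b = real b * (A (j - s) + N k0) / N k0"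
      using Nk0 by (simp add: field_simps)
    also have "\<dots> \<le> real b * A (k - t) / N k0"
      using assms Nk0 by (intro divide_right_mono mult_left_mono) auto
    finally show ?thesis .
  qed
  then have "\<lfloor>real b * A (j - s) / N k0 + real b\<rfloor> \<le> \<lfloor>real b * A (k - t) / N k0\<rfloor>"
    by (rule floor_mono)
  moreover have "\<lfloor>real b * A (j - s) / N k0 + real b\<rfloor> = \<lfloor>real b * A (j - s) / N k0\<rfloor> + int b"
    using floor_add_int[of "real b * A (j - s) / N k0" "int b"] by simp
  moreover have "0 \<le> \<lfloor>real b * A (j - s) / N k0\<rfloor>"
    using A_nonneg Nk0 by simp
  ultimately have "nat \<lfloor>real b * A (j - s) / N k0\<rfloor> + b \<le> nat \<lfloor>real b * A (k - t) / N k0\<rfloor>"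
    by linarith
  then show ?thesis by (simp add: pos_def)
qed

lemma P_nonneg: "0 \<le> P k t j s" if "j \<le> k1" "k \<le> k1" "a0 \<le> j"
proof -
  have "0 \<le> outflow j s"
    using N_anti[of j "Suc j"] that N_nonneg by (simp add: outflow_def)
  then show ?thesis
    unfolding P_def using overlap_nonneg m_nonneg ep0 by (simp add: divide_nonneg_nonneg)
qed

lemma PR_nonneg: "a0 \<le> j \<Longrightarrow> 0 \<le> PR k t j"
  unfolding PR_def using N_anti[of j "Suc j"] N_anti[of a0 "k0 - 15"] a0k0
  by (auto intro!: divide_nonneg_nonneg)

lemma P_support:
  assumes "P k t j s \<noteq> 0" "k0 < k" "k \<le> k1" "t < b" "s < b" "k0 \<le> j"
  shows "j + 16 \<le> k" "pos j s < pos k t"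
proof -
  have js: "j = (j - s) + s" using assms bk0 by simp
  have kt: "k = (k - t) + t" "k0 + 1 - b \<le> k - t" "k - t \<le> k1" using assms bk0 by auto
  have o: "overlap (j - s) (k - t) \<noteq> 0"
    using assms(1) by (auto simp: P_def split: if_splits)
  have gap: "(j - s) + b + 17 \<le> k - t" "pos j s + b + t \<le> pos k t + s"
    using overlap_gap[OF o kt(3,2)] pos_gap by auto
  have st: "s < b + t" "t = 0 \<or> Suc s = t" using assms by (auto simp: P_def split: if_splits)
  show "j + 16 \<le> k" using gap js kt st assms by linarith
  show "pos j s < pos k t" using gap st by linarith
qed

text \<open>Telescoping along a run: the mass of its first block from level \<open>k0\<close> on
  leaves it again, the last phase releasing all that is left. The condition
  \<open>h + b <= k1\<close> keeps the run from being cut off at \<open>k1\<close>.\<close>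

lemma sum_outflow:
  assumes "k0 + 1 - b \<le> h" "h + b \<le> k1"
  shows "(\<Sum>s<b. if k0 \<le> h + s \<and> h + s \<le> k1 then outflow (h + s) s else 0) = m h"
proof -
  define d where "d = max h k0 - h"
  have d: "d < b" "h + d = max h k0" using assms bk0 b0 by (auto simp: d_def)
  have "(\<Sum>s<b. if k0 \<le> h + s \<and> h + s \<le> k1 then outflow (h + s) s else 0) = (\<Sum>s=d..<b. outflow (h + s) s)"
  proof -
    have "(\<Sum>s<b. if k0 \<le> h + s \<and> h + s \<le> k1 then outflow (h + s) s else 0) = (\<Sum>s\<in>{s\<in>{..<b}. k0 \<le> h + s \<and> h + s \<le> k1}. outflow (h + s) s)"
      by (rule sum.inter_filter[symmetric]) simp
    also have "{s\<in>{..<b}. k0 \<le> h + s \<and> h + s \<le> k1} = {d..<b}"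
      using assms by (auto simp: d_def max_def)
    finally show ?thesis .
  qed
  also have "\<dots> = (\<Sum>s=d..<b - 1. outflow (h + s) s) + outflow (h + (b - 1)) (b - 1)"
    using d b0 sum.atLeastLessThan_Suc[of d "b - 1" "\<lambda>s. outflow (h + s) s"] by simp
  also have "(\<Sum>s=d..<b - 1. outflow (h + s) s) = (\<Sum>s=d..<b - 1. - (N (h + Suc s) - N (h + s)) / real b)"
    by (rule sum.cong) (auto simp: outflow_def)
  also have "\<dots> = (N (h + d) - N (h + (b - 1))) / real b"
    using d sum_Suc_diff'[of d "b - 1" "\<lambda>s. N (h + s)"]
    by (simp only: sum_divide_distrib[symmetric] sum_negf) simp
  also have "\<dots> + outflow (h + (b - 1)) (b - 1) = m h"
    using b0 d by (simp add: outflow_def m_def diff_divide_distrib)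
  finally show ?thesis .
qed

lemma not_fed_lam: "\<not> fed k t \<Longrightarrow> lam \<le> (1 + ep) * A (k - t)"
  using Nk0 by (auto simp: fed_def split: if_splits)

text \<open>This is the reason for the extra \<open>N k0\<close> in \<open>fed\<close> at positive
  phases: a run begun below \<open>k0\<close> lacks its early phases, so its phase
  \<open>t - 1\<close> could lie below the blocks. First blocks need no such care, since they draw
  on whatever part of a run exists.\<close>

lemma not_fed_sources:
  assumes "\<not> fed k t" "t > 0" "overlap h (k - t) \<noteq> 0"
  shows "k0 \<le> h"
proof (rule ccontr)
  assume "\<not> k0 \<le> h"
  then have "A (Suc h) \<le> A (Suc k0)" using A_mono by simp
  moreover have "(1 + ep) * A (k - t) < A (Suc h) + lam" using overlap_pos assms by blast
  ultimately show False using assms A_Suc_k0 by (auto simp: fed_def)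
qed

lemma sum_P:
  assumes k: "k0 < k" "k \<le> k1" and t: "t < b"
  shows "(\<Sum>j=a0..k0-16. PR k t j) + (\<Sum>j=k0..k1. \<Sum>s<b. P k t j s) = 1"
proof (cases "fed k t")
  case True
  have "(\<Sum>j=a0..k0-16. N j - N (Suc j)) = - (\<Sum>j=a0..k0-16. N (Suc j) - N j)"
    by (simp add: sum_negf[symmetric])
  also have "(\<Sum>j=a0..k0-16. N (Suc j) - N j) = N (Suc (k0 - 16)) - N a0"
    using a0k0 by (intro sum_Suc_diff) simp
  also have "Suc (k0 - 16) = k0 - 15" using a0k0 by simp
  finally have "(\<Sum>j=a0..k0-16. N j - N (Suc j)) = N a0 - N (k0 - 15)" by simp
  moreover have "N a0 - N (k0 - 15) > 0"
  proof -
    have "0 < (1 + ep) * (N k0 * 20 / real b)" using ep0 Nk0 b0 by (simp add: add_pos_pos)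
    then show ?thesis using reservoir by linarith
  qed
  ultimately show ?thesis
    using True by (simp add: PR_def P_def sum_divide_distrib[symmetric])
next
  case False
  define g where "g = k - t"
  have g: "k0 + 1 - b \<le> g" "g \<le> k1" using k t by (auto simp: g_def)
  have S: "(\<Sum>h=k0+1-b..k1. overlap h g) = (1 + ep) * m g"
    using sum_overlap_sources[OF _ g] not_fed_lam[OF False] by (simp add: g_def)
  have mg: "(1 + ep) * m g > 0" using m_pos[OF g(2)] ep0 by simp
  have "(\<Sum>j=k0..k1. \<Sum>s<b. P k t j s) = 1"
  proof (cases "t = 0")
    case True
    define F where "F = (\<lambda>h s. overlap h g / ((1 + ep) * m g) * (outflow (h + s) s / m h))"
    have "(\<Sum>j=k0..k1. \<Sum>s<b. P k t j s) = (\<Sum>j=k0..k1. \<Sum>s<b. F (j - s) s)"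
    proof (intro sum.cong refl)
      fix j s assume "j \<in> {k0..k1}" "s \<in> {..<b}"
      then have "j - s + s = j" using bk0 by simp
      then show "P k t j s = F (j - s) s"
        using True False by (simp add: P_def F_def g_def)
    qed
    also have "\<dots> = (\<Sum>h=k0+1-b..k1. \<Sum>s<b. if k0 \<le> h + s \<and> h + s \<le> k1 then F h s else 0)"
      using bk0 k01 by (intro sum_phase_reindex) auto
    also have "\<dots> = (\<Sum>h=k0+1-b..k1. overlap h g / ((1 + ep) * m g))"
    proof (rule sum.cong[OF refl])
      fix h assume h: "h \<in> {k0+1-b..k1}"
      show "(\<Sum>s<b. if k0 \<le> h + s \<and> h + s \<le> k1 then F h s else 0) = overlap h g / ((1 + ep) * m g)"
      proof (cases "overlap h g = 0")
        case False
        have "h + b + 17 \<le> g" using overlap_gap[OF False g(2,1)] by simp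
        then have hb: "h + b \<le> k1" using g by simp
        have "(\<Sum>s<b. if k0 \<le> h + s \<and> h + s \<le> k1 then F h s else 0)
          = (\<Sum>s<b. overlap h g / ((1 + ep) * m g) / m h * (if k0 \<le> h + s \<and> h + s \<le> k1 then outflow (h + s) s else 0))"
          by (rule sum.cong) (auto simp: F_def)
        also have "\<dots> = overlap h g / ((1 + ep) * m g) / m h * m h"
          unfolding sum_distrib_left[symmetric] using sum_outflow[of h] h hb by simp
        also have "\<dots> = overlap h g / ((1 + ep) * m g)"
          using m_pos[of h] h by simp
        finally show ?thesis .
      qed (auto simp: F_def intro!: sum.neutral)
    qed
    also have "\<dots> = 1"
      unfolding sum_divide_distrib[symmetric] S by (rule divide_self) (use mg in linarith)
    finally show ?thesis .
  next
    case t0: False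
    define F where "F = (\<lambda>h s. if Suc s = t then overlap h g / ((1 + ep) * m g) else 0)"
    have "(\<Sum>j=k0..k1. \<Sum>s<b. P k t j s) = (\<Sum>j=k0..k1. \<Sum>s<b. F (j - s) s)"
      using t0 False by (intro sum.cong refl) (simp only: P_def F_def g_def if_False)
    also have "\<dots> = (\<Sum>h=k0+1-b..k1. \<Sum>s<b. if k0 \<le> h + s \<and> h + s \<le> k1 then F h s else 0)"
      using bk0 k01 by (intro sum_phase_reindex) auto
    also have "\<dots> = (\<Sum>h=k0+1-b..k1. overlap h g / ((1 + ep) * m g))"
    proof (rule sum.cong[OF refl])
      fix h assume h: "h \<in> {k0+1-b..k1}"
      show "(\<Sum>s<b. if k0 \<le> h + s \<and> h + s \<le> k1 then F h s else 0) = overlap h g / ((1 + ep) * m g)"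
      proof (cases "overlap h g = 0")
        case True
        then show ?thesis by (auto simp: F_def intro!: sum.neutral)
      next
        case o: False
        have "h + b + 17 \<le> g" using overlap_gap[OF o g(2,1)] by simp
        moreover have "k0 \<le> h" using not_fed_sources[OF False] t0 o by (simp add: g_def)
        ultimately have hs: "k0 \<le> h + (t - 1) \<and> h + (t - 1) \<le> k1" using g t k by auto
        have "(\<Sum>s<b. if k0 \<le> h + s \<and> h + s \<le> k1 then F h s else 0) = (\<Sum>s\<in>{t - 1}. if k0 \<le> h + s \<and> h + s \<le> k1 then F h s else 0)"
          using t t0 by (intro sum.mono_neutral_right) (auto simp: F_def)
        also have "\<dots> = overlap h g / ((1 + ep) * m g)"
          using hs t0 by (simp add: F_def)
        finally show ?thesis .
      qed
    qed
    also have "\<dots> = 1"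
      unfolding sum_divide_distrib[symmetric] S by (rule divide_self) (use mg in linarith)
    finally show ?thesis .
  qed
  then show ?thesis using False by (simp add: PR_def)
qed

section \<open>Loads on the reservoir and on the blocks\<close>

text \<open>Since \<open>A\<close> is increasing, these runs are consecutive; only the last one can
  reach beyond \<open>T\<close>, and by at most \<open>N k0 / b\<close>.\<close>

lemma sum_below_threshold:
  assumes l: "k0 + 1 - b \<le> l" "A l \<le> T"
  shows "(\<Sum>g\<in>{g\<in>{l..u}. (1 + ep) * A g < T}. m g) \<le> T + N k0 / real b - A l"
proof (cases "{g\<in>{l..u}. (1 + ep) * A g < T} = {}")
  case True
  have "0 \<le> N k0 / real b" using Nk0 by simp
  then show ?thesis using l(2) unfolding True by simp
next
  case False
  define K where "K = Max {g\<in>{l..u}. (1 + ep) * A g < T}"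
  have K: "K \<in> {g\<in>{l..u}. (1 + ep) * A g < T}"
    unfolding K_def using False by (intro Max_in) auto
  have "(\<Sum>g\<in>{g\<in>{l..u}. (1 + ep) * A g < T}. m g) \<le> (\<Sum>g=l..K. m g)"
    using m_nonneg by (intro sum_mono2) (auto simp: K_def)
  also have "\<dots> = (\<Sum>g=l..K. A (Suc g) - A g)"
    using l by (intro sum.cong) (auto simp: A_Suc)
  also have "\<dots> = A (Suc K) - A l"
    using K by (intro sum_Suc_diff) auto
  also have "\<dots> \<le> T + N k0 / real b - A l"
  proof -
    have "A K \<le> (1 + ep) * A K" using ep0 A_nonneg[of K] by (simp add: algebra_simps)
    moreover have "A (Suc K) = A K + m K" using K l by (intro A_Suc) auto
    ultimately show ?thesis using K m_le[of K] by simp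
  qed
  finally show ?thesis .
qed

text \<open>Count in units of \<open>N k0 / b\<close>. First blocks start at
  \<open>A (Suc k0) = N k0\<close>, so \<open>lam\<close> leaves 18 units to the reservoir, and the
  run crossing the threshold adds one. Each positive phase asks for at most
  \<open>kap b * (3 * N k0)\<close>, and all of them for \<open>3 / 4\<close> of a unit.\<close>

lemma sum_fed: "(\<Sum>k=k0+1..k1. \<Sum>t<b. if fed k t then R k t else 0) \<le> N k0 * 20 / real b"
proof -
  have kap: "0 < kap b" "kap b \<le> 1 / 4" using kap_bounds b0 by auto
  have start: "(\<Sum>k=k0+1..k1. if fed k 0 then R k 0 else 0) \<le> 19 * (N k0 / real b)"
  proof -
    have "(\<Sum>k=k0+1..k1. if fed k 0 then R k 0 else 0) = (\<Sum>k=k0+1..k1. if (1 + ep) * A k < lam then m k else 0)"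
      by (rule sum.cong) (auto simp: fed_def R_def rmean_def m_eq)
    also have "\<dots> = (\<Sum>k\<in>{k\<in>{k0+1..k1}. (1 + ep) * A k < lam}. m k)"
      by (rule sum.inter_filter[symmetric]) simp
    also have "\<dots> \<le> lam + N k0 / real b - A (k0 + 1)"
      using A_Suc_k0 lam_ge by (intro sum_below_threshold) auto
    also have "\<dots> = 19 * (N k0 / real b)"
      using A_Suc_k0 by (simp add: lam_def distrib_left)
    finally show ?thesis .
  qed
  have inner: "(\<Sum>k=k0+1..k1. if fed k t then R k t else 0) \<le> kap b * (3 * N k0)" if t: "t \<in> {1..<b}" for t
  proof -
    define Q where "Q = (\<lambda>g. (1 + ep) * A g < lam + N k0)"
    have "(\<Sum>k=k0+1..k1. if fed k t then R k t else 0) \<le> (\<Sum>k=k0+1..k1. kap b * (if Q (k - t) then m (k - t) else 0))"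
    proof (rule sum_mono)
      fix k assume k: "k \<in> {k0+1..k1}"
      have "N k \<le> N (max (k - t) k0)" using k a0k0 by (intro N_anti) auto
      then have "R k t \<le> kap b * m (k - t)"
        using t kap b0 by (simp add: R_def rmean_def m_def field_simps)
      then show "(if fed k t then R k t else 0) \<le> kap b * (if Q (k - t) then m (k - t) else 0)"
        using t by (auto simp: fed_def Q_def)
    qed
    also have "\<dots> = kap b * (\<Sum>k=k0+1..k1. if Q (k - t) then m (k - t) else 0)"
      by (simp add: sum_distrib_left)
    also have "(\<Sum>k=k0+1..k1. if Q (k - t) then m (k - t) else 0) = (\<Sum>g=k0+1-t..k1-t. if Q g then m g else 0)"
      by (rule sum.reindex_bij_witness[where i = "\<lambda>g. g + t" and j = "\<lambda>k. k - t"]) (use t bk0 in auto)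
    also have "\<dots> \<le> (\<Sum>g=k0+1-b..k1. if Q g then m g else 0)"
      using t m_nonneg by (intro sum_mono2) auto
    also have "\<dots> = (\<Sum>g\<in>{g\<in>{k0+1-b..k1}. Q g}. m g)"
      by (rule sum.inter_filter[symmetric]) simp
    also have "\<dots> \<le> (lam + N k0) + N k0 / real b - A (k0 + 1 - b)"
      unfolding Q_def using A_start lam_ge Nk0 by (intro sum_below_threshold) auto
    also have "\<dots> = 2 * N k0 + 19 * (N k0 / real b)"
      using A_start by (simp add: lam_def distrib_left)
    also have "\<dots> \<le> 3 * N k0"
      using Nk0 b20 by (simp add: field_simps)
    finally show ?thesis using kap by simp
  qed
  have "(\<Sum>k=k0+1..k1. \<Sum>t<b. if fed k t then R k t else 0)
     = (\<Sum>t<b. \<Sum>k=k0+1..k1. if fed k t then R k t else 0)"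
    by (rule sum.swap)
  also have "\<dots> = (\<Sum>t\<in>insert 0 {1..<b}. \<Sum>k=k0+1..k1. if fed k t then R k t else 0)"
    using b0 by (intro sum.cong) auto
  also have "\<dots> = (\<Sum>k=k0+1..k1. if fed k 0 then R k 0 else 0) + (\<Sum>t=1..<b. \<Sum>k=k0+1..k1. if fed k t then R k t else 0)"
    by (subst sum.insert) auto
  also have "\<dots> \<le> 19 * (N k0 / real b) + (\<Sum>t=1..<b. kap b * (3 * N k0))"
    by (rule add_mono[OF start sum_mono]) (rule inner)
  also have "(\<Sum>t=1..<b. kap b * (3 * N k0)) \<le> real b * (kap b * (3 * N k0))"
    using kap Nk0 b0 by (simp add: mult_right_mono)
  also have "real b * (kap b * (3 * N k0)) = 3 / 4 * (N k0 / real b)"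
    using b0 by (simp add: kap_def power2_eq_square)
  also have "19 * (N k0 / real b) + 3 / 4 * (N k0 / real b) \<le> 20 * (N k0 / real b)"
  proof -
    have "0 \<le> N k0 / real b" using Nk0 by simp
    then show ?thesis by linarith
  qed
  finally show ?thesis by (simp add: mult.commute)
qed

lemma reservoir_load:
  assumes "a0 \<le> j" "j \<le> k0 - 16"
  shows "(1 + ep) * (\<Sum>k=k0+1..k1. \<Sum>t<b. PR k t j * R k t) \<le> N j - N (Suc j)"
proof -
  define D where "D = N a0 - N (k0 - 15)"
  have D: "(1 + ep) * (N k0 * 20 / real b) \<le> D" "D > 0"
  proof -
    show 1: "(1 + ep) * (N k0 * 20 / real b) \<le> D" using reservoir by (simp add: D_def)
    have "0 < (1 + ep) * (N k0 * 20 / real b)" using ep0 Nk0 b0 by (simp add: add_pos_pos)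
    then show "D > 0" using 1 by linarith
  qed
  have d: "0 \<le> N j - N (Suc j)" using N_anti[of j "Suc j"] assms by simp
  have "(\<Sum>k=k0+1..k1. \<Sum>t<b. PR k t j * R k t)
     = (\<Sum>k=k0+1..k1. \<Sum>t<b. (N j - N (Suc j)) / D * (if fed k t then R k t else 0))"
    by (intro sum.cong) (auto simp: PR_def D_def)
  also have "\<dots> = (N j - N (Suc j)) / D * (\<Sum>k=k0+1..k1. \<Sum>t<b. if fed k t then R k t else 0)"
    by (simp only: sum_distrib_left)
  also have "\<dots> \<le> (N j - N (Suc j)) / D * (N k0 * 20 / real b)"
    using d D by (intro mult_left_mono sum_fed) auto
  finally have "(1 + ep) * (\<Sum>k=k0+1..k1. \<Sum>t<b. PR k t j * R k t) \<le> (1 + ep) * ((N j - N (Suc j)) / D * (N k0 * 20 / real b))"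
    using ep0 by (intro mult_left_mono) auto
  also have "\<dots> = (N j - N (Suc j)) / D * ((1 + ep) * (N k0 * 20 / real b))" by simp
  also have "\<dots> \<le> (N j - N (Suc j)) / D * D"
    using d D by (intro mult_left_mono) auto
  finally show ?thesis using D by simp
qed

lemma C_eq: "C j s = (N j - (if Suc s < b then (1 - kap b) * N (Suc j) else 0)) / real b"
proof -
  have "N j * (real (n - j) * eta b j) = (1 - kap b) * N (Suc j) / real b"
  proof -
    have "N j * (real (n - j) * eta b j) = (N j * real (n - j)) / real (Suc j) * ((1 - kap b) / real b)"
      by (simp add: eta_def mult_ac del: of_nat_Suc)
    also have "N j * real (n - j) = N (Suc j) * real (Suc j)"
      using binomial_Suc_ratio[of n j] by (simp add: N_def)
    finally show ?thesis by (simp del: of_nat_Suc)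
  qed
  then show ?thesis by (simp add: C_def cmean_def right_diff_distrib diff_divide_distrib)
qed

text \<open>The factor \<open>1 + ep\<close> is built into the target lengths and cancels; what
  remains is the share of run \<open>h\<close> that targets cover, which is at most 1.\<close>

lemma start_load:
  assumes j: "k0 \<le> j" "j \<le> k1" and s: "s < b"
  shows "(1 + ep) * (\<Sum>k=k0+1..k1. P k 0 j s * R k 0) \<le> outflow j s"
proof -
  define h where "h = j - s"
  have h: "h \<le> k1" using j by (simp add: h_def)
  have mh: "m h > 0" using m_pos h by simp
  have of0: "0 \<le> outflow j s" using N_anti[of j "Suc j"] N_nonneg j a0k0 by (simp add: outflow_def)
  have "(1 + ep) * (\<Sum>k=k0+1..k1. P k 0 j s * R k 0) = (\<Sum>k=k0+1..k1. (1 + ep) * (P k 0 j s * R k 0))"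
    by (simp only: sum_distrib_left)
  also have "\<dots> \<le> (\<Sum>k=k0+1..k1. outflow j s / m h * overlap h k)"
  proof (rule sum_mono)
    fix k assume k: "k \<in> {k0+1..k1}"
    have mk: "m k > 0" using m_pos k by simp
    have "R k 0 = m k" using k by (simp add: R_def rmean_def m_eq)
    note mk = mk this
    show "(1 + ep) * (P k 0 j s * R k 0) \<le> outflow j s / m h * overlap h k"
    proof (cases "fed k 0")
      case True
      then show ?thesis using of0 mh overlap_nonneg by (simp add: P_def)
    next
      case False
      then have "P k 0 j s = overlap h k / ((1 + ep) * m k) * (outflow j s / m h)"
        by (simp add: P_def h_def)
      then show ?thesis using mk ep0 by (simp add: mult.commute)
    qed
  qed
  also have "\<dots> = outflow j s / m h * (\<Sum>k=k0+1..k1. overlap h k)"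
    by (simp only: sum_distrib_left)
  also have "\<dots> \<le> outflow j s / m h * m h"
    using of0 mh by (intro mult_left_mono sum_overlap_targets_subset) auto
  finally show ?thesis using mh by simp
qed

text \<open>By log-concavity, level \<open>k\<close> is no larger a share of \<open>N g\<close> than
  level \<open>Suc j\<close> is of \<open>N h\<close>: both lie \<open>Suc s\<close> levels after
  the start of their run, and \<open>g\<close> is the later run. So masses that balance at the
  starts of runs also balance the repairs in every later phase.\<close>

lemma repair_load:
  assumes j: "k0 \<le> j" "j \<le> k1" and s: "Suc s < b"
  shows "(1 + ep) * (\<Sum>k=k0+1..k1. P k (Suc s) j s * R k (Suc s)) \<le> kap b * N (Suc j) / real b"
proof -
  define h where "h = j - s"
  have hs: "h + Suc s = Suc j" using j s bk0 by (simp add: h_def)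
  have h: "h \<le> k1" using j by (simp add: h_def)
  have kap: "0 < kap b" using kap_bounds b0 by simp
  define q where "q = kap b * N (Suc j) / real b"
  have q0: "0 \<le> q" using kap N_nonneg by (simp add: q_def)
  have mh: "m h > 0" using m_pos h by simp
  have "(1 + ep) * (\<Sum>k=k0+1..k1. P k (Suc s) j s * R k (Suc s)) = (\<Sum>k=k0+1..k1. (1 + ep) * (P k (Suc s) j s * R k (Suc s)))"
    by (simp only: sum_distrib_left)
  also have "\<dots> \<le> (\<Sum>k=k0+1..k1. q / m h * overlap h (k - Suc s))"
  proof (rule sum_mono)
    fix k assume k: "k \<in> {k0+1..k1}"
    define g where "g = k - Suc s"
    have gk: "g + Suc s = k" "k0 + 1 - b \<le> g" "g \<le> k1" using k s bk0 by (auto simp: g_def)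
    have mg: "m g > 0" using m_pos gk by simp
    show "(1 + ep) * (P k (Suc s) j s * R k (Suc s)) \<le> q / m h * overlap h (k - Suc s)"
    proof (cases "fed k (Suc s) \<or> overlap h g = 0")
      case True
      then show ?thesis using q0 mh overlap_nonneg by (auto simp: P_def h_def g_def)
    next
      case False
      then have P: "P k (Suc s) j s = overlap h g / ((1 + ep) * m g)"
        by (simp add: P_def h_def g_def)
      have hk: "k0 \<le> h" using not_fed_sources[of k "Suc s" h] False by (simp add: g_def)
      have hg: "h \<le> g" using overlap_gap[of h g] False gk by simp
      have mm: "m h = N h / real b" "m g = N g / real b" using hk hg by (auto simp: m_eq)
      have Npos: "N h > 0" "N g > 0" using mh mg b0 by (auto simp: mm zero_less_divide_iff)
      have lc: "N k * N h \<le> N (Suc j) * N g"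
        using binomial_log_concave[of h g "Suc s" n] hg hs gk k j k1n by (simp add: N_def)
      have "(1 + ep) * (P k (Suc s) j s * R k (Suc s)) = overlap h g * (kap b * N k / N g)"
        using Npos ep0 b0 by (simp add: P R_def rmean_def mm)
      also have "\<dots> \<le> overlap h g * (kap b * N (Suc j) / N h)"
        using lc kap Npos by (intro mult_left_mono overlap_nonneg) (simp add: field_simps)
      also have "\<dots> = q / m h * overlap h g"
        using b0 by (simp add: q_def mm)
      finally show ?thesis by (simp add: g_def)
    qed
  qed
  also have "\<dots> = q / m h * (\<Sum>k=k0+1..k1. overlap h (k - Suc s))"
    by (simp only: sum_distrib_left)
  also have "(\<Sum>k=k0+1..k1. overlap h (k - Suc s)) = (\<Sum>g=k0+1-Suc s..k1-Suc s. overlap h g)"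
    by (rule sum.reindex_bij_witness[where i = "\<lambda>g. g + Suc s" and j = "\<lambda>k. k - Suc s"]) (use s bk0 in auto)
  also have "q / m h * (\<Sum>g=k0+1-Suc s..k1-Suc s. overlap h g) \<le> q / m h * m h"
    using q0 mh s by (intro mult_left_mono sum_overlap_targets_subset) auto
  finally show ?thesis using mh by (simp add: q_def)
qed

text \<open>The capacity left in a block splits into \<open>outflow j s\<close>, which starts new
  runs, and \<open>kap b * N (Suc j) / b\<close>, which repairs phase \<open>Suc s\<close>; the two
  kinds of targets use separate parts. In the last phase only the first kind occurs.\<close>

lemma block_load:
  assumes j: "k0 \<le> j" "j \<le> k1" and s: "s < b"
  shows "(1 + ep) * (\<Sum>k=k0+1..k1. \<Sum>t<b. P k t j s * R k t) \<le> C j s"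
proof -
  have "(\<Sum>k=k0+1..k1. \<Sum>t<b. P k t j s * R k t) = (\<Sum>t<b. \<Sum>k=k0+1..k1. P k t j s * R k t)"
    by (rule sum.swap)
  also have "\<dots> = (\<Sum>t\<in>{t\<in>{..<b}. t = 0 \<or> t = Suc s}. \<Sum>k=k0+1..k1. P k t j s * R k t)"
  proof (rule sum.mono_neutral_right)
    show "\<forall>t\<in>{..<b} - {t\<in>{..<b}. t = 0 \<or> t = Suc s}. (\<Sum>k=k0+1..k1. P k t j s * R k t) = 0"
    proof
      fix t assume "t \<in> {..<b} - {t\<in>{..<b}. t = 0 \<or> t = Suc s}"
      then have "t \<noteq> 0" "Suc s \<noteq> t" by auto
      then have "P k t j s = 0" for k by (simp only: P_def if_False if_cancel)
      then show "(\<Sum>k=k0+1..k1. P k t j s * R k t) = 0" by simp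
    qed
  qed auto
  finally have split: "(\<Sum>k=k0+1..k1. \<Sum>t<b. P k t j s * R k t)
     = (\<Sum>t\<in>{t\<in>{..<b}. t = 0 \<or> t = Suc s}. \<Sum>k=k0+1..k1. P k t j s * R k t)" .
  show ?thesis
  proof (cases "Suc s < b")
    case True
    then have "{t\<in>{..<b}. t = 0 \<or> t = Suc s} = {0, Suc s}" by auto
    then have "(1 + ep) * (\<Sum>k=k0+1..k1. \<Sum>t<b. P k t j s * R k t) =
      (1 + ep) * (\<Sum>k=k0+1..k1. P k 0 j s * R k 0) + (1 + ep) * (\<Sum>k=k0+1..k1. P k (Suc s) j s * R k (Suc s))"
      unfolding split by (simp add: distrib_left)
    also have "\<dots> \<le> outflow j s + kap b * N (Suc j) / real b"
      by (rule add_mono[OF start_load[OF j s] repair_load[OF j True]])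
    also have "\<dots> = C j s"
      using True by (simp add: C_eq outflow_def left_diff_distrib add_divide_distrib diff_divide_distrib)
    finally show ?thesis .
  next
    case False
    then have "{t\<in>{..<b}. t = 0 \<or> t = Suc s} = {0}" using b0 by auto
    then show ?thesis
      unfolding split using start_load[OF j s] False by (simp add: C_eq outflow_def)
  qed
qed

end

section \<open>The fractional matching\<close>

lemma sum_by_levels:
  fixes h :: "nat set \<Rightarrow> real"
  shows "(\<Sum>x\<in>{x. x \<subseteq> {1..n} \<and> a \<le> card x}. h x) = (\<Sum>j=a..n. \<Sum>x\<in>level n j. h x)"
proof -
  have "{x. x \<subseteq> {1..n} \<and> a \<le> card x} = (\<Union>j\<in>{a..n}. level n j)"
    using card_mono[of "{1..n}"] by (auto simp: level_def)
  then have "(\<Sum>x\<in>{x. x \<subseteq> {1..n} \<and> a \<le> card x}. h x) = (\<Sum>x\<in>(\<Union>j\<in>{a..n}. level n j). h x)"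
    by simp
  also have "\<dots> = (\<Sum>j=a..n. \<Sum>x\<in>level n j. h x)"
    by (rule sum.UNION_disjoint) (auto simp: level_def)
  finally show ?thesis .
qed

lemma sum_level_below:
  fixes h :: "nat set \<Rightarrow> real"
  assumes "y \<subseteq> {1..n}"
  shows "(\<Sum>x\<in>level n j. if x \<subseteq> y then h x else 0) = (\<Sum>x\<in>below y j. h x)"
proof -
  have "below y j = {x\<in>level n j. x \<subseteq> y}" using assms by (auto simp: below_def level_def)
  then show ?thesis by (simp add: sum.inter_filter)
qed

lemma sum_level_above:
  fixes h :: "nat set \<Rightarrow> real"
  shows "(\<Sum>y\<in>level n k. if x \<subseteq> y then h y else 0) = (\<Sum>y\<in>above n x k. h y)"
proof -
  have "above n x k = {y\<in>level n k. x \<subseteq> y}" by (auto simp: above_def level_def)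
  then show ?thesis by (simp add: sum.inter_filter)
qed

lemma sum_by_phase:
  fixes h :: "nat set \<Rightarrow> real" and F :: "nat \<Rightarrow> real"
  assumes "\<And>x. x \<in> I \<Longrightarrow> \<phi> x < b"
  shows "(\<Sum>x\<in>I. F (\<phi> x) * h x) = (\<Sum>s<b. F s * (\<Sum>x\<in>I. of_bool (\<phi> x = s) * h x))"
proof -
  have "(\<Sum>s<b. F s * (\<Sum>x\<in>I. of_bool (\<phi> x = s) * h x)) = (\<Sum>x\<in>I. \<Sum>s<b. F s * (of_bool (\<phi> x = s) * h x))"
    unfolding sum_distrib_left by (rule sum.swap)
  also have "\<dots> = (\<Sum>x\<in>I. F (\<phi> x) * h x)"
  proof (rule sum.cong[OF refl])
    fix x assume "x \<in> I"
    then have "\<phi> x \<in> {..<b}" using assms by simp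
    then show "(\<Sum>s<b. F s * (of_bool (\<phi> x = s) * h x)) = F (\<phi> x) * h x"
      by (subst sum.remove[of _ "\<phi> x"]) (auto intro!: sum.neutral)
  qed
  finally show ?thesis by simp
qed

text \<open>\<open>cgood\<close> and \<open>rgood\<close> are the conclusions of
  \<open>good_colouring\<close>, extended to all distances from 16 on by \<open>spread_below\<close>
  and \<open>spread_above\<close>.\<close>

locale coloured_blocks = calibrated_blocks +
  fixes \<phi> :: "nat set \<Rightarrow> nat"
  assumes \<phi>: "\<phi> \<in> Pow {1..n} \<rightarrow>\<^sub>E {..<b}"
    and b5: "144 * b ^ 5 \<le> k0" and n2: "2 \<le> n"
    and cgood: "\<And>j k y t. k0 \<le> j \<Longrightarrow> j \<le> k1 \<Longrightarrow> y \<in> level n k \<Longrightarrow> j + 16 \<le> k \<Longrightarrow> t < b \<Longrightarrow>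
       (1 - 1 / real n) * cmean n b j t * real (k choose j) \<le> (\<Sum>x\<in>below y j. of_bool (\<phi> x = t) * cfl n b \<phi> x)"
    and rgood: "\<And>i k x t. k0 < k \<Longrightarrow> k \<le> k1 \<Longrightarrow> x \<in> level n i \<Longrightarrow> i + 16 \<le> k \<Longrightarrow> t < b \<Longrightarrow>
       (\<Sum>y\<in>above n x k. of_bool (\<phi> y = t) * rfl n b \<phi> y) \<le> (1 + 1 / real n) * rmean b t * real ((n - i) choose (k - i))"
begin

definition Z :: "nat \<Rightarrow> nat \<Rightarrow> nat set \<Rightarrow> real" where
  "Z j s y = (\<Sum>x\<in>below y j. of_bool (\<phi> x = s) * cfl n b \<phi> x)"

text \<open>In the reservoir the capacity left is the same at all sets of a level, hence uniform
  shares. In a block, \<open>x\<close> serves in proportion to its own \<open>cfl\<close>. Dividing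
  by the true sum \<open>Z\<close> instead of its mean keeps demands exact and moves the whole error
  to the capacities.\<close>

definition far :: "nat set \<Rightarrow> nat set \<Rightarrow> real" where
  "far x y = (if card x \<le> k0 - 16 then PR (card y) (\<phi> y) (card x) / real (card y choose card x)
     else if k0 \<le> card x \<and> card x \<le> k1 then P (card y) (\<phi> y) (card x) (\<phi> x) * (cfl n b \<phi> x / Z (card x) (\<phi> x) y)
     else 0)"

text \<open>Outside the block levels the uniform weights between consecutive levels suffice, the
  upper degree being at most the size of the upper sets. Inside, \<open>far\<close> consists of
  shares with sum 1, so its multiple by \<open>rfl\<close> supplies just what the flow inside runs
  misses.\<close>

definition wt :: "nat set \<Rightarrow> nat set \<Rightarrow> real" where
  "wt x y = (if \<not> x \<subseteq> y then 0
     else if card y \<le> k0 \<or> k1 < card y then (if Suc (card x) = card y then 1 / real (card y) else 0)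
     else (if Suc (card x) = card y then sflow n b \<phi> x y else 0) + rfl n b \<phi> y * far x y)"

text \<open>All edges of \<open>wt\<close> increase \<open>height\<close>, which therefore bounds the sizes of the chains.\<close>

definition height :: "nat set \<Rightarrow> nat" where
  "height x = (if card x < k0 then card x else pos (card x) (\<phi> x))"

lemma \<phi>_less: "x \<in> level n j \<Longrightarrow> \<phi> x < b"
  using \<phi> by (auto simp: level_def dest: PiE_mem)

lemma short_flow_range: "k0 \<le> j \<Longrightarrow> n \<le> 2 * j + 1" "k0 \<le> j \<Longrightarrow> 144 * b ^ 5 \<le> Suc j"
  using na0 a0k0 b5 by auto

lemma cfl01: "x \<in> level n j \<Longrightarrow> k0 \<le> j \<Longrightarrow> 0 \<le> cfl n b \<phi> x" "x \<in> level n j \<Longrightarrow> k0 \<le> j \<Longrightarrow> cfl n b \<phi> x \<le> 1"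
  using cfl_bounds[OF _ \<phi> short_flow_range] by auto

lemma rfl01:
  assumes "y \<in> level n k" "k0 < k"
  shows "0 \<le> rfl n b \<phi> y" "rfl n b \<phi> y \<le> 1"
proof -
  obtain j where "k = Suc j" "k0 \<le> j" using assms by (cases k) auto
  then show "0 \<le> rfl n b \<phi> y" "rfl n b \<phi> y \<le> 1"
    using rfl_bounds[OF _ \<phi> short_flow_range] assms by auto
qed

lemma cmean_pos: "k0 \<le> j \<Longrightarrow> 0 < cmean n b j t"
  using cmean_bounds(1)[OF _ short_flow_range(1), of b j t] kap_bounds[of b] b0
  by (metis One_nat_def Suc_leI divide_pos_pos less_le_trans of_nat_0_less_iff)

lemma rmean_nonneg: "0 \<le> rmean b t"
  using kap_bounds[of b] b0 by (simp add: rmean_def)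

lemma Z_pos:
  assumes "k0 \<le> j" "j \<le> k1" "y \<in> level n k" "j + 16 \<le> k" "s < b"
  shows "0 < Z j s y"
proof -
  have "0 < (1 - 1 / real n) * cmean n b j s * real (k choose j)"
    using n2 cmean_pos assms by (intro mult_pos_pos) auto
  then show ?thesis using cgood[OF assms] unfolding Z_def by linarith
qed

lemma Z_nonneg: "y \<in> level n k \<Longrightarrow> k0 \<le> j \<Longrightarrow> 0 \<le> Z j s y"
  unfolding Z_def using below_subset_level[of y n k j] cfl01(1) by (intro sum_nonneg) auto

lemma far_nonneg:
  assumes "x \<in> level n j" "y \<in> level n k" "a0 \<le> j" "k \<le> k1"
  shows "0 \<le> far x y"
proof -
  have c: "card x = j" "card y = k" using assms by (auto simp: level_def)
  show ?thesis
    unfolding far_def c using PR_nonneg[of j k "\<phi> y"] P_nonneg[of j k "\<phi> y" "\<phi> x"] assms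
      cfl01(1)[OF assms(1)] Z_nonneg[OF assms(2), of j "\<phi> x"]
    by auto
qed

lemma wt_nonneg:
  assumes "x \<in> level n j" "y \<in> level n k" "a0 \<le> j"
  shows "0 \<le> wt x y"
proof -
  have c: "card x = j" "card y = k" using assms by (auto simp: level_def)
  have "0 \<le> sflow n b \<phi> x y" if "x \<subseteq> y" "Suc j = k" "k0 < k"
  proof -
    have "y \<in> above n x (Suc j)" using assms that by (auto simp: above_def level_def)
    then show ?thesis using sflow_bounds(1)[OF assms(1) _ \<phi> short_flow_range] that by auto
  qed
  then show ?thesis
    unfolding wt_def c using far_nonneg[OF assms] rfl01(1)[OF assms(2)] by auto
qed

section \<open>Demands and capacities of the weights\<close>

lemma demand_uniform:
  assumes y: "y \<in> level n k" and k: "a0 < k" "k \<le> k0 \<or> k1 < k"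
  shows "(\<Sum>j=a0..n. \<Sum>x\<in>level n j. wt x y) = 1"
proof -
  have c: "card y = k" "y \<subseteq> {1..n}" and fy: "finite y" using y finite_mem_level[OF y] by (auto simp: level_def)
  have kn: "k \<le> n" using c card_mono[of "{1..n}" y] by simp
  have "(\<Sum>j=a0..n. \<Sum>x\<in>level n j. wt x y) = (\<Sum>j\<in>{k - 1}. \<Sum>x\<in>level n j. wt x y)"
  proof (rule sum.mono_neutral_right)
    show "\<forall>j\<in>{a0..n} - {k - 1}. (\<Sum>x\<in>level n j. wt x y) = 0"
      using k c by (auto simp: wt_def level_def intro!: sum.neutral)
  qed (use k kn in auto)
  also have "\<dots> = (\<Sum>x\<in>level n (k - 1). if x \<subseteq> y then 1 / real k else 0)"
    using k c by (auto simp: wt_def level_def intro!: sum.cong)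
  also have "\<dots> = (\<Sum>x\<in>below y (k - 1). 1 / real k)"
    by (rule sum_level_below[OF c(2)])
  also have "\<dots> = 1"
    using card_below[OF fy, of "k - 1"] c k binomial_symmetric[of 1 k] by simp
  finally show ?thesis .
qed

lemma demand_blocks:
  assumes y: "y \<in> level n k" and k: "k0 < k" "k \<le> k1"
  shows "(\<Sum>j=a0..n. \<Sum>x\<in>level n j. wt x y) = 1"
proof -
  have c: "card y = k" "y \<subseteq> {1..n}" and fy: "finite y" using y finite_mem_level[OF y] by (auto simp: level_def)
  define t where "t = \<phi> y"
  have t: "t < b" using \<phi>_less[OF y] by (simp add: t_def)
  have wt_eq: "(\<Sum>x\<in>level n j. wt x y) = (if Suc j = k then (\<Sum>x\<in>below y j. sflow n b \<phi> x y) else 0)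
     + rfl n b \<phi> y * (\<Sum>x\<in>below y j. far x y)" for j
  proof -
    have "(\<Sum>x\<in>level n j. wt x y) = (\<Sum>x\<in>level n j. if x \<subseteq> y then (if Suc j = k then sflow n b \<phi> x y else 0) + rfl n b \<phi> y * far x y else 0)"
      by (rule sum.cong) (use k c in \<open>auto simp: wt_def level_def\<close>)
    also have "\<dots> = (\<Sum>x\<in>below y j. (if Suc j = k then sflow n b \<phi> x y else 0) + rfl n b \<phi> y * far x y)"
      by (rule sum_level_below[OF c(2)])
    finally show ?thesis by (simp add: sum.distrib sum_distrib_left)
  qed
  have short: "(\<Sum>j=a0..n. if Suc j = k then (\<Sum>x\<in>below y j. sflow n b \<phi> x y) else 0) = 1 - rfl n b \<phi> y"
  proof -
    have "(\<Sum>j=a0..n. if Suc j = k then (\<Sum>x\<in>below y j. sflow n b \<phi> x y) else 0)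
      = (\<Sum>j\<in>{k - 1}. if Suc j = k then (\<Sum>x\<in>below y j. sflow n b \<phi> x y) else 0)"
      by (rule sum.mono_neutral_right) (use k a0k0 k1n in auto)
    then show ?thesis using k c by (simp add: rfl_def)
  qed
  have far1: "(\<Sum>x\<in>below y j. far x y) = PR k t j" if "a0 \<le> j" "j \<le> k0 - 16" for j
  proof -
    have "(\<Sum>x\<in>below y j. far x y) = (\<Sum>x\<in>below y j. PR k t j / real (k choose j))"
      by (rule sum.cong) (use that c in \<open>auto simp: far_def below_def t_def\<close>)
    then show ?thesis using card_below[OF fy, of j] c that k by simp
  qed
  have far2: "(\<Sum>x\<in>below y j. far x y) = (\<Sum>s<b. P k t j s)" if j: "k0 \<le> j" "j \<le> k1" for j
  proof -
    have "(\<Sum>x\<in>below y j. far x y) = (\<Sum>x\<in>below y j. P k t j (\<phi> x) / Z j (\<phi> x) y * cfl n b \<phi> x)"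
      by (rule sum.cong) (use j c a0k0 in \<open>auto simp: far_def below_def t_def\<close>)
    also have "\<dots> = (\<Sum>s<b. P k t j s / Z j s y * (\<Sum>x\<in>below y j. of_bool (\<phi> x = s) * cfl n b \<phi> x))"
      by (rule sum_by_phase[where F = "\<lambda>s. P k t j s / Z j s y"]) (use below_subset_level[OF y] \<phi>_less in blast)
    also have "\<dots> = (\<Sum>s<b. P k t j s)"
    proof (rule sum.cong[OF refl])
      fix s assume s: "s \<in> {..<b}"
      show "P k t j s / Z j s y * (\<Sum>x\<in>below y j. of_bool (\<phi> x = s) * cfl n b \<phi> x) = P k t j s"
      proof (cases "P k t j s = 0")
        case False
        then have "j + 16 \<le> k" using P_support(1)[of k t j s] k t s j by simp
        then have "Z j s y > 0" using Z_pos[OF j y] s by simp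
        then show ?thesis by (simp add: Z_def)
      qed simp
    qed
    finally show ?thesis .
  qed
  have far3: "(\<Sum>x\<in>below y j. far x y) = 0" if "\<not> j \<le> k0 - 16" "\<not> (k0 \<le> j \<and> j \<le> k1)" for j
    by (rule sum.neutral) (use that in \<open>auto simp: far_def below_def\<close>)
  have "(\<Sum>j=a0..n. \<Sum>x\<in>below y j. far x y) = (\<Sum>j\<in>{a0..k0-16} \<union> {k0..k1}. \<Sum>x\<in>below y j. far x y)"
    by (rule sum.mono_neutral_right) (use far3 a0k0 k01 k1n in auto)
  also have "\<dots> = (\<Sum>j=a0..k0-16. \<Sum>x\<in>below y j. far x y) + (\<Sum>j=k0..k1. \<Sum>x\<in>below y j. far x y)"
    by (rule sum.union_disjoint) (use a0k0 in auto)
  also have "\<dots> = (\<Sum>j=a0..k0-16. PR k t j) + (\<Sum>j=k0..k1. \<Sum>s<b. P k t j s)"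
    by (simp add: far1 far2)
  also have "\<dots> = 1" by (rule sum_P[OF k t])
  finally have far: "(\<Sum>j=a0..n. \<Sum>x\<in>below y j. far x y) = 1" .
  have "(\<Sum>j=a0..n. \<Sum>x\<in>level n j. wt x y)
     = (\<Sum>j=a0..n. if Suc j = k then (\<Sum>x\<in>below y j. sflow n b \<phi> x y) else 0)
       + rfl n b \<phi> y * (\<Sum>j=a0..n. \<Sum>x\<in>below y j. far x y)"
    by (simp only: wt_eq sum.distrib sum_distrib_left)
  then show ?thesis using short far by simp
qed

lemma far_load_reservoir:
  assumes x: "x \<in> level n j" and j: "a0 \<le> j" "j \<le> k0 - 16"
  shows "(\<Sum>k=k0+1..k1. \<Sum>y\<in>above n x k. rfl n b \<phi> y * far x y) \<le> (N j - N (Suc j)) / N j"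
proof -
  have cx: "card x = j" using x by (simp add: level_def)
  have jn: "j \<le> n" using j a0k0 k01 k1n by simp
  have Nj: "N j > 0" using N_pos jn by simp
  have "(\<Sum>k=k0+1..k1. \<Sum>y\<in>above n x k. rfl n b \<phi> y * far x y) \<le> (\<Sum>k=k0+1..k1. \<Sum>t<b. (1 + ep) * (PR k t j * R k t) / N j)"
  proof (rule sum_mono)
    fix k assume k: "k \<in> {k0+1..k1}"
    have k': "k0 < k" "k \<le> k1" "j + 16 \<le> k" "j \<le> k" "k \<le> n" using k j a0k0 k1n by auto
    have yb: "\<phi> y < b" if "y \<in> above n x k" for y
      using that above_subset_level \<phi>_less by blast
    have "(\<Sum>y\<in>above n x k. rfl n b \<phi> y * far x y) = (\<Sum>y\<in>above n x k. PR k (\<phi> y) j / real (k choose j) * rfl n b \<phi> y)"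
      by (rule sum.cong) (use j cx in \<open>auto simp: far_def above_def\<close>)
    also have "\<dots> = (\<Sum>t<b. PR k t j / real (k choose j) * (\<Sum>y\<in>above n x k. of_bool (\<phi> y = t) * rfl n b \<phi> y))"
      by (rule sum_by_phase[where F = "\<lambda>t. PR k t j / real (k choose j)"]) (rule yb)
    also have "\<dots> \<le> (\<Sum>t<b. (1 + ep) * (PR k t j * R k t) / N j)"
    proof (rule sum_mono)
      fix t assume t: "t \<in> {..<b}"
      have pr: "0 \<le> PR k t j / real (k choose j)" using PR_nonneg[OF j(1)] by simp
      have "(\<Sum>y\<in>above n x k. of_bool (\<phi> y = t) * rfl n b \<phi> y) \<le> (1 + 1 / real n) * rmean b t * real ((n - j) choose (k - j))"
        using rgood[OF k'(1,2) x k'(3)] t by simp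
      also have "\<dots> \<le> (1 + ep) * rmean b t * real ((n - j) choose (k - j))"
        using rmean_nonneg n0 by (intro mult_right_mono) (auto simp: ep_def divide_right_mono)
      finally have "PR k t j / real (k choose j) * (\<Sum>y\<in>above n x k. of_bool (\<phi> y = t) * rfl n b \<phi> y)
         \<le> PR k t j / real (k choose j) * ((1 + ep) * rmean b t * real ((n - j) choose (k - j)))"
        using pr by (rule mult_left_mono)
      also have "\<dots> = (1 + ep) * PR k t j * rmean b t * (real ((n - j) choose (k - j)) / real (k choose j))"
        by simp
      also have "real ((n - j) choose (k - j)) / real (k choose j) = N k / N j"
      proof -
        have "N j * real ((n - j) choose (k - j)) = N k * real (k choose j)"
          using choose_double_count[OF k'(4,5)] unfolding N_def by (metis of_nat_mult)
        then show ?thesis using Nj k'(4) by (simp add: field_simps)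
      qed
      finally show "PR k t j / real (k choose j) * (\<Sum>y\<in>above n x k. of_bool (\<phi> y = t) * rfl n b \<phi> y)
        \<le> (1 + ep) * (PR k t j * R k t) / N j" by (simp add: R_def mult_ac)
    qed
    finally show "(\<Sum>y\<in>above n x k. rfl n b \<phi> y * far x y) \<le> (\<Sum>t<b. (1 + ep) * (PR k t j * R k t) / N j)" .
  qed
  also have "\<dots> = (1 + ep) * (\<Sum>k=k0+1..k1. \<Sum>t<b. PR k t j * R k t) / N j"
    by (simp only: sum_distrib_left sum_divide_distrib)
  also have "\<dots> \<le> (N j - N (Suc j)) / N j"
    using reservoir_load[OF j] Nj by (intro divide_right_mono) auto
  finally show ?thesis .
qed

text \<open>Residual demands exceed their mean by at most the factor \<open>1 + 1 / n\<close>,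
  residual capacities fall short by at most \<open>1 - 1 / n\<close>; the value \<open>4 / n\<close>
  of \<open>ep\<close> covers the quotient.\<close>

lemma ep_ratio: "(1 + 1 / real n) / (1 - 1 / real n) \<le> 1 + ep"
proof -
  have "0 < 1 - 1 / real n" using n2 by simp
  moreover have "1 + 1 / real n \<le> (1 + ep) * (1 - 1 / real n)"
  proof -
    have "(1 + ep) * (1 - 1 / real n) - (1 + 1 / real n) = (2 - 4 / real n) / real n"
      using n2 by (simp add: ep_def field_simps)
    moreover have "0 \<le> (2 - 4 / real n) / real n"
      using n2 by (simp add: field_simps)
    ultimately show ?thesis by linarith
  qed
  ultimately show ?thesis by (simp add: divide_le_eq)
qed

text \<open>The load on \<open>x\<close> is at most \<open>cfl n b \<phi> x\<close> times a factor
  that depends only on its block, because shares are proportional to \<open>cfl\<close> and all sums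
  are close to their means. So the single inequality \<open>block_load\<close> settles every set of
  the block.\<close>

lemma far_load_block:
  assumes x: "x \<in> level n j" and j: "k0 \<le> j" "j \<le> k1"
  shows "(\<Sum>k=k0+1..k1. \<Sum>y\<in>above n x k. rfl n b \<phi> y * far x y) \<le> cfl n b \<phi> x"
proof -
  define s where "s = \<phi> x"
  have s: "s < b" using \<phi>_less[OF x] by (simp add: s_def)
  have cx: "card x = j" using x by (simp add: level_def)
  have jn: "j \<le> n" using j k1n by simp
  have Nj: "N j > 0" using N_pos jn by simp
  have cm: "cmean n b j s > 0" using cmean_pos j by simp
  have cx0: "0 \<le> cfl n b \<phi> x" using cfl01(1)[OF x j(1)] .
  define K where "K = cfl n b \<phi> x / C j s"
  have Cpos: "C j s > 0" using Nj cm by (simp add: C_def)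
  have K0: "0 \<le> K" using cx0 Cpos by (simp add: K_def)
  have "(\<Sum>k=k0+1..k1. \<Sum>y\<in>above n x k. rfl n b \<phi> y * far x y)
     \<le> (\<Sum>k=k0+1..k1. \<Sum>t<b. K * ((1 + ep) * (P k t j s * R k t)))"
  proof (rule sum_mono)
    fix k assume k: "k \<in> {k0+1..k1}"
    have k': "k0 < k" "k \<le> k1" "k \<le> n" using k k1n by auto
    have yb: "\<phi> y < b" and yl: "y \<in> level n k" if "y \<in> above n x k" for y
      using that above_subset_level \<phi>_less by blast+
    have "(\<Sum>y\<in>above n x k. rfl n b \<phi> y * far x y)
      = (\<Sum>y\<in>above n x k. P k (\<phi> y) j s * (cfl n b \<phi> x * (rfl n b \<phi> y / Z j s y)))"
      by (rule sum.cong) (use j cx a0k0 in \<open>auto simp: far_def above_def s_def\<close>)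
    also have "\<dots> = (\<Sum>t<b. P k t j s * (\<Sum>y\<in>above n x k. of_bool (\<phi> y = t) * (cfl n b \<phi> x * (rfl n b \<phi> y / Z j s y))))"
      by (rule sum_by_phase[where F = "\<lambda>t. P k t j s"]) (rule yb)
    also have "\<dots> \<le> (\<Sum>t<b. K * ((1 + ep) * (P k t j s * R k t)))"
    proof (rule sum_mono)
      fix t assume t: "t \<in> {..<b}"
      show "P k t j s * (\<Sum>y\<in>above n x k. of_bool (\<phi> y = t) * (cfl n b \<phi> x * (rfl n b \<phi> y / Z j s y)))
        \<le> K * ((1 + ep) * (P k t j s * R k t))"
      proof (cases "P k t j s = 0")
        case False
        have k16: "j + 16 \<le> k" using P_support(1)[OF False] k' t s j by simp
        have P0: "0 \<le> P k t j s" using P_nonneg[of j k] j k' a0k0 by simp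
        define z where "z = (1 - 1 / real n) * cmean n b j s * real (k choose j)"
        have z: "z > 0" unfolding z_def using n2 cm k16 by (intro mult_pos_pos) auto
        have "(\<Sum>y\<in>above n x k. of_bool (\<phi> y = t) * (cfl n b \<phi> x * (rfl n b \<phi> y / Z j s y)))
          \<le> (\<Sum>y\<in>above n x k. cfl n b \<phi> x / z * (of_bool (\<phi> y = t) * rfl n b \<phi> y))"
        proof (rule sum_mono)
          fix y assume y: "y \<in> above n x k"
          have zZ: "z \<le> Z j s y" using cgood[OF j yl[OF y] k16 s] by (simp add: z_def Z_def)
          have "rfl n b \<phi> y / Z j s y \<le> rfl n b \<phi> y / z"
            using rfl01(1)[OF yl[OF y] k'(1)] zZ z by (intro divide_left_mono) auto
          then have "cfl n b \<phi> x * (rfl n b \<phi> y / Z j s y) \<le> cfl n b \<phi> x * (rfl n b \<phi> y / z)"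
            using cx0 by (rule mult_left_mono)
          then show "of_bool (\<phi> y = t) * (cfl n b \<phi> x * (rfl n b \<phi> y / Z j s y))
            \<le> cfl n b \<phi> x / z * (of_bool (\<phi> y = t) * rfl n b \<phi> y)" by simp
        qed
        also have "\<dots> = cfl n b \<phi> x / z * (\<Sum>y\<in>above n x k. of_bool (\<phi> y = t) * rfl n b \<phi> y)"
          by (simp only: sum_distrib_left)
        also have "\<dots> \<le> cfl n b \<phi> x / z * ((1 + 1 / real n) * rmean b t * real ((n - j) choose (k - j)))"
          using rgood[OF k'(1,2) x k16] t cx0 z by (intro mult_left_mono) auto
        also have "\<dots> = cfl n b \<phi> x / cmean n b j s * rmean b t * ((1 + 1 / real n) / (1 - 1 / real n))
            * (real ((n - j) choose (k - j)) / real (k choose j))"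
          by (simp add: z_def mult_ac)
        also have "real ((n - j) choose (k - j)) / real (k choose j) = N k / N j"
        proof -
          have "N j * real ((n - j) choose (k - j)) = N k * real (k choose j)"
            using choose_double_count[of j k n] k16 k'(3) unfolding N_def by (metis add_leD1 of_nat_mult)
          then show ?thesis using Nj k16 by (simp add: field_simps)
        qed
        also have "cfl n b \<phi> x / cmean n b j s * rmean b t * ((1 + 1 / real n) / (1 - 1 / real n)) * (N k / N j)
           \<le> cfl n b \<phi> x / cmean n b j s * rmean b t * (1 + ep) * (N k / N j)"
          using cx0 cm rmean_nonneg N_nonneg by (intro mult_right_mono mult_left_mono ep_ratio) auto
        also have "\<dots> = K * ((1 + ep) * R k t)"
          by (simp add: K_def C_def R_def mult_ac)
        finally have "P k t j s * (\<Sum>y\<in>above n x k. of_bool (\<phi> y = t) * (cfl n b \<phi> x * (rfl n b \<phi> y / Z j s y)))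
          \<le> P k t j s * (K * ((1 + ep) * R k t))"
          using P0 by (rule mult_left_mono)
        then show ?thesis by (simp add: mult_ac)
      qed simp
    qed
    finally show "(\<Sum>y\<in>above n x k. rfl n b \<phi> y * far x y) \<le> (\<Sum>t<b. K * ((1 + ep) * (P k t j s * R k t)))" .
  qed
  also have "\<dots> = K * ((1 + ep) * (\<Sum>k=k0+1..k1. \<Sum>t<b. P k t j s * R k t))"
    by (simp only: sum_distrib_left)
  also have "\<dots> \<le> K * C j s"
    using K0 by (intro mult_left_mono block_load[OF j s])
  also have "\<dots> = cfl n b \<phi> x" using Cpos by (simp add: K_def)
  finally show ?thesis .
qed

lemma capacity:
  assumes x: "x \<in> level n j" and j: "a0 \<le> j" "j \<le> n"
  shows "(\<Sum>k=a0+1..n. \<Sum>y\<in>level n k. wt x y) \<le> 1"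
proof -
  have cx: "card x = j" using x by (simp add: level_def)
  define U where "U = (\<lambda>k. if (k \<le> k0 \<or> k1 < k) \<and> Suc j = k then real (n - j) / real (Suc j) else 0)"
  define S where "S = (\<lambda>k. if k0 < k \<and> k \<le> k1 \<and> Suc j = k then 1 - cfl n b \<phi> x else 0)"
  define F where "F = (\<lambda>k. if k0 < k \<and> k \<le> k1 then (\<Sum>y\<in>above n x k. rfl n b \<phi> y * far x y) else 0)"
  have wt_eq: "(\<Sum>y\<in>level n k. wt x y) = U k + S k + F k" for k
  proof (cases "k \<le> k0 \<or> k1 < k")
    case True
    have "(\<Sum>y\<in>level n k. wt x y) = (\<Sum>y\<in>level n k. if x \<subseteq> y then (if Suc j = k then 1 / real (Suc j) else 0) else 0)"
      by (rule sum.cong) (use True cx in \<open>auto simp: wt_def level_def\<close>)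
    also have "\<dots> = (\<Sum>y\<in>above n x k. if Suc j = k then 1 / real (Suc j) else 0)"
      by (rule sum_level_above)
    also have "\<dots> = U k"
      using True card_above[OF x, of "Suc j"] by (auto simp: U_def)
    finally show ?thesis using True by (auto simp: S_def F_def)
  next
    case False
    have "(\<Sum>y\<in>level n k. wt x y) = (\<Sum>y\<in>level n k. if x \<subseteq> y then (if Suc j = k then sflow n b \<phi> x y else 0) + rfl n b \<phi> y * far x y else 0)"
      by (rule sum.cong) (use False cx in \<open>auto simp: wt_def level_def\<close>)
    also have "\<dots> = (\<Sum>y\<in>above n x k. (if Suc j = k then sflow n b \<phi> x y else 0) + rfl n b \<phi> y * far x y)"
      by (rule sum_level_above)
    also have "\<dots> = S k + F k"
      using False cx by (auto simp: S_def F_def sum.distrib cfl_def)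
    finally show ?thesis using False by (auto simp: U_def)
  qed
  have sumF: "(\<Sum>k=a0+1..n. F k) = (\<Sum>k=k0+1..k1. \<Sum>y\<in>above n x k. rfl n b \<phi> y * far x y)"
  proof -
    have "(\<Sum>k=a0+1..n. F k) = (\<Sum>k=k0+1..k1. F k)"
      by (rule sum.mono_neutral_right) (use a0k0 k1n in \<open>auto simp: F_def\<close>)
    then show ?thesis by (simp add: F_def)
  qed
  have single: "(\<Sum>k=a0+1..n. U k) \<le> U (Suc j)" "(\<Sum>k=a0+1..n. S k) \<le> S (Suc j)" if "S (Suc j) \<ge> 0"
  proof -
    have "(\<Sum>k=a0+1..n. U k) = (\<Sum>k\<in>{a0+1..n} \<inter> {Suc j}. U k)" "(\<Sum>k=a0+1..n. S k) = (\<Sum>k\<in>{a0+1..n} \<inter> {Suc j}. S k)"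
      by (rule sum.mono_neutral_right; auto simp: U_def S_def)+
    moreover have "U (Suc j) \<ge> 0" by (simp add: U_def)
    ultimately show "(\<Sum>k=a0+1..n. U k) \<le> U (Suc j)" "(\<Sum>k=a0+1..n. S k) \<le> S (Suc j)"
      using that by (auto simp: Int_insert_right)
  qed
  have Nj: "N j > 0" using N_pos j by simp
  have ratio: "real (n - j) / real (Suc j) = N (Suc j) / N j"
    using binomial_Suc_ratio[of n j] Nj by (simp add: N_def field_simps)
  have ratio1: "N (Suc j) / N j \<le> 1"
    using N_anti[of j "Suc j"] j Nj by simp
  have total: "(\<Sum>k=a0+1..n. \<Sum>y\<in>level n k. wt x y)
     = (\<Sum>k=a0+1..n. U k) + (\<Sum>k=a0+1..n. S k) + (\<Sum>k=k0+1..k1. \<Sum>y\<in>above n x k. rfl n b \<phi> y * far x y)"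
    unfolding wt_eq sum.distrib sumF ..
  \<comment> \<open>The 15 levels just below \<open>k0\<close> serve no far pairs. Level
    \<open>k1\<close> feeds level \<open>k1 + 1\<close> by uniform weights, so it must not be a
    source of far weight as well; distance 16 excludes that.\<close>
  consider "j \<le> k0 - 16" | "k0 - 16 < j" "j < k0" | "k0 \<le> j" "j < k1" | "j = k1" | "k1 < j" by linarith
  then show ?thesis
  proof cases
    case 1
    then have *: "S (Suc j) = 0" "U (Suc j) = N (Suc j) / N j"
      using a0k0 ratio by (auto simp: S_def U_def)
    show ?thesis
      using total single * far_load_reservoir[OF x j(1) 1] Nj by (simp add: diff_divide_distrib)
  next
    case 2
    then have *: "S (Suc j) = 0" "U (Suc j) \<le> 1"
      using ratio ratio1 by (auto simp: S_def U_def)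
    have "(\<Sum>k=k0+1..k1. \<Sum>y\<in>above n x k. rfl n b \<phi> y * far x y) = 0"
      using 2 by (auto simp: far_def cx intro!: sum.neutral)
    then show ?thesis using total single * by simp
  next
    case 3
    then have *: "S (Suc j) = 1 - cfl n b \<phi> x" "U (Suc j) = 0"
      by (auto simp: S_def U_def)
    have "S (Suc j) \<ge> 0" using * cfl01(2)[OF x 3(1)] by simp
    then show ?thesis
      using total single * far_load_block[OF x 3(1)] 3 by simp
  next
    case 4
    then have *: "S (Suc j) = 0" "U (Suc j) \<le> 1"
      using ratio ratio1 by (auto simp: S_def U_def)
    have "far x y = 0" if y: "y \<in> above n x k" and k: "k \<in> {k0+1..k1}" for k y
    proof -
      have cy: "card y = k" "y \<in> level n k" using y above_subset_level by (auto simp: above_def)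
      have "P k (\<phi> y) j (\<phi> x) = 0"
        using P_support(1)[of k "\<phi> y" j "\<phi> x"] k \<phi>_less[OF cy(2)] \<phi>_less[OF x] 4 k01 by force
      moreover have "\<not> k1 \<le> k0 - 16" using k01 by linarith
      ultimately show ?thesis using 4 by (simp add: far_def cx cy)
    qed
    then have "(\<Sum>k=k0+1..k1. \<Sum>y\<in>above n x k. rfl n b \<phi> y * far x y) = 0"
      by (auto intro!: sum.neutral)
    then show ?thesis using total single * by simp
  next
    case 5
    then have *: "S (Suc j) = 0" "U (Suc j) \<le> 1"
      using ratio ratio1 k01 by (auto simp: S_def U_def)
    have "(\<Sum>k=k0+1..k1. \<Sum>y\<in>above n x k. rfl n b \<phi> y * far x y) = 0"
      using 5 k01 by (auto simp: far_def cx intro!: sum.neutral)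
    then show ?thesis using total single * by simp
  qed
qed

text \<open>Inside a run \<open>pos\<close> grows by 1 with the phase. A far step between blocks
  gains \<open>b\<close> from the gap in \<open>A\<close> and loses less than \<open>b\<close> in
  phase. Below \<open>k0\<close> the height is the size, and every value of \<open>pos\<close> is at
  least \<open>k0\<close>.\<close>

lemma height_increases:
  assumes x: "x \<in> level n j" and y: "y \<in> level n k" and j: "a0 \<le> j" and w: "wt x y > 0"
  shows "x \<subset> y" "k \<le> k1 \<Longrightarrow> height x < height y"
proof -
  have c: "card x = j" "card y = k" using assms by (auto simp: level_def)
  have ph: "\<phi> x < b" "\<phi> y < b" using x y \<phi>_less by auto
  have sub: "x \<subseteq> y" using w by (auto simp: wt_def split: if_splits)
  have pk: "k0 \<le> pos i s" for i s by (simp add: pos_def)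
  have "j < k \<and> (k \<le> k1 \<longrightarrow> height x < height y)"
  proof (cases "k \<le> k0 \<or> k1 < k")
    case True
    then have "Suc j = k" using w sub c by (auto simp: wt_def split: if_splits)
    then show ?thesis using True c pk[of k "\<phi> y"] k01 by (auto simp: height_def)
  next
    case False
    then have "(if Suc j = k then sflow n b \<phi> x y else 0) + rfl n b \<phi> y * far x y > 0"
      using w sub c by (auto simp: wt_def)
    then consider "Suc j = k" "sflow n b \<phi> x y \<noteq> 0" | "far x y \<noteq> 0"
      by (cases "far x y = 0") (auto split: if_splits)
    then show ?thesis
    proof cases
      case 1
      then have "\<phi> y = Suc (\<phi> x)" by (auto simp: sflow_def qflow_def)
      then show ?thesis using 1 False c by (auto simp: height_def pos_def)
    next
      case 2
      show ?thesis
      proof (cases "j \<le> k0 - 16")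
        case True
        then show ?thesis using False c pk[of k "\<phi> y"] a0k0 by (auto simp: height_def)
      next
        case f: False
        then have "P k (\<phi> y) j (\<phi> x) \<noteq> 0" "k0 \<le> j"
          using 2 c by (auto simp: far_def split: if_splits)
        then show ?thesis
          using P_support[of k "\<phi> y" j "\<phi> x"] False ph c by (auto simp: height_def)
      qed
    qed
  qed
  then show "x \<subset> y" "k \<le> k1 \<Longrightarrow> height x < height y"
    using sub c by auto
qed

lemma height_range:
  assumes "x \<in> level n j" "a0 \<le> j" "j \<le> k1"
  shows "a0 \<le> height x" "real (height x) \<le> real k0 + real b * A (Suc k1) / N k0 + real b"
proof -
  have c: "card x = j" using assms by (simp add: level_def)
  have ph: "\<phi> x < b" using \<phi>_less assms by simp
  show "a0 \<le> height x" using assms c a0k0 by (auto simp: height_def pos_def)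
  have "A (j - \<phi> x) \<le> A (Suc k1)" using assms by (intro A_mono) simp
  then have "real b * A (j - \<phi> x) / N k0 \<le> real b * A (Suc k1) / N k0"
    using Nk0 by (intro divide_right_mono mult_left_mono) auto
  moreover have "0 \<le> real b * A (j - \<phi> x) / N k0" using A_nonneg Nk0 by simp
  moreover from this have "real (nat \<lfloor>real b * A (j - \<phi> x) / N k0\<rfloor>) \<le> real b * A (j - \<phi> x) / N k0"
    by (intro of_nat_floor)
  ultimately show "real (height x) \<le> real k0 + real b * A (Suc k1) / N k0 + real b"
    using ph c by (auto simp: height_def pos_def)
qed

theorem predecessor_map:
  "\<exists>p. inj_on p {y. y \<subseteq> {1..n} \<and> a0 < card y} \<and>
    (\<forall>y. y \<subseteq> {1..n} \<longrightarrow> a0 < card y \<longrightarrow> a0 \<le> card (p y) \<and> p y \<subset> y \<and> (card y \<le> k1 \<longrightarrow> height (p y) < height y))"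
proof -
  define X where "X = {x. x \<subseteq> {1..n} \<and> a0 \<le> card x}"
  define B where "B = {y. y \<subseteq> {1..n} \<and> a0 + 1 \<le> card y}"
  have lev: "x \<in> level n (card x)" "card x \<le> n" if "x \<subseteq> {1..n}" for x
    using that card_mono[of "{1..n}" x] by (auto simp: level_def)
  have "\<exists>g. inj_on g B \<and> (\<forall>y\<in>B. g y \<in> X \<and> 0 < wt (g y) y)"
  proof (rule fractional_matching)
    show "finite X" "finite B"
      by (rule finite_subset[of _ "Pow {1..n}"]; auto simp: X_def B_def)+
    show "0 \<le> wt x y" if "x \<in> X" "y \<in> B" for x y
      using that wt_nonneg[OF lev(1) lev(1), of x y] by (auto simp: X_def B_def)
    show "(\<Sum>x\<in>X. wt x y) = 1" if y: "y \<in> B" for y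
    proof -
      have "(\<Sum>x\<in>X. wt x y) = (\<Sum>j=a0..n. \<Sum>x\<in>level n j. wt x y)"
        unfolding X_def by (rule sum_by_levels)
      then show ?thesis
        using demand_uniform[OF lev(1), of y] demand_blocks[OF lev(1), of y] y by (force simp: B_def)
    qed
    show "(\<Sum>y\<in>B. wt x y) \<le> 1" if x: "x \<in> X" for x
    proof -
      have "(\<Sum>y\<in>B. wt x y) = (\<Sum>k=a0+1..n. \<Sum>y\<in>level n k. wt x y)"
        unfolding B_def by (rule sum_by_levels)
      then show ?thesis using capacity[OF lev(1), of x] lev(2)[of x] x by (auto simp: X_def)
    qed
  qed
  then obtain g where g: "inj_on g B" "\<forall>y\<in>B. g y \<in> X \<and> 0 < wt (g y) y" by blast
  have "B = {y. y \<subseteq> {1..n} \<and> a0 < card y}" by (auto simp: B_def)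
  moreover have "a0 \<le> card (g y) \<and> g y \<subset> y \<and> (card y \<le> k1 \<longrightarrow> height (g y) < height y)"
    if "y \<subseteq> {1..n}" "a0 < card y" for y
  proof -
    have "y \<in> B" using that by (simp add: B_def)
    then have gy: "g y \<subseteq> {1..n}" "a0 \<le> card (g y)" "0 < wt (g y) y"
      using g(2) by (auto simp: X_def)
    show ?thesis
      using height_increases[OF lev(1)[OF gy(1)] lev(1)[OF that(1)] gy(2,3)] gy by blast
  qed
  ultimately show ?thesis using g(1) by auto
qed

end

section \<open>Chains\<close>

text \<open>Uniform weights do it, since above the middle an upper degree \<open>n - card x\<close>
  is at most \<open>Suc (card x)\<close>. This serves small \<open>n\<close>, where no control of
  the chain sizes is asked for.\<close>

lemma uniform_matching:
  assumes "n \<le> 2 * a"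
  shows "\<exists>p. inj_on p {y. y \<subseteq> {1..n} \<and> a < card y} \<and>
    (\<forall>y. y \<subseteq> {1..n} \<longrightarrow> a < card y \<longrightarrow> p y \<subset> y \<and> Suc (card (p y)) = card y)"
proof -
  define w :: "nat set \<Rightarrow> nat set \<Rightarrow> real" where
    "w = (\<lambda>x y. if x \<subseteq> y \<and> Suc (card x) = card y then 1 / real (card y) else 0)"
  define X where "X = {x. x \<subseteq> {1..n} \<and> a \<le> card x}"
  define B where "B = {y. y \<subseteq> {1..n} \<and> a + 1 \<le> card y}"
  have lev: "x \<in> level n (card x)" "card x \<le> n" "finite x" if "x \<subseteq> {1..n}" for x
    using that card_mono[of "{1..n}" x] finite_subset[of x "{1..n}"] by (auto simp: level_def)
  have "\<exists>g. inj_on g B \<and> (\<forall>y\<in>B. g y \<in> X \<and> 0 < w (g y) y)"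
  proof (rule fractional_matching)
    show fin: "finite X" "finite B"
      by (rule finite_subset[of _ "Pow {1..n}"]; auto simp: X_def B_def)+
    show "0 \<le> w x y" for x y by (simp add: w_def)
    show "(\<Sum>x\<in>X. w x y) = 1" if y: "y \<in> B" for y
    proof -
      have y': "y \<subseteq> {1..n}" "a < card y" "finite y" using y lev by (auto simp: B_def)
      have "(\<Sum>x\<in>X. w x y) = (\<Sum>x\<in>below y (card y - 1). w x y)"
        by (rule sum.mono_neutral_right[OF fin(1)]) (use y' in \<open>auto simp: X_def below_def w_def\<close>)
      also have "\<dots> = (\<Sum>x\<in>below y (card y - 1). 1 / real (card y))"
        by (rule sum.cong) (use y' in \<open>auto simp: below_def w_def\<close>)
      also have "\<dots> = 1"
      proof -
        have "y \<noteq> {}" using y'(2) by auto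
        then show ?thesis
          using card_below[OF y'(3), of "card y - 1"] y' binomial_symmetric[of 1 "card y"] by simp
      qed
      finally show ?thesis .
    qed
    show "(\<Sum>y\<in>B. w x y) \<le> 1" if x: "x \<in> X" for x
    proof -
      have x': "x \<subseteq> {1..n}" "a \<le> card x" using x by (auto simp: X_def)
      have "(\<Sum>y\<in>B. w x y) = (\<Sum>y\<in>above n x (Suc (card x)). w x y)"
        by (rule sum.mono_neutral_right[OF fin(2)]) (use x' in \<open>auto simp: B_def above_def w_def\<close>)
      also have "\<dots> = (\<Sum>y\<in>above n x (Suc (card x)). 1 / real (Suc (card x)))"
        by (rule sum.cong) (auto simp: above_def w_def)
      also have "\<dots> = real (n - card x) / real (Suc (card x))"
        using card_above[OF lev(1)[OF x'(1)], of "Suc (card x)"] by simp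
      also have "\<dots> \<le> 1" using assms x' by (simp add: divide_le_eq)
      finally show ?thesis .
    qed
  qed
  then obtain g where g: "inj_on g B" "\<forall>y\<in>B. g y \<in> X \<and> 0 < w (g y) y" by blast
  have "B = {y. y \<subseteq> {1..n} \<and> a < card y}" by (auto simp: B_def)
  moreover have "g y \<subset> y \<and> Suc (card (g y)) = card y" if "y \<in> B" for y
  proof -
    have "0 < w (g y) y" using g(2) that by blast
    then show ?thesis by (auto simp: w_def split: if_splits)
  qed
  ultimately show ?thesis using g(1) by (intro exI[of _ g]) auto
qed

text \<open>This joins the two halves. For even \<open>n\<close> they share the middle level; for
  odd \<open>n\<close> the two middle levels form a regular bipartite graph of degree
  \<open>a\<close>.\<close>

lemma middle_bijection:
  assumes "a = (n + 1) div 2"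
  obtains g where "bij_betw g (level n a) (level n (n - a))" "\<And>z. z \<in> level n a \<Longrightarrow> g z \<subseteq> z"
proof (cases "even n")
  case True
  then have "n - a = a" using assms by auto
  then show ?thesis using that[of id] by (auto simp: bij_betw_def)
next
  case False
  then have a: "Suc (n - a) = a" "n - a < a" "n \<le> 2 * (n - a) + 1" "a \<le> n"
    using assms by presburger+
  have cards: "card (level n a) = card (level n (n - a))"
    using binomial_symmetric[of a n] assms by (simp add: card_level)
  define w :: "nat set \<Rightarrow> nat set \<Rightarrow> real" where "w = (\<lambda>x y. if x \<subseteq> y then 1 / real a else 0)"
  have "\<exists>g. inj_on g (level n a) \<and> (\<forall>y\<in>level n a. g y \<in> level n (n - a) \<and> 0 < w (g y) y)"
  proof (rule fractional_matching)
    show "(\<Sum>x\<in>level n (n - a). w x y) = 1" if y: "y \<in> level n a" for y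
    proof -
      have y': "y \<subseteq> {1..n}" "card y = a" "finite y" using y finite_mem_level[OF y] by (auto simp: level_def)
      have "(\<Sum>x\<in>level n (n - a). w x y) = (\<Sum>x\<in>below y (n - a). 1 / real a)"
        unfolding w_def by (rule sum_level_below[OF y'(1)])
      also have "\<dots> = real (a choose (a - 1)) / real a"
        using card_below[OF y'(3), of "n - a"] y'(2) a by (metis diff_Suc_1 mult.right_neutral sum_constant times_divide_eq_right)
      also have "\<dots> = 1" using a binomial_symmetric[of 1 a] by simp
      finally show ?thesis .
    qed
    show "(\<Sum>y\<in>level n a. w x y) \<le> 1" if x: "x \<in> level n (n - a)" for x
    proof -
      have "(\<Sum>y\<in>level n a. w x y) = (\<Sum>y\<in>above n x a. 1 / real a)"
        unfolding w_def by (rule sum_level_above)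
      also have "\<dots> = real ((n - (n - a)) choose (a - (n - a))) / real a"
        using card_above[OF x, of a] a by simp
      also have "n - (n - a) = a" using a by simp
      also have "a - (n - a) = 1" using a by simp
      finally show ?thesis using a by simp
    qed
  qed (auto simp: w_def)
  then obtain g where g: "inj_on g (level n a)" "\<forall>y\<in>level n a. g y \<in> level n (n - a) \<and> 0 < w (g y) y"
    by blast
  have "g ` level n a = level n (n - a)"
    using g cards by (intro card_subset_eq) (auto simp: card_image)
  moreover have "g z \<subseteq> z" if "z \<in> level n a" for z
  proof -
    have "0 < w (g z) z" using g(2) that by blast
    then show ?thesis by (simp add: w_def split: if_splits)
  qed
  ultimately show ?thesis
    using that[of g] g(1) by (auto simp: bij_betw_def)
qed

lemma trancl_predecessor:
  assumes "(z, y) \<in> {(p v, v) |v. v \<in> B}\<^sup>+"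
    and "\<And>v. v \<in> B \<Longrightarrow> p v \<subset> v \<and> (card v \<le> k \<longrightarrow> (f (p v) :: nat) < f v) \<and> finite v"
  shows "z \<subset> y \<and> (card y \<le> k \<longrightarrow> f z < f y)"
  using assms(1)
proof (induction rule: trancl_induct)
  case (base y)
  then show ?case using assms(2) by auto
next
  case (step y w)
  then have "p w = y" "w \<in> B" by auto
  then have *: "y \<subset> w" "card w \<le> k \<longrightarrow> f y < f w" "finite w" using assms(2)[of w] by auto
  then have "card y \<le> card w" by (simp add: card_mono psubset_imp_subset)
  then show ?case using step.IH * by force
qed

text \<open>The paths of \<open>p\<close> partition the upper half into chains rooted in level
  \<open>a\<close>; their complements do the same for the lower half, and the middle bijection glues
  the two. On each side heights are distinct and take at most \<open>H\<close> values, hence the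
  bound \<open>2 * H\<close>.\<close>

theorem chain_partition_from_predecessors:
  fixes p :: "nat set \<Rightarrow> nat set" and f :: "nat set \<Rightarrow> nat"
  assumes a: "a = (n + 1) div 2"
    and inj: "inj_on p {y. y \<subseteq> {1..n} \<and> a < card y}"
    and p: "\<And>y. y \<subseteq> {1..n} \<Longrightarrow> a < card y \<Longrightarrow> a \<le> card (p y) \<and> p y \<subset> y \<and> (card y \<le> k1 \<longrightarrow> f (p y) < f y)"
    and f: "\<And>y. y \<subseteq> {1..n} \<Longrightarrow> a \<le> card y \<Longrightarrow> card y \<le> k1 \<Longrightarrow> a \<le> f y \<and> f y < a + H"
  shows "\<exists>P. chain_partition n P \<and> card P = n choose (n div 2) \<and>
    (\<forall>C\<in>P. card {x\<in>C. n - k1 \<le> card x \<and> card x \<le> k1} \<le> 2 * H)"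
proof -
  define X where "X = {y. y \<subseteq> {1..n} \<and> a \<le> card y}"
  define R where "R = level n a"
  have XR: "X - R = {y. y \<subseteq> {1..n} \<and> a < card y}" by (auto simp: X_def R_def level_def)
  have finX: "finite y" if "y \<subseteq> {1..n}" for y :: "nat set" using that finite_subset by blast
  have cardn: "card y \<le> n" if "y \<subseteq> {1..n}" for y :: "nat set" using that card_mono[of "{1..n}" y] by simp
  have step: "p v \<subset> v \<and> (card v \<le> k1 \<longrightarrow> f (p v) < f v) \<and> finite v" if "v \<in> X - R" for v
    using that p[of v] finX[of v] unfolding XR by blast
  obtain root where root: "\<And>z. z \<in> R \<Longrightarrow> root z = z" "\<And>y. y \<in> X \<Longrightarrow> root y \<in> R"
    "\<And>y. y \<in> X \<Longrightarrow> root y \<subseteq> y"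
    "\<And>y z. y \<in> X \<Longrightarrow> z \<in> X \<Longrightarrow> root y = root z \<Longrightarrow> y \<noteq> z \<Longrightarrow>
       (z, y) \<in> {(p v, v) |v. v \<in> X - R}\<^sup>+ \<or> (y, z) \<in> {(p v, v) |v. v \<in> X - R}\<^sup>+"
  proof (rule descending_paths[of X n R p])
    show "card x \<le> n" if "x \<in> X" for x using that cardn by (simp add: X_def)
    show "R \<subseteq> X" by (auto simp: X_def R_def level_def)
    show "inj_on p (X - R)" using inj unfolding XR .
    fix y assume y: "y \<in> X - R"
    then have "y \<subseteq> {1..n}" "a < card y" unfolding XR by auto
    then show "p y \<in> X \<and> p y \<subset> y \<and> finite y" using p[of y] finX[of y] by (auto simp: X_def)
  qed blast
  have comparable: "y \<subset> z \<and> (card z \<le> k1 \<longrightarrow> f y < f z) \<or> z \<subset> y \<and> (card y \<le> k1 \<longrightarrow> f z < f y)"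
    if "y \<in> X" "z \<in> X" "root y = root z" "y \<noteq> z" for y z
    using root(4)[OF that] trancl_predecessor[OF _ step] by blast
  define up where "up = (\<lambda>z. {y\<in>X. root y = z})"
  have fin_up: "finite (up z)" for z
    by (rule finite_subset[of _ "Pow {1..n}"]) (auto simp: up_def X_def)
  have card_up: "card {y\<in>up z. card y \<le> k1} \<le> H" for z
  proof -
    have "inj_on f {y\<in>up z. card y \<le> k1}"
    proof (rule inj_onI)
      fix y v assume "y \<in> {y\<in>up z. card y \<le> k1}" "v \<in> {y\<in>up z. card y \<le> k1}" "f y = f v"
      then show "y = v" using comparable[of y v] by (auto simp: up_def)
    qed
    moreover have "f ` {y\<in>up z. card y \<le> k1} \<subseteq> {a..<a + H}"
      using f by (auto simp: up_def X_def)
    ultimately have "card {y\<in>up z. card y \<le> k1} \<le> card {a..<a + H}"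
      by (intro card_inj_on_le) auto
    then show ?thesis by simp
  qed
  obtain g where g: "bij_betw g (level n a) (level n (n - a))" "\<And>z. z \<in> level n a \<Longrightarrow> g z \<subseteq> z"
    using middle_bijection[OF a] by blast
  define co where "co = (\<lambda>x::nat set. {1..n} - x)"
  have co_co: "co (co x) = x" if "x \<subseteq> {1..n}" for x using that by (auto simp: co_def)
  have co_sub: "co x \<subseteq> {1..n}" for x by (auto simp: co_def)
  have card_co: "card (co x) = n - card x" if "x \<subseteq> {1..n}" for x
    using that finX by (simp add: co_def card_Diff_subset)
  have co_anti: "x \<subseteq> y \<Longrightarrow> co y \<subseteq> co x" for x y by (auto simp: co_def)
  \<comment> \<open>For even \<open>n\<close> the middle set \<open>z\<close> lies in both
    \<open>up z\<close> and \<open>down z\<close>; for odd \<open>n\<close> the two are disjoint.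
    That is why \<open>disj\<close> has a mixed case.\<close>
  define down where "down = (\<lambda>z. {x. x \<subseteq> {1..n} \<and> card x \<le> n - a \<and> co (root (co x)) = g z})"
  have an: "a \<le> n" "n \<le> 2 * a" "n - a = n div 2" "n - a \<le> a" using a by auto
  have coX: "co x \<in> X" if "x \<subseteq> {1..n}" "card x \<le> n - a" for x
    using that card_co[of x] co_sub an by (auto simp: X_def)
  have gR: "g z \<subseteq> {1..n}" "card (g z) = n - a" if "z \<in> R" for z
    using that g(1) by (auto simp: bij_betw_def R_def level_def)
  have Rl: "z \<subseteq> {1..n}" "card z = a" if "z \<in> R" for z using that by (auto simp: R_def level_def)
  have down_co: "co x \<in> up (co (g z))" if "x \<in> down z" for x z
  proof -
    have x: "x \<subseteq> {1..n}" "card x \<le> n - a" "co (root (co x)) = g z" using that by (auto simp: down_def)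
    have "root (co x) \<in> R" using root(2)[OF coX[OF x(1,2)]] .
    then have "root (co x) = co (g z)" using co_co[of "root (co x)"] Rl x(3) by metis
    then show ?thesis using coX[OF x(1,2)] by (simp add: up_def)
  qed
  define blk where "blk = (\<lambda>z. up z \<union> down z)"
  have down_sub: "x \<subseteq> g z" if "x \<in> down z" for x z
  proof -
    have x: "x \<subseteq> {1..n}" "card x \<le> n - a" "co (root (co x)) = g z" using that by (auto simp: down_def)
    then have "co (co x) \<subseteq> co (root (co x))" using root(3)[OF coX[OF x(1,2)]] by (intro co_anti)
    then show ?thesis using co_co[OF x(1)] x(3) by simp
  qed
  have up_sup: "z \<subseteq> y" if "y \<in> up z" for y z
    using that root(3)[of y] by (auto simp: up_def)
  have chain: "chain\<^sub>\<subseteq> (blk z)" if z: "z \<in> R" for z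
    unfolding chain_subset_def
  proof (intro ballI)
    fix x y assume xy: "x \<in> blk z" "y \<in> blk z"
    have uu: "x \<subseteq> y \<or> y \<subseteq> x" if "x \<in> up w" "y \<in> up w" for x y w
      using that comparable[of x y] by (auto simp: up_def)
    have dd: "x \<subseteq> y \<or> y \<subseteq> x" if "x \<in> down z" "y \<in> down z" for x y
    proof -
      have "co x \<subseteq> co y \<or> co y \<subseteq> co x" using uu[OF down_co[OF that(1)] down_co[OF that(2)]] .
      then have "co (co y) \<subseteq> co (co x) \<or> co (co x) \<subseteq> co (co y)" using co_anti by blast
      then show ?thesis using that co_co by (auto simp: down_def)
    qed
    have du: "x \<subseteq> y" if "x \<in> down z" "y \<in> up z" for x y
      using down_sub[OF that(1)] g(2)[of z] up_sup[OF that(2)] z by (auto simp: R_def)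
    show "x \<subseteq> y \<or> y \<subseteq> x" using xy uu dd du unfolding blk_def by blast
  qed
  have mid: "y = z" if "z \<in> R" "y \<in> up z" "card y \<le> a" for y z
  proof -
    have "y \<in> R" using that by (auto simp: up_def X_def R_def level_def)
    then show ?thesis using root(1)[of y] that by (simp add: up_def)
  qed
  have disj: "z = z'" if z: "z \<in> R" "z' \<in> R" and x: "x \<in> blk z" "x \<in> blk z'" for x z z'
  proof -
    have du: "z = z'" if "x \<in> up z" "x \<in> down z'" "z \<in> R" "z' \<in> R" for z z'
    proof -
      have cx: "card x = a" "n - a = a" "x \<subseteq> {1..n}" using that an by (auto simp: up_def X_def down_def)
      then have "x = z" using mid[OF that(3,1)] by simp
      have "card (g z') = card z'" using gR[OF that(4)] Rl[OF that(4)] cx by simp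
      then have gz: "g z' = z'" using g(2)[of z'] that(4) Rl[OF that(4)] finX by (metis R_def card_subset_eq)
      have "x \<subseteq> z'" using down_sub[OF that(2)] gz by simp
      then have "x = z'" using cx Rl[OF that(4)] finX by (metis card_subset_eq)
      then show ?thesis using \<open>x = z\<close> by simp
    qed
    have dd: "z = z'" if "x \<in> down z" "x \<in> down z'"
    proof -
      have "g z = g z'" using that by (auto simp: down_def)
      then show ?thesis using g(1) z by (auto simp: bij_betw_def inj_on_def R_def)
    qed
    show ?thesis
      using x du[of z z'] du[of z' z] dd z by (auto simp: blk_def up_def)
  qed
  have zin: "z \<in> blk z" if "z \<in> R" for z
    using that root(1)[OF that] by (auto simp: blk_def up_def X_def R_def level_def)
  define P where "P = blk ` R"
  have inj_blk: "inj_on blk R"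
    by (rule inj_onI) (metis disj zin)
  have "card P = n choose (n div 2)"
    using inj_blk an binomial_symmetric[of a n] by (simp add: P_def card_image R_def card_level)
  moreover have "chain_partition n P"
    unfolding chain_partition_def partition_on_def
  proof (intro conjI ballI)
    show "\<Union>P = Pow {1..n}"
    proof
      show "\<Union>P \<subseteq> Pow {1..n}" by (auto simp: P_def blk_def up_def X_def down_def)
      show "Pow {1..n} \<subseteq> \<Union>P"
      proof
        fix x assume x: "x \<in> Pow {1..n}"
        show "x \<in> \<Union>P"
        proof (cases "a \<le> card x")
          case True
          then have "x \<in> X" using x by (simp add: X_def)
          then have "x \<in> blk (root x)" "root x \<in> R" using root(2) by (auto simp: blk_def up_def)
          then show ?thesis by (auto simp: P_def)
        next
          case False
          then have cx: "card x \<le> n - a" using a by auto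
          have "root (co x) \<in> R" using root(2) coX x cx by blast
          then have "co (root (co x)) \<in> level n (n - a)"
            using card_co[of "root (co x)"] co_sub Rl by (auto simp: level_def)
          then have "co (root (co x)) \<in> g ` R"
            using g(1) by (simp add: bij_betw_def R_def)
          then obtain z where z: "z \<in> R" "g z = co (root (co x))"
            by (metis imageE)
          then have "x \<in> blk z" using x cx by (auto simp: blk_def down_def)
          then show ?thesis using z by (auto simp: P_def)
        qed
      qed
    qed
    show "disjoint P"
      unfolding disjoint_def P_def using disj by blast
    show "{} \<notin> P" using zin by (auto simp: P_def)
    show "chain\<^sub>\<subseteq> C" if "C \<in> P" for C using that chain by (auto simp: P_def)
  qed
  moreover have "card {x\<in>C. n - k1 \<le> card x \<and> card x \<le> k1} \<le> 2 * H" if CP: "C \<in> P" for C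
  proof -
    obtain z where z: "z \<in> R" "C = blk z" using CP by (auto simp: P_def)
    have cdown: "card {x\<in>down z. n - k1 \<le> card x} \<le> H"
    proof -
      have "inj_on co {x\<in>down z. n - k1 \<le> card x}"
        by (rule inj_on_inverseI[where g = co]) (use co_co in \<open>auto simp: down_def\<close>)
      moreover have "co ` {x\<in>down z. n - k1 \<le> card x} \<subseteq> {y\<in>up (co (g z)). card y \<le> k1}"
        using down_co card_co by (auto simp: down_def)
      ultimately have "card {x\<in>down z. n - k1 \<le> card x} \<le> card {y\<in>up (co (g z)). card y \<le> k1}"
        using fin_up by (intro card_inj_on_le) auto
      then show ?thesis using card_up[of "co (g z)"] by linarith
    qed
    have "{x\<in>C. n - k1 \<le> card x \<and> card x \<le> k1} \<subseteq> {y\<in>up z. card y \<le> k1} \<union> {x\<in>down z. n - k1 \<le> card x}"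
      by (auto simp: z blk_def)
    moreover have "finite (down z)"
      by (rule finite_subset[of _ "Pow {1..n}"]) (auto simp: down_def)
    ultimately have "card {x\<in>C. n - k1 \<le> card x \<and> card x \<le> k1} \<le> card ({y\<in>up z. card y \<le> k1} \<union> {x\<in>down z. n - k1 \<le> card x})"
      using fin_up by (intro card_mono) auto
    also have "\<dots> \<le> H + H"
      using card_Un_le[of "{y\<in>up z. card y \<le> k1}" "{x\<in>down z. n - k1 \<le> card x}"] cdown card_up[of z] by linarith
    finally show ?thesis by simp
  qed
  ultimately show ?thesis by blast
qed

section \<open>Estimates\<close>

text \<open>Markov's inequality for the nonnegative deficits \<open>L - a C\<close>.\<close>

lemma deficit_count:
  fixes a :: "'a \<Rightarrow> real"
  assumes "finite P" "\<And>C. C \<in> P \<Longrightarrow> a C \<le> L" "0 < g"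
  shows "real (card {C\<in>P. a C + g \<le> L}) * g \<le> (\<Sum>C\<in>P. L - a C)"
proof -
  have "real (card {C\<in>P. a C + g \<le> L}) * g = (\<Sum>C\<in>{C\<in>P. a C + g \<le> L}. g)" by simp
  also have "\<dots> \<le> (\<Sum>C\<in>{C\<in>P. a C + g \<le> L}. L - a C)" by (rule sum_mono) auto
  also have "\<dots> \<le> (\<Sum>C\<in>P. L - a C)" using assms by (intro sum_mono2) auto
  finally show ?thesis .
qed

text \<open>An upper bound on the sizes is enough: the average size is \<open>s\<close>, so Markov's inequality bounds the
  number of chains that are too short.\<close>

lemma bad_chain_count:
  fixes s \<delta> E :: real
  assumes P: "partition_on (Pow {1..n}) P" "card P = M" "M > 0"
    and s: "s = 2 ^ n / real M" and E: "0 < \<delta>" "\<delta> \<le> E" "E \<le> 1"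
    and H: "\<And>C. C \<in> P \<Longrightarrow> real (card {x\<in>C. Q x}) \<le> s * (1 + \<delta>)"
    and T: "real (card {x. x \<subseteq> {1..n} \<and> \<not> Q x}) \<le> \<delta> * real M"
  shows "real (card {C\<in>P. \<not> \<bar>real (card C) - s\<bar> \<le> E * s}) \<le> 3 * \<delta> * real M / E"
proof -
  have finP: "finite P" using P by (simp add: card_ge_0_finite)
  have Cs: "C \<subseteq> Pow {1..n}" if "C \<in> P" for C using P(1) that by (auto simp: partition_on_def)
  have finC: "finite C" if "C \<in> P" for C using Cs[OF that] finite_subset by blast
  have disj: "C \<inter> D = {}" if "C \<in> P" "D \<in> P" "C \<noteq> D" for C D
    using P(1) that by (auto simp: partition_on_def disjoint_def)
  have union: "\<Union>P = Pow {1..n}" using P(1) by (simp add: partition_on_def)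
  have tot: "(\<Sum>C\<in>P. card {x\<in>C. G x}) = card {x. x \<subseteq> {1..n} \<and> G x}" for G
  proof -
    have "card (\<Union>C\<in>P. {x\<in>C. G x}) = (\<Sum>C\<in>P. card {x\<in>C. G x})"
      by (rule card_UN_disjoint) (use finP finC disj in auto)
    moreover have "(\<Union>C\<in>P. {x\<in>C. G x}) = {x. x \<subseteq> {1..n} \<and> G x}" using union by auto
    ultimately show ?thesis by simp
  qed
  define t where "t = (\<lambda>C. card {x\<in>C. \<not> Q x})"
  define q where "q = (\<lambda>C. card {x\<in>C. Q x})"
  have split: "card C = q C + t C" if "C \<in> P" for C
  proof -
    have "C = {x\<in>C. Q x} \<union> {x\<in>C. \<not> Q x}" by auto
    then have "card C = card ({x\<in>C. Q x} \<union> {x\<in>C. \<not> Q x})" by simp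
    also have "\<dots> = q C + t C" unfolding q_def t_def using finC[OF that] by (intro card_Un_disjoint) auto
    finally show ?thesis .
  qed
  define Tn where "Tn = card {x. x \<subseteq> {1..n} \<and> \<not> Q x}"
  have sumt: "(\<Sum>C\<in>P. t C) = Tn" using tot[of "\<lambda>x. \<not> Q x"] by (simp add: t_def Tn_def)
  have "(\<Sum>C\<in>P. card C) = card (Pow {1..n})" using tot[of "\<lambda>_. True"] by (simp add: Pow_def)
  then have sumC: "(\<Sum>C\<in>P. card C) = 2 ^ n" by (simp add: card_Pow)
  have M0: "real M > 0" using P by simp
  have s1: "1 \<le> s"
  proof -
    have "M = (\<Sum>C\<in>P. 1)" using P by simp
    also have "\<dots> \<le> (\<Sum>C\<in>P. card C)"
    proof (rule sum_mono)
      fix C assume C: "C \<in> P"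
      then have "C \<noteq> {}" using P(1) by (auto simp: partition_on_def)
      then show "1 \<le> card C" using finC[OF C] by (simp add: Suc_leI card_gt_0_iff)
    qed
    finally have "real M \<le> real (2 ^ n)" unfolding sumC by (simp only: of_nat_le_iff)
    then show ?thesis using M0 s by simp
  qed
  \<comment> \<open>\<open>Up\<close> collects the chains that meet the discarded sets. A bad chain
    outside \<open>Up\<close> cannot be too long, as \<open>\<delta> <= E\<close>, so it misses the
    common bound \<open>s * (1 + \<delta>)\<close> by at least \<open>s * E\<close>.\<close>
  define Up where "Up = {C\<in>P. t C > 0}"
  define Lo where "Lo = {C\<in>P. real (q C) + s * E \<le> s * (1 + \<delta>)}"
  have "{C\<in>P. \<not> \<bar>real (card C) - s\<bar> \<le> E * s} \<subseteq> Up \<union> Lo"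
  proof
    fix C assume C: "C \<in> {C\<in>P. \<not> \<bar>real (card C) - s\<bar> \<le> E * s}"
    then have CP: "C \<in> P" by simp
    show "C \<in> Up \<union> Lo"
    proof (cases "t C = 0")
      case True
      then have q: "real (card C) = real (q C)" using split[OF CP] by simp
      have "s * \<delta> \<le> s * E" using E s1 by (intro mult_left_mono) auto
      then have "real (card C) \<le> s + E * s" using H[OF CP] q by (simp add: q_def algebra_simps)
      then have "real (card C) < s - E * s" using C by auto
      moreover have "0 \<le> s * \<delta>" using s1 E by simp
      ultimately have "C \<in> Lo" using CP q by (simp add: Lo_def algebra_simps)
      then show ?thesis by simp
    qed (use CP in \<open>simp add: Up_def\<close>)
  qed
  then have "card {C\<in>P. \<not> \<bar>real (card C) - s\<bar> \<le> E * s} \<le> card (Up \<union> Lo)"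
    using finP by (intro card_mono) (auto simp: Up_def Lo_def)
  also have "\<dots> \<le> card Up + card Lo" by (rule card_Un_le)
  finally have bad: "real (card {C\<in>P. \<not> \<bar>real (card C) - s\<bar> \<le> E * s}) \<le> real (card Up) + real (card Lo)"
    by (simp flip: of_nat_add)
  have "card Up = (\<Sum>C\<in>Up. 1)" by simp
  also have "\<dots> \<le> (\<Sum>C\<in>Up. t C)" by (rule sum_mono) (auto simp: Up_def)
  also have "\<dots> \<le> (\<Sum>C\<in>P. t C)" using finP by (intro sum_mono2) (auto simp: Up_def)
  finally have Up: "real (card Up) \<le> \<delta> * real M" using sumt T by (simp add: Tn_def)
  have "real (card Lo) * (s * E) \<le> (\<Sum>C\<in>P. s * (1 + \<delta>) - real (q C))"
    unfolding Lo_def using H s1 E by (intro deficit_count finP) (auto simp: q_def)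
  also have "\<dots> = s * (1 + \<delta>) * real M - (\<Sum>C\<in>P. real (card C)) + (\<Sum>C\<in>P. real (t C))"
    using split P by (simp add: sum_subtractf sum.distrib)
  also have "\<dots> = s * \<delta> * real M + real Tn"
    using sumC sumt s M0 by (simp flip: of_nat_sum add: field_simps)
  also have "\<dots> \<le> s * \<delta> * real M + s * (\<delta> * real M)"
  proof -
    have "1 * (\<delta> * real M) \<le> s * (\<delta> * real M)" using s1 E by (intro mult_right_mono) auto
    then have "real Tn \<le> s * (\<delta> * real M)" using T by (simp add: Tn_def)
    then show ?thesis by linarith
  qed
  finally have "s * (real (card Lo) * E) \<le> s * (2 * \<delta> * real M)" by (simp add: algebra_simps)
  then have "real (card Lo) * E \<le> 2 * \<delta> * real M" using s1 by simp
  then have Lo: "real (card Lo) \<le> 2 * \<delta> * real M / E" using E by (simp add: pos_le_divide_eq)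
  have "\<delta> * real M \<le> \<delta> * real M / E"
    using E M0 by (simp add: pos_le_divide_eq mult_left_le)
  then have "real (card Up) + real (card Lo) \<le> \<delta> * real M / E + 2 * \<delta> * real M / E"
    using Up Lo by linarith
  also have "\<dots> = 3 * \<delta> * real M / E" by (simp add: add_divide_distrib[symmetric])
  finally show ?thesis using bad by linarith
qed

lemma minimum_chain_partition_exists:
  assumes "n \<ge> 1"
  shows "\<exists>P. chain_partition n P \<and> card P = n choose (n div 2)"
proof -
  define a where "a = (n + 1) div 2"
  have a1: "a \<ge> 1" "n \<le> 2 * a" using assms by (auto simp: a_def)
  obtain p where p: "inj_on p {y. y \<subseteq> {1..n} \<and> a < card y}"
    "\<forall>y. y \<subseteq> {1..n} \<longrightarrow> a < card y \<longrightarrow> p y \<subset> y \<and> Suc (card (p y)) = card y"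
    using uniform_matching[OF a1(2)] by blast
  \<comment> \<open>With \<open>k1 = 0\<close> the conditions on the heights hold vacuously, since
    \<open>a\<close> is positive.\<close>
  have "\<exists>P. chain_partition n P \<and> card P = n choose (n div 2) \<and>
    (\<forall>C\<in>P. card {x\<in>C. n - 0 \<le> card x \<and> card x \<le> 0} \<le> 2 * 0)"
  proof (rule chain_partition_from_predecessors[OF a_def p(1), where f = "\<lambda>_. 0"])
    fix y assume y: "y \<subseteq> {1..n}" "a < card y"
    then have "p y \<subset> y" "Suc (card (p y)) = card y" using p(2) by auto
    then show "a \<le> card (p y) \<and> p y \<subset> y \<and> (card y \<le> 0 \<longrightarrow> (0::nat) < 0)" using y by simp
  qed (use a1 in auto)
  then show ?thesis by blast
qed

section \<open>Estimates for binomial coefficients\<close>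

text \<open>The ratio of consecutive coefficients is at most \<open>1 - (2 * i + 1) / n\<close>, and
  the odd numbers add up to \<open>i^2\<close>.\<close>

lemma binomial_upper_gauss:
  assumes "n \<le> 2 * a" "a + i \<le> n"
  shows "real (n choose (a + i)) \<le> real (n choose a) * exp (- (real i)\<^sup>2 / real n)"
  using assms(2)
proof (induction i)
  case (Suc i)
  have n: "real n > 0" using Suc by simp
  have "real (n - (a + i)) / real (Suc (a + i)) \<le> 1 - (2 * real i + 1) / real n"
  proof -
    have "real (n - (a + i)) / real (Suc (a + i)) = 1 - (2 * real a + 2 * real i + 1 - real n) / real (Suc (a + i))"
      using Suc.prems by (simp add: field_simps of_nat_diff)
    moreover have "(2 * real i + 1) / real n \<le> (2 * real a + 2 * real i + 1 - real n) / real (Suc (a + i))"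
      using assms Suc.prems by (intro frac_le) auto
    ultimately show ?thesis by linarith
  qed
  also have "\<dots> \<le> exp (- ((2 * real i + 1) / real n))"
    using exp_ge_add_one_self[of "- ((2 * real i + 1) / real n)"] by simp
  finally have step: "real (n - (a + i)) / real (Suc (a + i)) \<le> exp (- ((2 * real i + 1) / real n))" .
  have "real (n choose (a + Suc i)) = real (n choose (a + i)) * (real (n - (a + i)) / real (Suc (a + i)))"
    using binomial_Suc_ratio[of n "a + i"] by (simp add: field_simps)
  also have "\<dots> \<le> (real (n choose a) * exp (- (real i)\<^sup>2 / real n)) * exp (- ((2 * real i + 1) / real n))"
    using Suc step by (intro mult_mono) auto
  also have "\<dots> = real (n choose a) * exp (- (real (Suc i))\<^sup>2 / real n)"
  proof -
    have "- (real i)\<^sup>2 / real n + - ((2 * real i + 1) / real n) = - (real (Suc i))\<^sup>2 / real n"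
      by (simp add: power2_eq_square add_divide_distrib diff_divide_distrib algebra_simps)
    then show ?thesis by (simp only: mult.assoc exp_add[symmetric])
  qed
  finally show ?case .
qed simp

text \<open>The ratio is at least \<open>1 - 4 * (i + 1) / n\<close>. Measuring each loss against
  the largest coefficient makes the losses additive.\<close>

lemma binomial_lower_quadratic:
  assumes "n \<le> 2 * a" "2 * a \<le> n + 1" "a + i \<le> n"
  shows "real (n choose a) * (1 - 2 * real i * (real i + 1) / real n) \<le> real (n choose (a + i))"
  using assms(3)
proof (induction i)
  case (Suc i)
  have n: "real n > 0" using Suc by simp
  have "1 - 4 * (real i + 1) / real n \<le> real (n - (a + i)) / real (Suc (a + i))"
  proof -
    have "real (n - (a + i)) / real (Suc (a + i)) = 1 - (2 * real a + 2 * real i + 1 - real n) / real (Suc (a + i))"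
      using Suc.prems by (simp add: field_simps of_nat_diff)
    moreover have "(2 * real a + 2 * real i + 1 - real n) / real (Suc (a + i)) \<le> (2 * real i + 2) / (real n / 2)"
      using assms n by (intro frac_le) auto
    ultimately show ?thesis by (simp add: algebra_simps)
  qed
  then have "real (n choose (a + i)) * (1 - 4 * (real i + 1) / real n) \<le> real (n choose (a + i)) * (real (n - (a + i)) / real (Suc (a + i)))"
    by (rule mult_left_mono) simp
  also have "\<dots> = real (n choose (a + Suc i))"
    using binomial_Suc_ratio[of n "a + i"] by (simp add: field_simps)
  finally have "real (n choose (a + i)) * (1 - 4 * (real i + 1) / real n) \<le> real (n choose (a + Suc i))" .
  note s1 = this
  have s2: "real (n choose (a + i)) * (4 * (real i + 1) / real n) \<le> real (n choose a) * (4 * (real i + 1) / real n)"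
    using binomial_antimono[of n a "a + i"] assms by (intro mult_right_mono) auto
  have "real (n choose a) * (1 - 2 * real i * (real i + 1) / real n) - real (n choose a) * (4 * (real i + 1) / real n) \<le> real (n choose (a + Suc i))"
  proof -
    have "real (n choose (a + i)) * (1 - 4 * (real i + 1) / real n)
        = real (n choose (a + i)) - real (n choose (a + i)) * (4 * (real i + 1) / real n)"
      by (simp only: right_diff_distrib mult_1_right)
    then have "real (n choose (a + i)) - real (n choose (a + i)) * (4 * (real i + 1) / real n) \<le> real (n choose (a + Suc i))"
      using s1 by (simp only:)
    moreover have "real (n choose a) * (1 - 2 * real i * (real i + 1) / real n) \<le> real (n choose (a + i))"
      using Suc by simp
    ultimately show ?thesis using diff_mono[OF _ s2] order_trans by blast
  qed
  also have "real (n choose a) * (1 - 2 * real i * (real i + 1) / real n) - real (n choose a) * (4 * (real i + 1) / real n)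
     = real (n choose a) * (1 - 2 * real (Suc i) * (real (Suc i) + 1) / real n)"
    using n by (simp add: field_simps)
  finally show ?case .
qed simp

text \<open>Reflection maps the upper half to the lower half, and the two overlap at most in the
  middle level.\<close>

lemma upper_half_sum:
  assumes "a = (n + 1) div 2"
  shows "2 * (\<Sum>k=a..n. real (n choose k)) \<le> 2 ^ n + real (n choose a)"
proof -
  have a: "a \<le> n" "n - a \<le> a" "a \<le> Suc (n - a)" using assms by auto
  have "(\<Sum>k=a..n. real (n choose k)) = (\<Sum>k=0..n-a. real (n choose k))"
    by (rule sum.reindex_bij_witness[where i = "\<lambda>k. n - k" and j = "\<lambda>k. n - k"])
      (use a in \<open>auto simp: binomial_symmetric[symmetric]\<close>)
  then have "2 * (\<Sum>k=a..n. real (n choose k)) = (\<Sum>k=0..n-a. real (n choose k)) + (\<Sum>k=a..n. real (n choose k))"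
    by simp
  also have "\<dots> = (\<Sum>k\<in>{0..n-a} \<union> {a..n}. real (n choose k)) + (\<Sum>k\<in>{0..n-a} \<inter> {a..n}. real (n choose k))"
    by (rule sum.union_inter[symmetric]) auto
  also have "{0..n-a} \<union> {a..n} = {..n}" using a by auto
  also have "(\<Sum>k\<le>n. real (n choose k)) = 2 ^ n"
    using choose_row_sum[of n] by (simp flip: of_nat_sum)
  also have "(\<Sum>k\<in>{0..n-a} \<inter> {a..n}. real (n choose k)) \<le> (\<Sum>k\<in>{a}. real (n choose k))"
    by (rule sum_mono2) (use a in auto)
  finally show ?thesis by simp
qed

text \<open>About \<open>sqrt n / 3\<close> levels above the middle have at least
  \<open>5 / 9\<close> of its size. Only the order of \<open>s\<close> matters: it makes
  \<open>b^2\<close> small against \<open>s\<close>.\<close>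

lemma average_chain_size_ge:
  assumes a: "a = (n + 1) div 2" and n: "n \<ge> 100"
  shows "sqrt (real n) / 6 * real (n choose a) \<le> 2 ^ n"
proof -
  define I where "I = nat \<lfloor>sqrt (real n) / 3\<rfloor>"
  have "10 \<le> sqrt (real n)" using n by (intro real_le_rsqrt) simp
  then have "1 \<le> \<lfloor>sqrt (real n) / 3\<rfloor>" by simp
  moreover from this have "real I = of_int \<lfloor>sqrt (real n) / 3\<rfloor>" by (simp add: I_def)
  ultimately have I1: "real I \<le> sqrt (real n) / 3" "sqrt (real n) / 3 \<le> real I + 1" "1 \<le> real I"
    by linarith+
  have "real I * real I \<le> sqrt (real n) / 3 * (sqrt (real n) / 3)"
    using I1 by (intro mult_mono) auto
  then have II: "real I * real I \<le> real n / 9" by simp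
  have aI: "a + I \<le> n"
  proof -
    have "real I * 1 \<le> real I * real I" using I1 by (intro mult_left_mono) auto
    then have "real I \<le> real n / 9" using II by linarith
    then have "9 * I \<le> n" by linarith
    then show ?thesis using a n by linarith
  qed
  have na: "n \<le> 2 * a" "2 * a \<le> n + 1" using a by auto
  have each: "5 / 9 * real (n choose a) \<le> real (n choose (a + i))" if "i \<le> I" for i
  proof -
    have "2 * real i * (real i + 1) \<le> 2 * real I * (real I + real I)"
      using that I1 by (intro mult_mono) auto
    also have "\<dots> \<le> 4 / 9 * real n" using II by (simp add: algebra_simps)
    finally have "2 * real i * (real i + 1) / real n \<le> 4 / 9" using n by (simp add: divide_le_eq)
    then have "real (n choose a) * (5 / 9) \<le> real (n choose a) * (1 - 2 * real i * (real i + 1) / real n)"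
      by (intro mult_left_mono) auto
    moreover have "a + i \<le> n" using that aI by simp
    ultimately show ?thesis using binomial_lower_quadratic[OF na, of i] by linarith
  qed
  have "sqrt (real n) / 6 * real (n choose a) \<le> (real I + 1) * (5 / 9 * real (n choose a))"
  proof -
    have "sqrt (real n) / 6 \<le> (real I + 1) * (5 / 9)" using I1 by simp
    then have "sqrt (real n) / 6 * real (n choose a) \<le> (real I + 1) * (5 / 9) * real (n choose a)"
      by (intro mult_right_mono) auto
    then show ?thesis by (simp only: mult.assoc)
  qed
  also have "\<dots> = (\<Sum>i=0..I. 5 / 9 * real (n choose a))" by (simp add: algebra_simps)
  also have "\<dots> \<le> (\<Sum>i=0..I. real (n choose (a + i)))" by (rule sum_mono) (use each in auto)
  also have "\<dots> = (\<Sum>k=a..a+I. real (n choose k))"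
    by (rule sum.reindex_bij_witness[where i = "\<lambda>k. k - a" and j = "\<lambda>i. a + i"]) auto
  also have "\<dots> \<le> (\<Sum>k\<le>n. real (n choose k))" by (rule sum_mono2) (use aI in auto)
  also have "\<dots> = 2 ^ n" using choose_row_sum[of n] by (simp flip: of_nat_sum)
  finally show ?thesis .
qed

text \<open>The outer levels are at distance at least \<open>n / 8\<close> from the middle, up to
  reflection, so each is smaller by a factor \<open>exp (- n / 64)\<close>; even
  \<open>n + 1\<close> of them stay below the proportion of order \<open>1 / b\<close> that is
  allowed.\<close>

lemma tail_size:
  assumes n: "n \<ge> 2 ^ 16" and k1: "k1 = 3 * n div 4" and b: "b \<ge> 1" "b \<le> n"
  shows "real (card {x. x \<subseteq> {1..n} \<and> \<not> (n - k1 \<le> card x \<and> card x \<le> k1)})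
    \<le> 9000 / real b * real (n choose (n div 2))"
proof -
  define a where "a = (n + 1) div 2"
  define B where "B = real (n choose a) * exp (- real n / 64)"
  have nd: "n choose (n div 2) = n choose a" 
  proof -
    have "a \<le> n" "n - a = n div 2" using n by (auto simp: a_def)
    then show ?thesis using binomial_symmetric[of a n] by simp
  qed
  have big: "real (n choose k) \<le> B" if "k1 < k" "k \<le> n" for k
  proof -
    define i where "i = k - a"
    have i: "k = a + i" "real n / 8 \<le> real i"
    proof -
      have "3 * n < 4 * k" using that k1 by linarith
      then have "8 * a + n \<le> 8 * k" using n by (simp add: a_def)
      then show "k = a + i" "real n / 8 \<le> real i" by (auto simp: i_def)
    qed
    have "(real n / 8)\<^sup>2 \<le> (real i)\<^sup>2" using i by (intro power_mono) auto
    then have "real n / 64 \<le> (real i)\<^sup>2 / real n"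
      using n by (simp add: pos_le_divide_eq power2_eq_square)
    then have "exp (- (real i)\<^sup>2 / real n) \<le> exp (- real n / 64)" by simp
    then have "real (n choose a) * exp (- (real i)\<^sup>2 / real n) \<le> B"
      unfolding B_def by (intro mult_left_mono) auto
    moreover have "real (n choose (a + i)) \<le> real (n choose a) * exp (- (real i)\<^sup>2 / real n)"
      by (rule binomial_upper_gauss) (use that i in \<open>auto simp: a_def\<close>)
    moreover have "n choose k = n choose (a + i)" using i(1) by simp
    ultimately show ?thesis by simp
  qed
  have each: "real (n choose k) \<le> B" if "k \<le> n" "\<not> (n - k1 \<le> k \<and> k \<le> k1)" for k
  proof (cases "k1 < k")
    case False
    then have "real (n choose (n - k)) \<le> B" using that by (intro big) auto
    then show ?thesis using that binomial_symmetric[of k n] by simp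
  qed (use big that in auto)
  define J where "J = {k. k \<le> n \<and> \<not> (n - k1 \<le> k \<and> k \<le> k1)}"
  have "{x. x \<subseteq> {1..n} \<and> \<not> (n - k1 \<le> card x \<and> card x \<le> k1)} = (\<Union>k\<in>J. level n k)"
    using card_mono[of "{1..n}"] by (auto simp: level_def J_def)
  then have "real (card {x. x \<subseteq> {1..n} \<and> \<not> (n - k1 \<le> card x \<and> card x \<le> k1)}) = real (card (\<Union>k\<in>J. level n k))"
    by simp
  also have "card (\<Union>k\<in>J. level n k) = (\<Sum>k\<in>J. card (level n k))"
    by (rule card_UN_disjoint) (auto simp: J_def level_def)
  also have "real (\<Sum>k\<in>J. card (level n k)) \<le> (\<Sum>k\<in>J. B)"
    unfolding of_nat_sum card_level by (rule sum_mono) (use each in \<open>auto simp: J_def\<close>)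
  also have "\<dots> \<le> (real n + 1) * B"
  proof -
    have "card J \<le> card {..n}" by (rule card_mono) (auto simp: J_def)
    then show ?thesis by (auto simp: B_def intro!: mult_right_mono)
  qed
  also have "(real n + 1) * B \<le> 9000 / real b * real (n choose a)"
  proof -
    have "(real n)\<^sup>2 \<le> (real n / 256) ^ 4"
    proof -
      have "65536 * 65536 * (real n)\<^sup>2 \<le> real n * real n * (real n)\<^sup>2"
        using n by (intro mult_right_mono mult_mono) auto
      then show ?thesis by (simp add: power_divide power4_eq_xxxx power2_eq_square)
    qed
    also have "\<dots> \<le> exp (real n / 256) ^ 4"
      using exp_ge_add_one_self[of "real n / 256"] by (intro power_mono) linarith+
    also have "\<dots> = exp (real n / 64)" by (simp flip: exp_of_nat_mult)
    finally have e: "(real n)\<^sup>2 \<le> exp (real n / 64)" .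
    have "(real n + 1) * real b \<le> (2 * real n) * real n"
      using b n by (intro mult_mono) auto
    also have "\<dots> = 2 * (real n)\<^sup>2" by (simp add: power2_eq_square)
    also have "\<dots> \<le> 9000 * exp (real n / 64)" using e exp_gt_zero[of "real n / 64"] by linarith
    finally have "(real n + 1) * exp (- real n / 64) \<le> 9000 / real b"
      using b by (simp add: exp_minus field_simps)
    then have "((real n + 1) * exp (- real n / 64)) * real (n choose a) \<le> 9000 / real b * real (n choose a)"
      by (intro mult_right_mono) auto
    then show ?thesis by (simp add: B_def mult_ac)
  qed
  finally show ?thesis by (simp add: nd)
qed

text \<open>With \<open>k0 - a\<close> of the order of \<open>sqrt (n / b)\<close>, a proportion of order \<open>1 / b\<close> of the middle level is
  not needed up to level \<open>k0\<close>: this pays for the transit between runs and is all that is lost.\<close>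

lemma balanced_chain_partition:
  assumes n: "n \<ge> 2 ^ 16" and b: "b \<ge> 1000" "54000 * b ^ 5 \<le> n"
  shows "\<exists>P. chain_partition n P \<and> card P = n choose (n div 2) \<and>
    (\<forall>C\<in>P. real (card {x\<in>C. n - 3 * n div 4 \<le> card x \<and> card x \<le> 3 * n div 4})
      \<le> 2 ^ n / real (n choose (n div 2)) * (1 + 9000 / real b))"
proof -
  define a where "a = (n + 1) div 2"
  define k1 where "k1 = 3 * n div 4"
  \<comment> \<open>The factor 10 makes the reservoir at least \<open>64 / b\<close> times level
    \<open>k0\<close>, against a need of at most \<open>40 / b\<close>; the same distance makes
    level \<open>a\<close> larger than level \<open>k0\<close> by at most the factor
    \<open>1 + 800 / b\<close> in \<open>Nk\<close>.\<close>
  define i0 where "i0 = nat \<lfloor>10 * sqrt (real n / real b)\<rfloor>"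
  define k0 where "k0 = a + i0"
  define q where "q = sqrt (real n / real b)"
  have a: "n \<le> 2 * a" "2 * a \<le> n + 1" by (auto simp: a_def)
  have b0: "real b > 0" using b by simp
  have n0: "real n > 0" using n by simp
  have nb5: "54000 * real b ^ 5 \<le> real n"
    using b(2) by (metis of_nat_le_iff of_nat_mult of_nat_numeral of_nat_power)
  have "(200 * (real b)\<^sup>2)\<^sup>2 \<le> real n / real b"
  proof -
    have "(200 * (real b)\<^sup>2)\<^sup>2 * real b = 40000 * real b ^ 5"
      by (simp add: eval_nat_numeral)
    also have "\<dots> \<le> real n"
    proof -
      have "0 \<le> real b ^ 5" by simp
      then show ?thesis using nb5 by linarith
    qed
    finally show ?thesis using b0 by (simp add: pos_le_divide_eq)
  qed
  then have q200: "200 * (real b)\<^sup>2 \<le> q" unfolding q_def by (rule real_le_rsqrt)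
  have bb: "1000 * real b \<le> (real b)\<^sup>2" using b by (simp add: power2_eq_square)
  have qq: "q * q = real n / real b" by (simp add: q_def)
  have qbig: "200000 * real b \<le> q" "1000 \<le> real b" using q200 bb b by auto
  have i0: "real i0 \<le> 10 * q" "10 * q - 1 \<le> real i0"
  proof -
    have "0 \<le> \<lfloor>10 * q\<rfloor>" using qbig b0 by (simp add: q_def)
    then have "real i0 = of_int \<lfloor>10 * q\<rfloor>" by (simp add: i0_def q_def)
    then show "real i0 \<le> 10 * q" "10 * q - 1 \<le> real i0" by linarith+
  qed
  have i0b: "b \<le> i0" "1000 \<le> i0"
  proof -
    have "real b \<le> real i0" using i0 qbig by linarith
    then show "b \<le> i0" by simp
    then show "1000 \<le> i0" using b by simp
  qed
  have i0sq: "real i0 * real i0 \<le> 100 * (real n / real b)"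
  proof -
    have "real i0 * real i0 \<le> (10 * q) * (10 * q)" using i0 by (intro mult_mono) auto
    then show ?thesis using qq by simp
  qed
  have i0n: "1000 * i0 \<le> n"
  proof -
    have "real n * (100 / real b) \<le> real n * 1" using b by (intro mult_left_mono) auto
    then have "100 * (real n / real b) \<le> real n" by (simp add: mult.commute)
    then have "real i0 * real i0 \<le> real n" using i0sq by linarith
    then have "i0 * i0 \<le> n" by (metis of_nat_le_iff of_nat_mult)
    moreover have "1000 * i0 \<le> i0 * i0" using i0b by (intro mult_right_mono) auto
    ultimately show ?thesis by linarith
  qed
  have k1: "4 * k1 \<le> 3 * n" "3 * n < 4 * k1 + 4" by (auto simp: k1_def)
  have k01: "k0 < k1" using k1 i0n a n by (simp add: k0_def)
  have k1n: "k1 < n" using k1 n0 by linarith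
  have k0n: "n \<le> 2 * k0" using a by (simp add: k0_def)
  interpret blocks n b a k0 k1
    by unfold_locales (use b i0b a k01 k1n in \<open>auto simp: k0_def\<close>)
  have N0: "N a > 0" using N_pos a k01 k1n by (simp add: k0_def)
  \<comment> \<open>There are at most \<open>n / 4\<close> runs, each of mass at most
    \<open>N k0 / b\<close>, and \<open>ep\<close> is \<open>4 / n\<close>.\<close>
  have epA': "ep * A (Suc k1) \<le> N k0 / real b"
  proof -
    have len: "4 * (Suc k1 - (k0 + 1 - b)) \<le> n"
      using k1 k01 i0b a by (simp add: k0_def)
    have "A (Suc k1) \<le> real (Suc k1 - (k0 + 1 - b)) * (N k0 / real b)"
      using A_diff_le[of "k0 + 1 - b" "Suc k1"] A_start k01 by simp
    also have "\<dots> \<le> (real n / 4) * (N k0 / real b)"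
      using len N_nonneg[of k0] b0 by (intro mult_right_mono) auto
    finally have "ep * A (Suc k1) \<le> ep * ((real n / 4) * (N k0 / real b))"
      using ep0 by (intro mult_left_mono) auto
    then show ?thesis using n0 by (simp add: ep_def)
  qed
  have reservoir': "(1 + ep) * (N k0 * 20 / real b) \<le> N a - N (k0 - 15)"
  proof -
    define i where "i = i0 - 15"
    have i: "k0 - 15 = a + i" "real i = real i0 - 15" using i0b by (auto simp: i_def k0_def)
    have "8 * q \<le> real i" using i i0 qbig by linarith
    then have "(8 * q) * (8 * q) \<le> real i * real i" using qbig b0 by (intro mult_mono) auto
    then have "64 * (real n / real b) \<le> (real i)\<^sup>2" using qq by (simp add: power2_eq_square)
    then have e: "64 / real b \<le> (real i)\<^sup>2 / real n" using n0 b0 by (simp add: field_simps)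
    have "N (k0 - 15) * (1 + 64 / real b) \<le> (N a * exp (- (real i)\<^sup>2 / real n)) * exp ((real i)\<^sup>2 / real n)"
    proof (rule mult_mono)
      show "N (k0 - 15) \<le> N a * exp (- (real i)\<^sup>2 / real n)"
        unfolding N_def i(1) by (rule binomial_upper_gauss[OF a(1)]) (use i0b k01 k1n in \<open>auto simp: i_def k0_def\<close>)
      show "1 + 64 / real b \<le> exp ((real i)\<^sup>2 / real n)"
        using exp_ge_add_one_self[of "(real i)\<^sup>2 / real n"] e by linarith
    qed (use N_nonneg in auto)
    also have "\<dots> = N a" by (simp add: mult.assoc flip: exp_add)
    finally have "N (k0 - 15) * (64 / real b) \<le> N a - N (k0 - 15)" by (simp add: distrib_left)
    moreover have "N k0 * (64 / real b) \<le> N (k0 - 15) * (64 / real b)"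
      using N_anti[of "k0 - 15" k0] i by (intro mult_right_mono) auto
    moreover have "(1 + ep) * (N k0 * 20 / real b) \<le> 2 * (N k0 * 20 / real b)"
      using N_nonneg[of k0] n by (intro mult_right_mono) (auto simp: ep_def)
    moreover have "2 * (N k0 * 20 / real b) \<le> N k0 * (64 / real b)"
      using N_nonneg[of k0] b0 by (simp add: field_simps)
    ultimately show ?thesis by linarith
  qed
  interpret calibrated_blocks n b a k0 k1
    by unfold_locales (rule epA', rule reservoir')
  have b5k0: "144 * b ^ 5 \<le> k0" using b(2) k0n by linarith
  obtain \<phi> where \<phi>: "\<phi> \<in> Pow {1..n} \<rightarrow>\<^sub>E {..<b}"
    and c1: "\<And>j y t. k0 \<le> j \<Longrightarrow> j \<le> k1 \<Longrightarrow> y \<in> level n (j + 16) \<Longrightarrow> t < b \<Longrightarrow>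
       (1 - 1 / real n) * real ((j + 16) choose j) * cmean n b j t
         \<le> (\<Sum>x\<in>below y j. of_bool (\<phi> x = t) * cfl n b \<phi> x)"
    and r1: "\<And>j x t. k0 < j + 16 \<Longrightarrow> j + 16 \<le> k1 \<Longrightarrow> x \<in> level n j \<Longrightarrow> t < b \<Longrightarrow>
       (\<Sum>y\<in>above n x (j + 16). of_bool (\<phi> y = t) * rfl n b \<phi> y)
         \<le> (1 + 1 / real n) * real ((n - j) choose 16) * rmean b t"
    using good_colouring[of n b k0 k1] n b b5k0 k0n k1 by auto
  interpret coloured_blocks n b a k0 k1 \<phi>
  proof
    show "\<phi> \<in> Pow {1..n} \<rightarrow>\<^sub>E {..<b}" by (rule \<phi>)
    show "144 * b ^ 5 \<le> k0" by (rule b5k0)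
    show "2 \<le> n" using n by simp
  next
    fix j k y t assume *: "k0 \<le> j" "j \<le> k1" "y \<in> level n k" "j + 16 \<le> k" "t < b"
    show "(1 - 1 / real n) * cmean n b j t * real (k choose j) \<le> (\<Sum>x\<in>below y j. of_bool (\<phi> x = t) * cfl n b \<phi> x)"
    proof (rule spread_below[OF *(3,4)])
      fix u assume "u \<in> level n (j + 16)"
      then show "(1 - 1 / real n) * cmean n b j t * real ((j + 16) choose j) \<le> (\<Sum>x\<in>below u j. of_bool (\<phi> x = t) * cfl n b \<phi> x)"
        using c1[OF *(1,2) _ *(5)] by (simp add: mult_ac)
    qed
  next
    fix i k x t assume *: "k0 < k" "k \<le> k1" "x \<in> level n i" "i + 16 \<le> k" "t < b"
    show "(\<Sum>y\<in>above n x k. of_bool (\<phi> y = t) * rfl n b \<phi> y) \<le> (1 + 1 / real n) * rmean b t * real ((n - i) choose (k - i))"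
    proof (rule spread_above[OF *(3,4)])
      show "k \<le> n" using * k1n by simp
      fix u assume "u \<in> level n (k - 16)"
      then show "(\<Sum>y\<in>above n u k. of_bool (\<phi> y = t) * rfl n b \<phi> y) \<le> (1 + 1 / real n) * rmean b t * real ((n - (k - 16)) choose 16)"
        using r1[of "k - 16" u t] * by (simp add: mult_ac)
    qed
  qed
  obtain p where p: "inj_on p {y. y \<subseteq> {1..n} \<and> a < card y}"
    "\<forall>y. y \<subseteq> {1..n} \<longrightarrow> a < card y \<longrightarrow> a \<le> card (p y) \<and> p y \<subset> y \<and> (card y \<le> k1 \<longrightarrow> height (p y) < height y)"
    using predecessor_map by blast
  define S where "S = (\<Sum>h=k0..k1. N h)"
  have bA: "real b * A (Suc k1) = real (b - 1) * N k0 + S"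
  proof -
    have "real b * A (Suc k1) = (\<Sum>h=k0+1-b..<Suc k1. N (max h k0))"
      unfolding A_def m_def sum_distrib_left using b0 by (intro sum.cong) auto
    also have "\<dots> = (\<Sum>h=k0+1-b..<k0. N (max h k0)) + (\<Sum>h=k0..<Suc k1. N (max h k0))"
      using k01 b by (intro sum.atLeastLessThan_concat[symmetric]) auto
    also have "(\<Sum>h=k0+1-b..<k0. N (max h k0)) = real (b - 1) * N k0"
    proof -
      have "(\<Sum>h=k0+1-b..<k0. N (max h k0)) = (\<Sum>h=k0+1-b..<k0. N k0)"
        by (rule sum.cong) (auto simp: max_def)
      then show ?thesis using bk0 b by simp
    qed
    also have "(\<Sum>h=k0..<Suc k1. N (max h k0)) = S"
      unfolding S_def by (rule sum.cong) (auto simp: max_def)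
    finally show ?thesis .
  qed
  \<comment> \<open>The levels below \<open>k0\<close> account for \<open>i0\<close>; the
    \<open>b - 1\<close> runs begun below \<open>k0\<close>, the phase added in \<open>pos\<close>
    and the counting of both end points account for \<open>2 * b\<close>.\<close>
  define Hr where "Hr = real i0 + 2 * real b + S / N k0"
  define H where "H = nat \<lfloor>Hr\<rfloor>"
  have S0: "0 \<le> S / N k0" unfolding S_def using N_nonneg Nk0 by (intro divide_nonneg_pos sum_nonneg) auto
  have hr: "a \<le> height y \<and> height y < a + H" if y: "y \<subseteq> {1..n}" "a \<le> card y" "card y \<le> k1" for y
  proof -
    have yl: "y \<in> level n (card y)" using y by (simp add: level_def)
    have h1: "a \<le> height y" and h2: "real (height y) \<le> real k0 + real b * A (Suc k1) / N k0 + real b"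
      using height_range[OF yl y(2,3)] by auto
    have "real b * A (Suc k1) / N k0 = real (b - 1) + S / N k0"
      using Nk0 by (simp add: bA add_divide_distrib)
    then have "real (height y) - real a + 1 \<le> Hr"
      using h2 b by (simp add: Hr_def k0_def of_nat_diff)
    then have "int (height y) - int a + 1 \<le> \<lfloor>Hr\<rfloor>"
      by (simp add: le_floor_iff)
    then show ?thesis using h1 by (simp add: H_def)
  qed
  have "\<exists>P. chain_partition n P \<and> card P = n choose (n div 2) \<and>
    (\<forall>C\<in>P. card {x\<in>C. n - k1 \<le> card x \<and> card x \<le> k1} \<le> 2 * H)"
    by (rule chain_partition_from_predecessors[OF a_def p(1), where f = height]) (use p(2) hr in auto)
  then obtain P where P: "chain_partition n P" "card P = n choose (n div 2)"
    "\<And>C. C \<in> P \<Longrightarrow> card {x\<in>C. n - k1 \<le> card x \<and> card x \<le> k1} \<le> 2 * H" by blast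
  define s where "s = 2 ^ n / N a"
  have nd: "n choose (n div 2) = n choose a"
  proof -
    have "a \<le> n" "n - a = n div 2" using n by (auto simp: a_def)
    then show ?thesis using binomial_symmetric[of a n] by simp
  qed
  have s_eq: "2 ^ n / real (n choose (n div 2)) = s" by (simp add: s_def N_def nd)
  have Nk: "N a / N k0 \<le> 1 + 800 / real b"
  proof -
    have "real i0 * 1 \<le> real i0 * real i0" using i0b by (intro mult_left_mono) auto
    then have "2 * real i0 * (real i0 + 1) \<le> 4 * (real i0 * real i0)" by (simp add: algebra_simps)
    also have "\<dots> \<le> 400 * (real n / real b)" using i0sq by simp
    finally have "2 * real i0 * (real i0 + 1) / real n \<le> 400 / real b"
      using n0 b0 by (simp add: field_simps)
    then have "N a * (1 - 400 / real b) \<le> N a * (1 - 2 * real i0 * (real i0 + 1) / real n)"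
      using N_nonneg by (intro mult_left_mono) auto
    also have "\<dots> \<le> N k0"
      unfolding N_def k0_def by (rule binomial_lower_quadratic[OF a]) (use k01 k1n in \<open>simp add: k0_def\<close>)
    finally have "N a * (1 - 400 / real b) * (1 + 800 / real b) \<le> N k0 * (1 + 800 / real b)"
      using b0 by (intro mult_right_mono) auto
    moreover have "N a * 1 \<le> N a * ((1 - 400 / real b) * (1 + 800 / real b))"
    proof (rule mult_left_mono)
      have "(1 - 400 / real b) * (1 + 800 / real b) - 1 = (400 - 320000 / real b) / real b"
        using b0 by (simp add: field_simps)
      moreover have "0 \<le> (400 - 320000 / real b) / real b" using b b0 by (simp add: field_simps)
      ultimately show "1 \<le> (1 - 400 / real b) * (1 + 800 / real b)" by linarith
    qed (use N_nonneg in auto)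
    ultimately have "N a \<le> (1 + 800 / real b) * N k0" by (simp add: mult_ac)
    then show ?thesis using Nk0 by (simp add: divide_le_eq)
  qed
  have s6: "sqrt (real n) / 6 \<le> s"
    using average_chain_size_ge[OF a_def] n N0 by (simp add: s_def N_def pos_le_divide_eq)
  \<comment> \<open>The additive term \<open>4 * b\<close> of the chain sizes must be small against
    \<open>s / b\<close>. As \<open>b^5\<close> is at most of order \<open>n\<close>,
    \<open>b^2\<close> is at most of order \<open>sqrt n\<close>, and so is bounded by a multiple of
    \<open>s\<close>.\<close>
  have sb: "805 * (real b)\<^sup>2 \<le> 8200 * s - 800"
  proof -
    have "(30 * (real b)\<^sup>2)\<^sup>2 \<le> real n"
    proof -
      have "(30 * (real b)\<^sup>2)\<^sup>2 = 900 * real b ^ 4" by (simp add: eval_nat_numeral)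
      also have "\<dots> \<le> 54000 * (real b ^ 4 * real b)"
        using qbig(2) by (intro mult_mono) auto
      also have "\<dots> = 54000 * real b ^ 5" by (simp add: eval_nat_numeral)
      finally show ?thesis using nb5 by linarith
    qed
    then have "30 * (real b)\<^sup>2 \<le> sqrt (real n)" by (rule real_le_rsqrt)
    then have "5 * (real b)\<^sup>2 \<le> s" using s6 by linarith
    then show ?thesis using bb qbig(2) by linarith
  qed
  have "real (2 * H) \<le> s * (1 + 9000 / real b)"
  proof -
    have "real H \<le> Hr"
      using S0 by (simp add: H_def Hr_def)
    \<comment> \<open>Levels from \<open>a\<close> up to \<open>k0\<close> are at least as large as
      level \<open>k0\<close>, so their number is at most their total size divided by
      \<open>N k0\<close>; this reduces the count to the upper half sum.\<close>
    moreover have "real i0 + S / N k0 \<le> (\<Sum>k=a..n. N k) / N k0"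
    proof -
      have "real i0 = (\<Sum>k=a..<k0. N k0 / N k0)" using Nk0 by (simp add: k0_def)
      also have "\<dots> \<le> (\<Sum>k=a..<k0. N k / N k0)"
        using Nk0 N_anti by (intro sum_mono divide_right_mono) auto
      finally have "real i0 + S / N k0 \<le> ((\<Sum>k=a..<k0. N k) + (\<Sum>k=k0..<Suc k1. N k)) / N k0"
        by (simp add: S_def sum_divide_distrib add_divide_distrib atLeastLessThanSuc_atLeastAtMost)
      also have "(\<Sum>k=a..<k0. N k) + (\<Sum>k=k0..<Suc k1. N k) = (\<Sum>k=a..<Suc k1. N k)"
        using k01 by (intro sum.atLeastLessThan_concat) (auto simp: k0_def)
      also have "(\<Sum>k=a..<Suc k1. N k) / N k0 \<le> (\<Sum>k=a..n. N k) / N k0"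
        using k1n Nk0 N_nonneg by (intro divide_right_mono sum_mono2) auto
      finally show ?thesis .
    qed
    ultimately have "real (2 * H) \<le> 4 * real b + 2 * ((\<Sum>k=a..n. N k) / N k0)"
      by (simp add: Hr_def)
    also have "2 * ((\<Sum>k=a..n. N k) / N k0) \<le> (2 ^ n + N a) / N k0"
      using divide_right_mono[OF upper_half_sum[OF a_def], of "N k0"] Nk0 by (simp add: N_def)
    also have "(2 ^ n + N a) / N k0 = (s + 1) * (N a / N k0)"
    proof -
      have "(s + 1) * N a = 2 ^ n + N a" using N0 by (simp add: s_def distrib_right)
      then show ?thesis by simp
    qed
    also have "(s + 1) * (N a / N k0) \<le> (s + 1) * (1 + 800 / real b)"
    proof -
      have "0 \<le> sqrt (real n) / 6" by simp
      then have "0 \<le> s + 1" using s6 by linarith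
      then show ?thesis by (rule mult_left_mono[OF Nk])
    qed
    also have "4 * real b + (s + 1) * (1 + 800 / real b) \<le> s * (1 + 9000 / real b)"
    proof -
      have "4 * (real b)\<^sup>2 + real b + 800 \<le> 8200 * s" using sb bb qbig(2) by linarith
      then have "(4 * (real b)\<^sup>2 + real b + 800) / real b \<le> 8200 * s / real b"
        using b0 by (intro divide_right_mono) auto
      then have "4 * real b + 1 + 800 / real b \<le> 8200 * s / real b"
        using b0 by (simp add: add_divide_distrib power2_eq_square)
      moreover define z where "z = s / real b"
      moreover have "8200 * s / real b = 8200 * z" "s * (1 + 9000 / real b) = s + 9000 * z"
        "(s + 1) * (1 + 800 / real b) = s + 1 + 800 * z + 800 / real b"
        by (simp_all add: z_def algebra_simps add_divide_distrib)
      ultimately show ?thesis by linarith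
    qed
    finally show ?thesis by simp
  qed
  then have "real (card {x\<in>C. n - k1 \<le> card x \<and> card x \<le> k1}) \<le> s * (1 + 9000 / real b)" if "C \<in> P" for C
    using P(3)[OF that] by (meson of_nat_le_iff order_trans)
  then show ?thesis
    using P(1,2) unfolding s_eq k1_def by blast
qed

text \<open>With \<open>n = r^16\<close> and \<open>b\<close> about \<open>r^3\<close>, the factor
  \<open>r >= 54000\<close> left over from \<open>b^5\<close> meets the condition of
  \<open>balanced_chain_partition\<close>. The deviation constant 54000 is twice
  \<open>3 * 9000\<close>, which turns the bound of \<open>bad_chain_count\<close> into
  \<open>r / (2 * b)\<close>, at most \<open>1 / r^2\<close> with constant 1.\<close>

lemma few_bad_chains:
  fixes r :: real
  assumes r: "r = real n powr (1 / 16)" "54000 \<le> r"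
  shows "\<exists>P. chain_partition n P \<and> card P = n choose (n div 2) \<and>
    real (card {C \<in> P. \<not> (\<bar>real (card C) - 2 ^ n / real (n choose (n div 2))\<bar> \<le> 54000 / r * (2 ^ n / real (n choose (n div 2))))})
      \<le> 1 / r\<^sup>2 * real (n choose (n div 2))"
proof -
  define b where "b = nat \<lfloor>r ^ 3\<rfloor>"
  define M where "M = n choose (n div 2)"
  define k1 where "k1 = 3 * n div 4"
  have n0: "n > 0"
  proof (rule ccontr)
    assume "\<not> n > 0"
    then have "r = 0" by (simp add: r(1))
    then show False using r(2) by simp
  qed
  have r0: "r > 0" using r(2) by linarith
  have nr: "real n = r ^ 16" using n0 by (simp add: r(1) powr_power)
  have r3: "54000 * 54000 * 54000 \<le> r ^ 3"
    using power_mono[OF r(2), of 3] by simp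
  have b: "real b \<le> r ^ 3" "r ^ 3 - 1 \<le> real b"
  proof -
    have "0 \<le> \<lfloor>r ^ 3\<rfloor>" using r0 by simp
    then have "real b = of_int \<lfloor>r ^ 3\<rfloor>" by (simp add: b_def)
    then show "real b \<le> r ^ 3" "r ^ 3 - 1 \<le> real b" by linarith+
  qed
  have b1: "1000 \<le> real b" "r ^ 3 / 2 \<le> real b" using b r3 by linarith+
  have b5: "54000 * b ^ 5 \<le> n"
  proof -
    have "54000 * real b ^ 5 \<le> r * (r ^ 3) ^ 5"
      using b r(2) r0 by (intro mult_mono power_mono) auto
    also have "\<dots> = real n" by (simp add: nr flip: power_mult power_Suc)
    finally have "real (54000 * b ^ 5) \<le> real n" by simp
    then show ?thesis by (simp only: of_nat_le_iff)
  qed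
  have n16: "n \<ge> 2 ^ 16"
  proof -
    have "(2::real) ^ 16 \<le> r ^ 16" using r(2) by (intro power_mono) auto
    then have "real (2 ^ 16) \<le> real n" by (simp add: nr)
    then show ?thesis by (simp only: of_nat_le_iff)
  qed
  have bn: "b \<le> n"
  proof -
    have "b ^ 1 \<le> b ^ 5" using b1 by (intro power_increasing) auto
    then show ?thesis using b5 by simp
  qed
  obtain P where P: "chain_partition n P" "card P = M"
    "\<And>C. C \<in> P \<Longrightarrow> real (card {x\<in>C. n - k1 \<le> card x \<and> card x \<le> k1}) \<le> 2 ^ n / real M * (1 + 9000 / real b)"
    using balanced_chain_partition[OF n16 _ b5] b1 unfolding M_def k1_def by auto
  have "real (card {C\<in>P. \<not> \<bar>real (card C) - 2 ^ n / real M\<bar> \<le> 54000 / r * (2 ^ n / real M)})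
    \<le> 3 * (9000 / real b) * real M / (54000 / r)"
  proof (rule bad_chain_count[where Q = "\<lambda>x. n - k1 \<le> card x \<and> card x \<le> k1"])
    show "partition_on (Pow {1..n}) P" using P(1) by (simp add: chain_partition_def)
    show "9000 / real b \<le> 54000 / r"
    proof -
      have "r * 1 \<le> r * (r * r)" using r(2) by (intro mult_left_mono) (auto intro: mult_ge1_I)
      then have "r \<le> r ^ 3" by (simp add: power3_eq_cube)
      then have "9000 * r \<le> 54000 * real b" using b1 r0 by linarith
      then show ?thesis using b1 r0 by (simp add: field_simps)
    qed
    show "real (card {x. x \<subseteq> {1..n} \<and> \<not> (n - k1 \<le> card x \<and> card x \<le> k1)}) \<le> 9000 / real b * real M"
      unfolding M_def using b1 bn by (intro tail_size[OF n16 k1_def]) auto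
  qed (use P b1 r(2) in \<open>auto simp: M_def\<close>)
  also have "\<dots> = r / (2 * real b) * real M" using r0 b1 by simp
  also have "\<dots> \<le> 1 / r\<^sup>2 * real M"
  proof (rule mult_right_mono)
    have "r * r\<^sup>2 \<le> 2 * real b" using b1 by (simp add: power3_eq_cube power2_eq_square)
    then show "r / (2 * real b) \<le> 1 / r\<^sup>2" using r0 b1 by (simp add: field_simps)
  qed simp
  finally show ?thesis using P(1,2) unfolding M_def by blast
qed

theorem theorem1p2:
  shows "\<exists>(K::real) (\<epsilon> :: nat \<Rightarrow> real). K > 0 \<and> \<epsilon> \<longlonglongrightarrow> 0 \<and>
    (\<forall>n::nat. n \<ge> 1 \<longrightarrow>
      (let M = n choose (n div 2); s = 2 ^ n / real M in
        \<exists>P. chain_partition n P \<and> card P = M \<and>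
          real (card {C \<in> P. \<not> (\<bar>real (card C) - s\<bar> \<le> K * s * real n powr (- 1 / 16))})
            \<le> real n powr (- 1 / 8 + \<epsilon> n) * real M))"
proof -
  \<comment> \<open>For small \<open>n\<close> the value \<open>1 / 8\<close> makes the exponent 0,
    so that all chains may be bad; for large \<open>n\<close> the estimate holds with exponent
    exactly \<open>- 1 / 8\<close>.\<close>
  define \<epsilon> :: "nat \<Rightarrow> real" where "\<epsilon> = (\<lambda>n. if 54000 \<le> real n powr (1 / 16) then 0 else 1 / 8)"
  have "\<epsilon> \<longlonglongrightarrow> 0"
  proof (rule tendsto_eventually)
    have "eventually (\<lambda>n. 54000 powr 16 \<le> real n) sequentially"
      using filterlim_real_sequentially by (simp add: filterlim_at_top)
    then have "eventually (\<lambda>n. 54000 \<le> real n powr (1 / 16)) sequentially"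
    proof eventually_elim
      case (elim n)
      then have "(54000 powr 16) powr (1 / 16) \<le> real n powr (1 / 16)"
        by (intro powr_mono2) auto
      moreover have "(54000 powr 16) powr (1 / 16) = (54000::real)"
        by (subst powr_powr) simp
      ultimately show ?case by (simp only:)
    qed
    then show "eventually (\<lambda>n. \<epsilon> n = 0) sequentially"
      by eventually_elim (simp add: \<epsilon>_def)
  qed
  moreover have "let M = n choose (n div 2); s = 2 ^ n / real M in
        \<exists>P. chain_partition n P \<and> card P = M \<and>
          real (card {C \<in> P. \<not> (\<bar>real (card C) - s\<bar> \<le> 54000 * s * real n powr (- 1 / 16))})
            \<le> real n powr (- 1 / 8 + \<epsilon> n) * real M" if n: "n \<ge> 1" for n
  proof (cases "54000 \<le> real n powr (1 / 16)")
    case True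
    define r where "r = real n powr (1 / 16)"
    have r0: "r > 0" using True unfolding r_def by linarith
    have e1: "54000 * s * real n powr (- 1 / 16) = 54000 / r * s" for s
      using n by (simp add: r_def powr_minus_divide)
    have "real n powr (- 1 / 8) = 1 / (real n powr (1 / 8))"
      using powr_minus_divide[of "real n" "1 / 8"] by simp
    also have "real n powr (1 / 8) = r\<^sup>2"
      using n by (simp add: r_def powr_power)
    finally have e2: "real n powr (- 1 / 8 + \<epsilon> n) = 1 / r\<^sup>2"
      using True by (simp add: \<epsilon>_def)
    show ?thesis
      using few_bad_chains[OF r_def] True unfolding Let_def e1 e2 r_def by simp
  next
    case False
    obtain P where P: "chain_partition n P" "card P = n choose (n div 2)"
      using minimum_chain_partition_exists[OF n] by blast
    have "P \<noteq> {}" using P(2) by (metis card.empty binomial_eq_0_iff div_le_dividend not_less)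
    then have "finite P" using P(2) by (metis card.infinite binomial_eq_0_iff div_le_dividend not_less)
    then have "card {C \<in> P. \<not> (\<bar>real (card C) - s\<bar> \<le> t)} \<le> card P" for s t
      by (intro card_mono) auto
    moreover have "real n powr (- 1 / 8 + \<epsilon> n) = 1" using False n by (simp add: \<epsilon>_def)
    ultimately show ?thesis
      using P unfolding Let_def by (intro exI[of _ P]) simp
  qed
  ultimately show ?thesis by (intro exI[of _ 54000] exI[of _ \<epsilon>]) auto
qed

end
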